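(* Let $m\ge1$. Let $F$ be a proper rational boundary component of $\mathfrak h_n$ of rank $n-1$, let $\gamma\in\Gamma(4m)$, and suppose $F^\gamma\neq\emptyset$. Then $F^\gamma$ is contained in the closure, in the Satake partial compactification $\overline{\mathfrak h}_n$, of the set $\bigcup_{\gamma'\in\Gamma(4m)}\mathfrak h_n^{\gamma'}$.
   Context: $\mathbf{Sp}(2n,\mathbb R)$: real matrices $g=\begin{pmatrix}A&B\\C&D\end{pmatrix}$ with ${}^tgJg=J$, $J=\begin{pmatrix}0&I\\-I&0\end{pmatrix}$, acting on $\mathfrak h_n=\{Z\in M_n(\mathbb C):{}^tZ=Z,\mathrm{Im}Z>0\}$ by $gZ=(AZ+B)(CZ+D)^{-1}$. $\tau\begin{pmatrix}A&B\\C&D\end{pmatrix}=\begin{pmatrix}A&-B\\-C&D\end{pmatrix}$ and $\tau(Z)=-\overline Z$; $\mathfrak h_n^\gamma=\{Z:\gamma Z=\tau(Z)\}$. $\Gamma(4m)=\{\gamma\in\mathbf{Sp}(2n,\mathbb Z):\gamma\equiv I\bmod 4m\}$. $\overline{\mathfrak h}_n$ is the Satake partial compactification (all rational boundary components attached, Satake topology), on which $\mathbf{Sp}(2n,\mathbb Q)$ acts and to which $\tau$ extends with $\tau(gx)=\tau(g)\tau(x)$. For $1\le q<n$ the standard boundary component $F_q$ is the image of $\mathfrak h_q$ under $Z\mapsto\lim_Y\begin{pmatrix}Z&0\\0&iY\end{pmatrix}$, the limit taken as the positive definite $(n-q)\times(n-q)$ matrix $Y$ goes to infinity (all eigenvalues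 $\to\infty$); a rational boundary component of rank $q$ is a set $gF_q$ with $g\in\mathbf{Sp}(2n,\mathbb Q)$. For a boundary component $F$ and $\gamma$, $F^\gamma=\{x\in F:\tau(x)=\gamma x\}$. *)

theory Defs
  imports "HOL-Analysis.Analysis" "Jordan_Normal_Form.Matrix"
begin

definition minv :: "'a::field mat \<Rightarrow> 'a mat" where
  "minv M = (SOME N. N \<in> carrier_mat (dim_row M) (dim_row M)
                   \<and> M * N = 1\<^sub>m (dim_row M) \<and> N * M = 1\<^sub>m (dim_row M))"

definition Jmat :: "nat \<Rightarrow> real mat" where
  "Jmat n = four_block_mat (0\<^sub>m n n) (1\<^sub>m n) (- 1\<^sub>m n) (0\<^sub>m n n)"

definition is_Sp :: "nat \<Rightarrow> real mat \<Rightarrow> bool" where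
  "is_Sp n g \<longleftrightarrow> g \<in> carrier_mat (2*n) (2*n) \<and> transpose_mat g * Jmat n * g = Jmat n"

definition is_Sp_Q :: "nat \<Rightarrow> real mat \<Rightarrow> bool" where
  "is_Sp_Q n g \<longleftrightarrow> is_Sp n g \<and> (\<forall>i<2*n. \<forall>j<2*n. g $$ (i,j) \<in> \<rat>)"

definition is_Sp_Z :: "nat \<Rightarrow> real mat \<Rightarrow> bool" where
  "is_Sp_Z n g \<longleftrightarrow> is_Sp n g \<and> (\<forall>i<2*n. \<forall>j<2*n. g $$ (i,j) \<in> \<int>)"

definition Gamma_level :: "nat \<Rightarrow> nat \<Rightarrow> real mat \<Rightarrow> bool" where
  "Gamma_level n N g \<longleftrightarrow> is_Sp_Z n g \<and>
     (\<forall>i<2*n. \<forall>j<2*n. \<exists>k::int. g $$ (i,j) - (1\<^sub>m (2*n) :: real mat) $$ (i,j) = real N * of_int k)"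

definition blkA :: "nat \<Rightarrow> 'a mat \<Rightarrow> 'a mat" where
  "blkA n g = mat n n (\<lambda>(i,j). g $$ (i,j))"
definition blkB :: "nat \<Rightarrow> 'a mat \<Rightarrow> 'a mat" where
  "blkB n g = mat n n (\<lambda>(i,j). g $$ (i,j+n))"
definition blkC :: "nat \<Rightarrow> 'a mat \<Rightarrow> 'a mat" where
  "blkC n g = mat n n (\<lambda>(i,j). g $$ (i+n,j))"
definition blkD :: "nat \<Rightarrow> 'a mat \<Rightarrow> 'a mat" where
  "blkD n g = mat n n (\<lambda>(i,j). g $$ (i+n,j+n))"

definition pos_def :: "nat \<Rightarrow> real mat \<Rightarrow> bool" where
  "pos_def n Y \<longleftrightarrow> Y \<in> carrier_mat n n \<and> transpose_mat Y = Y \<and>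
     (\<forall>x \<in> carrier_vec n. x \<noteq> 0\<^sub>v n \<longrightarrow> x \<bullet> (Y *\<^sub>v x) > 0)"

definition siegel :: "nat \<Rightarrow> complex mat \<Rightarrow> bool" where
  "siegel n Z \<longleftrightarrow> Z \<in> carrier_mat n n \<and> transpose_mat Z = Z \<and> pos_def n (map_mat Im Z)"

definition sp_act :: "nat \<Rightarrow> real mat \<Rightarrow> complex mat \<Rightarrow> complex mat" where
  "sp_act n g Z = (let g' = map_mat complex_of_real g in
      (blkA n g' * Z + blkB n g') * minv (blkC n g' * Z + blkD n g'))"

definition tau_g :: "nat \<Rightarrow> real mat \<Rightarrow> real mat" where
  "tau_g n g = four_block_mat (blkA n g) (- blkB n g) (- blkC n g) (blkD n g)"

definition tau_pt :: "complex mat \<Rightarrow> complex mat" where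
  "tau_pt Z = map_mat (\<lambda>z. - cnj z) Z"

definition fixed_set :: "nat \<Rightarrow> real mat \<Rightarrow> complex mat set" where
  "fixed_set n \<gamma> = {Z. siegel n Z \<and> sp_act n \<gamma> Z = tau_pt Z}"

text \<open>The standard boundary component F_{n-1} is identified with h_{n-1}: the point iota(Z) is
  lim_{y\<rightarrow>\<infinity>} diag(Z, iy).  A rational boundary component of rank n-1 is g F_{n-1},
  g in Sp(2n,Q), and its points are g iota(Z), Z in h_{n-1}.  Such a point is represented by the
  pair (g, Z).

  The stabiliser P of F_{n-1} in Sp(2n,Q) consists of the h whose column with index n-1
  (0-based; i.e. the n-th column) is a multiple of the n-th standard basis vector, i.e. h stabilises
  the isotropic line Q e_n.  It acts on F_{n-1} = h_{n-1} through its Levi projection, the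
  2(n-1) x 2(n-1) symplectic matrix obtained by deleting the rows and columns with (0-based)
  indices n-1 and 2n-1.\<close>

definition stab_bc :: "nat \<Rightarrow> real mat \<Rightarrow> bool" where
  "stab_bc n h \<longleftrightarrow> (\<forall>i<2*n. i \<noteq> n - 1 \<longrightarrow> h $$ (i, n - 1) = 0)"

definition levi_proj :: "nat \<Rightarrow> real mat \<Rightarrow> real mat" where
  "levi_proj n h = (let idx = (\<lambda>i. if i < n - 1 then i else i + 1) in
      mat (2*(n-1)) (2*(n-1)) (\<lambda>(i,j). h $$ (idx i, idx j)))"

definition bpt_eq :: "nat \<Rightarrow> real mat \<times> complex mat \<Rightarrow> real mat \<times> complex mat \<Rightarrow> bool" where
  "bpt_eq n p p' = (case p of (g, Z) \<Rightarrow> case p' of (g', Z') \<Rightarrow>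
      (let h = minv g * g' in stab_bc n h \<and> Z = sp_act (n - 1) (levi_proj n h) Z'))"

text \<open>F^gamma for F = g F_{n-1}, as the set of Z in h_{n-1} such that x = g iota(Z) satisfies
  tau(x) = gamma x, where tau(g iota(Z)) = tau(g) iota(tau Z) and gamma (g iota(Z)) = (gamma g) iota(Z).\<close>
definition bc_fixed :: "nat \<Rightarrow> real mat \<Rightarrow> real mat \<Rightarrow> complex mat set" where
  "bc_fixed n g \<gamma> = {Z. siegel (n - 1) Z \<and> bpt_eq n (tau_g n g, tau_pt Z) (\<gamma> * g, Z)}"

text \<open>For W in h_n write W = [[W1, w],[w^t, w']] with W1 of size (n-1).  The height
  t(W) = Im w' - (Im w)^t (Im W1)^{-1} (Im w).  In the Satake topology, the sets
  {W in h_n : W1 in V, t(W) > T} (V a neighbourhood of Z0 in h_{n-1}, T real) together with the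
  corresponding points of F_{n-1} form a neighbourhood basis of iota(Z0); neighbourhoods of
  g iota(Z0) are their g-translates.\<close>

definition height :: "nat \<Rightarrow> complex mat \<Rightarrow> real" where
  "height n W = (let Y = map_mat Im W;
                     Y1 = mat (n-1) (n-1) (\<lambda>(i,j). Y $$ (i,j));
                     y = vec (n-1) (\<lambda>i. Y $$ (i, n-1))
                 in Y $$ (n-1, n-1) - y \<bullet> (minv Y1 *\<^sub>v y))"

definition in_satake_closure :: "nat \<Rightarrow> complex mat set \<Rightarrow> real mat \<Rightarrow> complex mat \<Rightarrow> bool" where
  "in_satake_closure n S g Z0 \<longleftrightarrow>
     (\<forall>\<epsilon>>0. \<forall>T::real. \<exists>W. siegel n W
        \<and> (\<forall>i<n-1. \<forall>j<n-1. cmod (W $$ (i,j) - Z0 $$ (i,j)) < \<epsilon>)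
        \<and> height n W > T \<and> sp_act n g W \<in> S)"

end

theory Submission
  imports Defs "Jordan_Normal_Form.Spectral_Radius"
begin

text \<open>
  Write \<open>T = diag(1,-1)\<close>, so that \<open>\<tau>(g) = TgT\<close>, and let \<open>x = g\<iota>(Z)\<close> satisfy \<open>\<gamma>x = \<tau>(x)\<close>.
  The element \<open>u = \<tau>(\<gamma>)\<gamma>\<close> lies in \<open>\<Gamma>(8m)\<close> and fixes \<open>x\<close>. Its eigenvalues have modulus 1, so the
  integral matrix \<open>(u-1)/8m\<close> has spectral radius at most 1/4; its powers tend to 0, so it is nilpotent.
  As \<open>u\<close> acts on the Levi quotient by an isometry, it acts trivially there, and \<open>(u-1)\<^sup>3 = 0\<close>.
  Therefore \<open>u\<close> has the inverse square root \<open>r = 1 - N/2 + 3N\<^sup>2/8\<close>, \<open>N = u - 1\<close>, in \<open>\<Gamma>(4m)\<close>, and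
  \<open>\<gamma>' = \<gamma>r\<close> still satisfies \<open>\<gamma>'x = \<tau>(x)\<close> but now \<open>\<tau>(\<gamma>')\<gamma>' = 1\<close>. The antiholomorphic involution
  \<open>W \<mapsto> \<tau>(\<gamma>'W)\<close> preserves the fibre over \<open>x\<close>, which consists of the \<open>gW\<close> with
  \<open>W = (Z, w; w\<^sup>T, \<omega>)\<close>; it is affine in \<open>w\<close> and preserves \<open>Im \<omega>\<close> once \<open>w\<close> is fixed, so it has fixed points
  of arbitrarily large height.
\<close>

unbundle no inner_syntax and no vec_syntax

text \<open>In general \<open>\<gamma>\<close> itself has to be abandoned. A point of
  \<open>h_n\<close> with \<open>\<gamma>Z = \<tau>(Z)\<close> is fixed by \<open>u\<close>;
  stabilisers in a discrete group are finite and \<open>\<Gamma>(8m)\<close> is torsion-free, so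
  \<open>u = 1\<close>. For \<open>u \<noteq> 1\<close> the set of such points is therefore empty,
  and some other element of \<open>\<Gamma>(4m)\<close> must serve near \<open>x\<close>. The
  passage from level \<open>4m\<close> to level \<open>8m\<close> pays for the denominators 2 and 8
  in \<open>r\<close>: with \<open>N = 8mY\<close>, \<open>Y\<close> integral, both
  \<open>N/2\<close> and \<open>3N^2/8\<close> are \<open>4m\<close> times an integral matrix.
  Rationality of \<open>g\<close> makes the stabilised line rational. The scalar on it is then an
  eigenvalue of an integral matrix with integral inverse on a rational vector, hence a sign; this is
  why the eigenvalues of \<open>u\<close> coming from that line have modulus 1. Fractions are
  avoided: a point \<open>W\<close> stands for the span of the columns of \<open>W\<close> stacked
  on 1, and \<open>g\<close> acts by \<open>g (W; 1) = (gW; 1) K\<close>. When \<open>g\<close>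
  fixes \<open>W\<close>, the factor \<open>K\<close> is unitary for \<open>Im W\<close>, which
  gives both the eigenvalues and the triviality of unipotent elements.\<close>

abbreviation cplx :: "real mat \<Rightarrow> complex mat" where "cplx \<equiv> map_mat complex_of_real"
abbreviation conj_mat :: "complex mat \<Rightarrow> complex mat" where "conj_mat \<equiv> map_mat cnj"

interpretation cnj_hom: comm_ring_hom cnj
  by unfold_locales auto

text \<open>Side conditions on dimensions instead of carriers contain no schematic sizes, so the simplifier can discharge them.\<close>

lemma assoc_mult_mat_dim: "dim_col A = dim_row B \<Longrightarrow> dim_col B = dim_row C \<Longrightarrow> A * B * C = A * (B * C)"
  for A :: "'a::semiring_0 mat"
  by (rule assoc_mult_mat) auto
lemma add_mult_distrib_mat_dim:
  "dim_row A = dim_row B \<Longrightarrow> dim_col A = dim_row C \<Longrightarrow> dim_col B = dim_row C \<Longrightarrow> (A + B) * C = A * C + B * C"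
  for A :: "'a::semiring_0 mat"
  by (rule add_mult_distrib_mat) auto
lemma mult_add_distrib_mat_dim:
  "dim_col A = dim_row B \<Longrightarrow> dim_row B = dim_row C \<Longrightarrow> dim_col B = dim_col C \<Longrightarrow> A * (B + C) = A * B + A * C"
  for A :: "'a::semiring_0 mat"
  by (rule mult_add_distrib_mat) auto
lemma minus_mult_distrib_mat_dim:
  "dim_row A = dim_row B \<Longrightarrow> dim_col A = dim_row C \<Longrightarrow> dim_col B = dim_row C \<Longrightarrow> (A - B) * C = A * C - B * C"
  for A :: "'a::ring mat"
  by (rule minus_mult_distrib_mat) auto
lemma mult_minus_distrib_mat_dim:
  "dim_col A = dim_row B \<Longrightarrow> dim_row B = dim_row C \<Longrightarrow> dim_col B = dim_col C \<Longrightarrow> A * (B - C) = A * B - A * C"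
  for A :: "'a::ring mat"
  by (rule mult_minus_distrib_mat) auto
lemma transpose_mult_dim: "dim_col A = dim_row B \<Longrightarrow> (A * B)\<^sup>T = B\<^sup>T * A\<^sup>T"
  for A :: "'a::comm_semiring_0 mat"
  by (rule transpose_mult) auto
lemma transpose_add_dim: "dim_row A = dim_row B \<Longrightarrow> dim_col A = dim_col B \<Longrightarrow> (A + B)\<^sup>T = A\<^sup>T + B\<^sup>T"
  by (rule transpose_add) auto
lemma smult_mult_mat_dim: "dim_col A = dim_row B \<Longrightarrow> (c \<cdot>\<^sub>m A) * B = c \<cdot>\<^sub>m (A * B)"
  for A :: "'a::comm_semiring_0 mat"
  by (rule mult_smult_assoc_mat) auto
lemma mult_smult_mat_dim: "dim_col A = dim_row B \<Longrightarrow> A * (c \<cdot>\<^sub>m B) = c \<cdot>\<^sub>m (A * B)"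
  for A :: "'a::comm_semiring_0 mat"
  by (rule mult_smult_distrib) auto
lemma one_mult_mat_dim: "dim_row A = n \<Longrightarrow> 1\<^sub>m n * A = A" "dim_col A = n \<Longrightarrow> A * 1\<^sub>m n = A"
  for A :: "'a::semiring_1 mat"
  by auto
lemma zero_mult_mat_dim:
  "dim_row A = n \<Longrightarrow> 0\<^sub>m k n * A = 0\<^sub>m k (dim_col A)" "dim_col A = n \<Longrightarrow> A * 0\<^sub>m n k = 0\<^sub>m (dim_row A) k"
  for A :: "'a::semiring_0 mat"
  by auto
lemma zero_add_mat_dim:
  "dim_row A = n \<Longrightarrow> dim_col A = k \<Longrightarrow> 0\<^sub>m n k + A = A" "dim_row A = n \<Longrightarrow> dim_col A = k \<Longrightarrow> A + 0\<^sub>m n k = A"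
  for A :: "'a::monoid_add mat"
  by auto
lemma uminus_zero_mat: "- 0\<^sub>m n k = (0\<^sub>m n k :: 'a::group_add mat)"
  by (intro eq_matI) auto

lemmas mat_dim_simps = assoc_mult_mat_dim add_mult_distrib_mat_dim mult_add_distrib_mat_dim
  minus_mult_distrib_mat_dim mult_minus_distrib_mat_dim transpose_mult_dim smult_mult_mat_dim
  mult_smult_mat_dim one_mult_mat_dim zero_mult_mat_dim zero_add_mat_dim uminus_zero_mat

section \<open>Inverses, and matrices stacked from two blocks\<close>

text \<open>\<open>minv\<close> is a Hilbert choice and says nothing until some inverse is
  exhibited. Over a field a right inverse is two-sided, hence unique.\<close>

lemma minv_eqI:
  assumes M: "M \<in> carrier_mat n n" and N: "N \<in> carrier_mat n n" and MN: "M * N = 1\<^sub>m n"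
  shows "minv M = N"
proof -
  have NM: "N * M = 1\<^sub>m n" using mat_mult_left_right_inverse[OF M N MN] .
  have "\<exists>N. N \<in> carrier_mat (dim_row M) (dim_row M)
          \<and> M * N = 1\<^sub>m (dim_row M) \<and> N * M = 1\<^sub>m (dim_row M)"
    using M N MN NM by auto
  from someI_ex[OF this, folded minv_def]
  have m: "minv M \<in> carrier_mat n n" "M * minv M = 1\<^sub>m n" using M by auto
  have "minv M = (N * M) * minv M" using NM m(1) by simp
  also have "\<dots> = N * (M * minv M)" using assoc_mult_mat[OF N M m(1)] .
  finally show ?thesis using m(2) N by simp
qed

lemma inverse_if_kernel_trivial:
  fixes M :: "'a::field mat"
  assumes M: "M \<in> carrier_mat n n"
    and ker: "\<And>x. x \<in> carrier_vec n \<Longrightarrow> M *\<^sub>v x = 0\<^sub>v n \<Longrightarrow> x = 0\<^sub>v n"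
  shows "minv M \<in> carrier_mat n n" "M * minv M = 1\<^sub>m n" "minv M * M = 1\<^sub>m n"
proof -
  have "det M \<noteq> 0" using det_0_iff_vec_prod_zero[OF M] ker by blast
  from det_non_zero_imp_unit[OF M this, of "()"] obtain N
    where N: "N \<in> carrier_mat n n" "M * N = 1\<^sub>m n" "N * M = 1\<^sub>m n"
    unfolding Units_def ring_mat_def by auto
  have "minv M = N" using minv_eqI[OF M N(1,2)] .
  then show "minv M \<in> carrier_mat n n" "M * minv M = 1\<^sub>m n" "minv M * M = 1\<^sub>m n" using N by auto
qed

text \<open>Stacked matrices \<open>U @\<^sub>r K\<close> are homogeneous coordinates: the point
  \<open>U K^{-1}\<close> is represented by the span of the columns, on which a \<open>2n\<close> by
  \<open>2n\<close> matrix acts linearly.\<close>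

lemma four_block_mult_append_rows:
  fixes A :: "'a::comm_ring_1 mat"
  assumes "A \<in> carrier_mat n1 n" "B \<in> carrier_mat n1 p" "C \<in> carrier_mat n2 n" "D \<in> carrier_mat n2 p"
    "U \<in> carrier_mat n c" "K \<in> carrier_mat p c"
  shows "four_block_mat A B C D * (U @\<^sub>r K) = (A * U + B * K) @\<^sub>r (C * U + D * K)"
proof -
  have d: "dim_row U = n" "dim_row K = p" "dim_row A = n1" "dim_row C = n2" using assms by auto
  show ?thesis unfolding append_rows_def d
    by (subst mult_four_block_mat[OF assms(1-5) zero_carrier_mat assms(6) zero_carrier_mat])
      (use assms in auto)
qed

lemma append_rows_mult:
  fixes U :: "'a::comm_ring_1 mat"
  assumes "U \<in> carrier_mat n c" "K \<in> carrier_mat p c" "M \<in> carrier_mat c d"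
  shows "(U @\<^sub>r K) * M = (U * M) @\<^sub>r (K * M)"
proof -
  \<comment> \<open>A stacked matrix is a block matrix with right blocks of width 0, so
    \<open>M\<close> is padded by blocks of size 0 to match.\<close>
  have 1: "M = four_block_mat M (0\<^sub>m c 0) (0\<^sub>m 0 d) (0\<^sub>m 0 0)" using assms by (intro eq_matI) auto
  have d: "dim_row U = n" "dim_row K = p" "dim_row (U * M) = n" "dim_row (K * M) = p" using assms by auto
  show ?thesis unfolding append_rows_def d
    by (subst 1, subst mult_four_block_mat[OF assms(1) _ assms(2) _ assms(3)])
      (use assms in auto)
qed

lemma index_append_rows:
  assumes "U \<in> carrier_mat n c" "K \<in> carrier_mat p c" "i < n + p" "j < c"
  shows "(U @\<^sub>r K) $$ (i, j) = (if i < n then U $$ (i, j) else K $$ (i - n, j))"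
  using assms unfolding append_rows_def by auto

lemma append_rows_inject:
  assumes "U \<in> carrier_mat n c" "K \<in> carrier_mat p c" "U' \<in> carrier_mat n c" "K' \<in> carrier_mat p c"
    "U @\<^sub>r K = U' @\<^sub>r K'"
  shows "U = U'" "K = K'"
proof -
  have e: "(U @\<^sub>r K) $$ (i, j) = (U' @\<^sub>r K') $$ (i, j)" for i j using assms by simp
  show "U = U'" 
  proof (rule eq_matI)
    fix i j assume "i < dim_row U'" "j < dim_col U'"
    with e[of i j] show "U $$ (i, j) = U' $$ (i, j)" using assms(1-4)
      by (simp add: index_append_rows[of _ n c _ p])
  qed (use assms in auto)
  show "K = K'" 
  proof (rule eq_matI)
    fix i j assume "i < dim_row K'" "j < dim_col K'"
    with e[of "n + i" j] show "K $$ (i, j) = K' $$ (i, j)" using assms(1-4)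
      by (simp add: index_append_rows[of _ n c _ p])
  qed (use assms in auto)
qed

lemma append_rows_transpose_mult:
  fixes U :: "'a::comm_ring_1 mat"
  assumes "U \<in> carrier_mat n c" "K \<in> carrier_mat p c" "U' \<in> carrier_mat n d" "K' \<in> carrier_mat p d"
  shows "(U @\<^sub>r K)\<^sup>T * (U' @\<^sub>r K') = U\<^sup>T * U' + K\<^sup>T * K'"
proof -
  have d: "dim_row U = n" "dim_row K = p" using assms by auto
  have "(U @\<^sub>r K)\<^sup>T = four_block_mat (U\<^sup>T) (K\<^sup>T) (0\<^sub>m 0 n) (0\<^sub>m 0 p)"
    unfolding append_rows_def d
    by (subst transpose_four_block_mat[OF assms(1) _ assms(2)]) auto
  then have "(U @\<^sub>r K)\<^sup>T * (U' @\<^sub>r K')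
      = (U\<^sup>T * U' + K\<^sup>T * K') @\<^sub>r (0\<^sub>m 0 n * U' + 0\<^sub>m 0 p * K')"
    using assms by (simp add: four_block_mult_append_rows[of _ c n _ p _ 0])
  also have "\<dots> = U\<^sup>T * U' + K\<^sup>T * K'"
    using assms unfolding append_rows_def by (intro eq_matI) auto
  finally show ?thesis .
qed

lemma map_append_rows:
  assumes "U \<in> carrier_mat n c" "K \<in> carrier_mat p c" "f 0 = 0"
  shows "map_mat f (U @\<^sub>r K) = map_mat f U @\<^sub>r map_mat f K"
  using assms unfolding append_rows_def by (intro eq_matI) auto

lemma uminus_append_rows:
  fixes U :: "'a::group_add mat"
  assumes "U \<in> carrier_mat n c" "K \<in> carrier_mat p c"
  shows "- (U @\<^sub>r K) = (- U) @\<^sub>r (- K)"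
  using assms unfolding append_rows_def by (intro eq_matI) auto

subsection \<open>The symplectic group\<close>

definition Tmat :: "nat \<Rightarrow> real mat" where
  "Tmat n = four_block_mat (1\<^sub>m n) (0\<^sub>m n n) (0\<^sub>m n n) (- 1\<^sub>m n)"

lemma Jmat_carrier [simp]: "Jmat n \<in> carrier_mat (2*n) (2*n)" "Jmat n \<in> carrier_mat (n+n) (n+n)"
  unfolding Jmat_def by (auto simp: mult_2)
lemma Tmat_carrier [simp]: "Tmat n \<in> carrier_mat (2*n) (2*n)" "Tmat n \<in> carrier_mat (n+n) (n+n)"
  unfolding Tmat_def by (auto simp: mult_2)

lemma index_Jmat:
  "i < 2*n \<Longrightarrow> j < 2*n \<Longrightarrow> Jmat n $$ (i, j) = (if j = i + n then 1 else if i = j + n then -1 else 0)"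
  unfolding Jmat_def by auto

lemma index_Tmat:
  "i < 2*n \<Longrightarrow> j < 2*n \<Longrightarrow> Tmat n $$ (i, j) = (if i = j then (if i < n then 1 else -1) else 0)"
  unfolding Tmat_def by auto

lemma Jmat_dim [simp]: "dim_row (Jmat n) = 2*n" "dim_col (Jmat n) = 2*n"
  using carrier_matD[OF Jmat_carrier(1)[of n]] by simp_all
lemma Tmat_dim [simp]: "dim_row (Tmat n) = 2*n" "dim_col (Tmat n) = 2*n"
  using carrier_matD[OF Tmat_carrier(1)[of n]] by simp_all

lemma Jmat_Jmat: "Jmat n * Jmat n = - 1\<^sub>m (2*n)"
proof -
  have "Jmat n * Jmat n = four_block_mat (- 1\<^sub>m n) (0\<^sub>m n n) (0\<^sub>m n n) (- 1\<^sub>m n)"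
    unfolding Jmat_def by (subst mult_four_block_mat[where ?n1.0=n and ?n2.0=n and ?nc1.0=n and ?nc2.0=n]) (auto simp: mat_dim_simps)
  also have "\<dots> = - 1\<^sub>m (2*n)" by (intro eq_matI) auto
  finally show ?thesis .
qed

lemma Tmat_Tmat: "Tmat n * Tmat n = 1\<^sub>m (2*n)"
proof -
  have "Tmat n * Tmat n = four_block_mat (1\<^sub>m n) (0\<^sub>m n n) (0\<^sub>m n n) (1\<^sub>m n)"
    unfolding Tmat_def by (subst mult_four_block_mat[where ?n1.0=n and ?n2.0=n and ?nc1.0=n and ?nc2.0=n]) (auto simp: mat_dim_simps)
  also have "\<dots> = 1\<^sub>m (2*n)" by (intro eq_matI) auto
  finally show ?thesis .
qed

lemma Tmat_Jmat: "Tmat n * Jmat n = - (Jmat n * Tmat n)"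
proof -
  have 1: "Tmat n * Jmat n = four_block_mat (0\<^sub>m n n) (1\<^sub>m n) (1\<^sub>m n) (0\<^sub>m n n)"
    unfolding Tmat_def Jmat_def by (subst mult_four_block_mat[where ?n1.0=n and ?n2.0=n and ?nc1.0=n and ?nc2.0=n]) (auto simp: mat_dim_simps)
  have 2: "Jmat n * Tmat n = four_block_mat (0\<^sub>m n n) (- 1\<^sub>m n) (- 1\<^sub>m n) (0\<^sub>m n n)"
    unfolding Tmat_def Jmat_def by (subst mult_four_block_mat[where ?n1.0=n and ?n2.0=n and ?nc1.0=n and ?nc2.0=n]) (auto simp: mat_dim_simps)
  show ?thesis unfolding 1 2 by (intro eq_matI) auto
qed

lemma Tmat_transpose [simp]: "(Tmat n)\<^sup>T = Tmat n"
  by (intro eq_matI) (auto simp: index_Tmat)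

lemma Jmat_transpose [simp]: "(Jmat n)\<^sup>T = - Jmat n"
  by (intro eq_matI) (auto simp: index_Jmat)

lemma block_decomp:
  assumes "g \<in> carrier_mat (2*n) (2*n)"
  shows "g = four_block_mat (blkA n g) (blkB n g) (blkC n g) (blkD n g)"
  using assms unfolding blkA_def blkB_def blkC_def blkD_def by (intro eq_matI) auto

lemma blk_carrier [simp]: "blkA n g \<in> carrier_mat n n" "blkB n g \<in> carrier_mat n n"
  "blkC n g \<in> carrier_mat n n" "blkD n g \<in> carrier_mat n n"
  unfolding blkA_def blkB_def blkC_def blkD_def by auto

lemma blk_dim [simp]: "dim_row (blkA n g) = n" "dim_row (blkB n g) = n" "dim_row (blkC n g) = n" "dim_row (blkD n g) = n"
  "dim_col (blkA n g) = n" "dim_col (blkB n g) = n" "dim_col (blkC n g) = n" "dim_col (blkD n g) = n"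
  unfolding blkA_def blkB_def blkC_def blkD_def by auto

lemma tau_g_eq:
  assumes "g \<in> carrier_mat (2*n) (2*n)"
  shows "tau_g n g = Tmat n * g * Tmat n"
proof -
  have "Tmat n * g = four_block_mat (blkA n g) (blkB n g) (- blkC n g) (- blkD n g)"
    by (subst block_decomp[OF assms], unfold Tmat_def, subst mult_four_block_mat[where ?n1.0=n and ?n2.0=n and ?nc1.0=n and ?nc2.0=n]) (auto simp: mat_dim_simps)
  then have "Tmat n * g * Tmat n = four_block_mat (blkA n g) (- blkB n g) (- blkC n g) (blkD n g)"
    by (simp add: Tmat_def, subst mult_four_block_mat[where ?n1.0=n and ?n2.0=n and ?nc1.0=n and ?nc2.0=n]) (auto simp: mat_dim_simps)
  then show ?thesis unfolding tau_g_def ..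
qed

lemma is_Sp_carrier: "is_Sp n g \<Longrightarrow> g \<in> carrier_mat (2*n) (2*n)"
  unfolding is_Sp_def by simp

lemma is_Sp_dim: "is_Sp n g \<Longrightarrow> dim_row g = 2*n" "is_Sp n g \<Longrightarrow> dim_col g = 2*n"
  unfolding is_Sp_def by auto

text \<open>This is \<open>J^{-1} g^T J\<close>, the inverse read off from
  \<open>g^T J g = J\<close>. Being polynomial in the entries of \<open>g\<close>, it is visibly
  integral when \<open>g\<close> is.\<close>

definition sp_inv :: "nat \<Rightarrow> real mat \<Rightarrow> real mat" where
  "sp_inv n g = - (Jmat n * g\<^sup>T * Jmat n)"

lemma sp_inv_carrier [simp]: "g \<in> carrier_mat (2*n) (2*n) \<Longrightarrow> sp_inv n g \<in> carrier_mat (2*n) (2*n)"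
  unfolding sp_inv_def by (auto intro!: mult_carrier_mat[of _ _ "2*n"])

lemma sp_inv_dim [simp]: "dim_row (sp_inv n g) = 2*n" "dim_col (sp_inv n g) = 2*n"
  unfolding sp_inv_def by auto

lemma sp_inv_left: 
  assumes "is_Sp n g" shows "sp_inv n g * g = 1\<^sub>m (2*n)"
proof -
  note [simp] = is_Sp_carrier[OF assms] is_Sp_dim[OF assms]
  have "sp_inv n g * g = - (Jmat n * (g\<^sup>T * Jmat n * g))"
    unfolding sp_inv_def by (simp add: mat_dim_simps)
  also have "g\<^sup>T * Jmat n * g = Jmat n" using assms unfolding is_Sp_def by simp
  finally show ?thesis by (simp add: Jmat_Jmat)
qed

lemma sp_inv_right: 
  assumes "is_Sp n g" shows "g * sp_inv n g = 1\<^sub>m (2*n)"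
  using mat_mult_left_right_inverse[OF _ _ sp_inv_left[OF assms]] is_Sp_carrier[OF assms] by simp

lemma is_Sp_mult:
  assumes "is_Sp n g" "is_Sp n h" shows "is_Sp n (g * h)"
proof -
  note [simp] = is_Sp_dim[OF assms(1)] is_Sp_dim[OF assms(2)] is_Sp_carrier[OF assms(1)] is_Sp_carrier[OF assms(2)]
  have "(g * h)\<^sup>T * Jmat n * (g * h) = h\<^sup>T * (g\<^sup>T * Jmat n * g) * h"
    by (simp add: mat_dim_simps)
  also have "\<dots> = Jmat n" using assms unfolding is_Sp_def by simp
  finally show ?thesis unfolding is_Sp_def by (auto intro: carrier_matI)
qed

text \<open>\<open>T\<close> is antisymplectic, \<open>T J T = -J\<close>; conjugation uses it twice
  and the signs cancel.\<close>

lemma is_Sp_Tconj: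
  assumes "is_Sp n g" shows "is_Sp n (Tmat n * g * Tmat n)"
proof -
  note [simp] = is_Sp_carrier[OF assms] is_Sp_dim[OF assms]
  have TJT: "Tmat n * (Jmat n * Tmat n) = - Jmat n"
  proof -
    have "Tmat n * (Jmat n * Tmat n) = Tmat n * (- (Tmat n * Jmat n))"
      by (simp add: Tmat_Jmat) 
    also have "\<dots> = - ((Tmat n * Tmat n) * Jmat n)" by (simp add: mat_dim_simps)
    finally show ?thesis by (simp add: Tmat_Tmat left_mult_one_mat[of _ "2*n" "2*n"])
  qed
  have "(Tmat n * g * Tmat n)\<^sup>T * Jmat n * (Tmat n * g * Tmat n)
     = Tmat n * (g\<^sup>T * (Tmat n * (Jmat n * Tmat n)) * g) * Tmat n"
    by (simp add: mat_dim_simps)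
  also have "\<dots> = - (Tmat n * ((g\<^sup>T * Jmat n * g) * Tmat n))" unfolding TJT by (simp add: mat_dim_simps)
  also have "g\<^sup>T * Jmat n * g = Jmat n" using assms unfolding is_Sp_def by simp
  finally show ?thesis unfolding is_Sp_def TJT by (auto intro: carrier_matI)
qed

lemma is_Sp_sp_inv:
  assumes "is_Sp n g" shows "is_Sp n (sp_inv n g)"
proof -
  note c[simp] = is_Sp_carrier[OF assms] is_Sp_dim[OF assms]
  let ?i = "sp_inv n g"
  have gg: "g * ?i = 1\<^sub>m (2*n)" using sp_inv_right[OF assms] .
  have "?i\<^sup>T * Jmat n * ?i = ?i\<^sup>T * (g\<^sup>T * Jmat n * g) * ?i" using assms unfolding is_Sp_def by simp
  also have "\<dots> = (g * ?i)\<^sup>T * Jmat n * (g * ?i)"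
    by (simp add: mat_dim_simps)
  also have "\<dots> = Jmat n" unfolding gg by simp
  finally show ?thesis unfolding is_Sp_def by simp
qed

subsection \<open>The action on the Siegel upper half space\<close>

definition sesq :: "real mat \<Rightarrow> complex vec \<Rightarrow> complex vec \<Rightarrow> complex" where
  "sesq Y c d = map_vec cnj c \<bullet> (cplx Y *\<^sub>v d)"

text \<open>Split \<open>c\<close> into real and imaginary part: the cross terms are purely
  imaginary.\<close>

lemma Re_sesq_self:
  assumes Y: "Y \<in> carrier_mat n n" and c: "c \<in> carrier_vec n"
  shows "Re (sesq Y c c) = map_vec Re c \<bullet> (Y *\<^sub>v map_vec Re c) + map_vec Im c \<bullet> (Y *\<^sub>v map_vec Im c)"
proof -
  have q: "x \<bullet> (Y *\<^sub>v x) = (\<Sum>i<n. \<Sum>j<n. x $ i * (Y $$ (i, j) * x $ j))" if "x \<in> carrier_vec n" for x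
    using Y that by (simp add: scalar_prod_def sum_distrib_left atLeast0LessThan)
  have "sesq Y c c = (\<Sum>i<n. \<Sum>j<n. cnj (c $ i) * (of_real (Y $$ (i, j)) * c $ j))"
    using Y c unfolding sesq_def by (simp add: scalar_prod_def sum_distrib_left atLeast0LessThan)
  then have "Re (sesq Y c c)
      = (\<Sum>i<n. \<Sum>j<n. Re (c $ i) * (Y $$ (i, j) * Re (c $ j)) + Im (c $ i) * (Y $$ (i, j) * Im (c $ j)))"
    by simp
  then show ?thesis using c by (simp add: q sum.distrib)
qed

lemma sesq_pos:
  assumes "pos_def n Y" "c \<in> carrier_vec n" "c \<noteq> 0\<^sub>v n"
  shows "Re (sesq Y c c) > 0"
proof -
  have Y: "Y \<in> carrier_mat n n" using assms unfolding pos_def_def by auto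
  have nn: "x \<bullet> (Y *\<^sub>v x) \<ge> 0" if "x \<in> carrier_vec n" for x
    using assms(1) that Y unfolding pos_def_def
    by (cases "x = 0\<^sub>v n") (auto intro!: less_imp_le)
  have "map_vec Re c \<noteq> 0\<^sub>v n \<or> map_vec Im c \<noteq> 0\<^sub>v n"
  proof (rule ccontr)
    assume "\<not> ?thesis"
    then have e: "map_vec Re c $ i = 0" "map_vec Im c $ i = 0" if "i < n" for i using that by auto
    have "c = 0\<^sub>v n" using e assms(2) by (intro eq_vecI) (auto simp: complex_eq_iff)
    with assms show False by simp
  qed
  then have "map_vec Re c \<bullet> (Y *\<^sub>v map_vec Re c) > 0 \<or> map_vec Im c \<bullet> (Y *\<^sub>v map_vec Im c) > 0"
    using assms unfolding pos_def_def by auto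
  then show ?thesis using nn[of "map_vec Re c"] nn[of "map_vec Im c"] assms(2)
    unfolding Re_sesq_self[OF Y assms(2)] by auto
qed

lemma scalar_prod_transpose_mult:
  fixes M :: "'a::comm_semiring_0 mat"
  assumes "M \<in> carrier_mat p q" "x \<in> carrier_vec q" "y \<in> carrier_vec p"
  shows "x \<bullet> (M\<^sup>T *\<^sub>v y) = (M *\<^sub>v x) \<bullet> y"
proof -
  have "x \<bullet> (M\<^sup>T *\<^sub>v y) = (M\<^sup>T *\<^sub>v y) \<bullet> x"
    using assms by (intro comm_scalar_prod[of _ q]) auto
  also have "\<dots> = y \<bullet> (M *\<^sub>v x)"
    using transpose_vec_mult_scalar[OF assms] .
  also have "\<dots> = (M *\<^sub>v x) \<bullet> y"
    using assms by (intro comm_scalar_prod[of _ p]) auto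
  finally show ?thesis .
qed

lemma mult_mat_zero_vec: "M \<in> carrier_mat p q \<Longrightarrow> M *\<^sub>v 0\<^sub>v q = 0\<^sub>v p"
  for M :: "'a::semiring_0 mat"
  by (intro eq_vecI) auto

text \<open>Applied with \<open>Y' = Y\<close> when \<open>K\<close> is unitary, and with
  \<open>Y\<close>, \<open>Y'\<close> the imaginary parts of an image point and of the point
  itself.\<close>

lemma sesq_congruence:
  assumes c: "K \<in> carrier_mat n n" "Y \<in> carrier_mat n n" "Y' \<in> carrier_mat n n" 
    "c \<in> carrier_vec n" "d \<in> carrier_vec n"
    and eq: "(conj_mat K)\<^sup>T * cplx Y * K = cplx Y'"
  shows "sesq Y (K *\<^sub>v c) (K *\<^sub>v d) = sesq Y' c d"
proof -
  have 1: "map_vec cnj (K *\<^sub>v c) = conj_mat K *\<^sub>v map_vec cnj c"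
    using cnj_hom.mult_mat_vec_hom[OF c(1,4)] .
  have "sesq Y' c d = map_vec cnj c \<bullet> (((conj_mat K)\<^sup>T * (cplx Y * K)) *\<^sub>v d)"
    unfolding sesq_def eq[symmetric] using c by (simp add: mat_dim_simps)
  also have "\<dots> = map_vec cnj c \<bullet> ((conj_mat K)\<^sup>T *\<^sub>v (cplx Y *\<^sub>v (K *\<^sub>v d)))"
    using c by (simp add: assoc_mult_mat_vec[of _ n n _ n])
  also have "\<dots> = (conj_mat K *\<^sub>v map_vec cnj c) \<bullet> (cplx Y *\<^sub>v (K *\<^sub>v d))"
    by (rule scalar_prod_transpose_mult[of _ n n]) (use c in \<open>auto intro!: mult_mat_vec_carrier\<close>)
  finally show ?thesis unfolding sesq_def 1 by simp
qed

lemma cplx_mult: "dim_col X = dim_row Y \<Longrightarrow> cplx (X * Y) = cplx X * cplx Y"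
  by (rule of_real_hom.mat_hom_mult[of _ "dim_row X" "dim_col X" _ "dim_col Y"]) auto

lemma cplx_add: "dim_row X = dim_row Y \<Longrightarrow> dim_col X = dim_col Y \<Longrightarrow> cplx (X + Y) = cplx X + cplx Y"
  by (intro eq_matI) auto

lemma cplx_transpose: "cplx (X\<^sup>T) = (cplx X)\<^sup>T"
  by (intro eq_matI) auto

lemma cplx_smult: "cplx (a \<cdot>\<^sub>m X) = of_real a \<cdot>\<^sub>m cplx X"
  by (intro eq_matI) auto

section \<open>Symplectic pairings and the automorphy factor\<close>

lemma cplx_Sp:
  assumes "is_Sp n g" shows "(cplx g)\<^sup>T * (cplx (Jmat n) * cplx g) = cplx (Jmat n)"
proof -
  note [simp] = is_Sp_dim[OF assms]
  have "cplx (g\<^sup>T * (Jmat n * g)) = (cplx g)\<^sup>T * (cplx (Jmat n) * cplx g)"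
    by (simp add: cplx_mult cplx_transpose)
  moreover have "g\<^sup>T * (Jmat n * g) = Jmat n" using assms unfolding is_Sp_def by (simp add: mat_dim_simps)
  ultimately show ?thesis by simp
qed

text \<open>For \<open>U = U' = W\<close> and \<open>K = K' = 1\<close> the value is
  \<open>W - W^T\<close> up to sign, so symmetric matrices correspond to Lagrangian
  subspaces.\<close>

lemma lagrangian_pairing:
  fixes U :: "complex mat"
  assumes c: "U \<in> carrier_mat n k" "K \<in> carrier_mat n k" "U' \<in> carrier_mat n l" "K' \<in> carrier_mat n l"
  shows "(U @\<^sub>r K)\<^sup>T * (cplx (Jmat n) * (U' @\<^sub>r K')) = U\<^sup>T * K' - K\<^sup>T * U'"
proof -
  have "cplx (Jmat n) = four_block_mat (0\<^sub>m n n) (1\<^sub>m n) (- 1\<^sub>m n) (0\<^sub>m n n)"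
    unfolding Jmat_def by (intro eq_matI) auto
  then have "cplx (Jmat n) * (U' @\<^sub>r K') = K' @\<^sub>r (- U')"
    using c by (simp add: four_block_mult_append_rows[of _ n n _ n _ n] mat_dim_simps)
  moreover have "(U @\<^sub>r K)\<^sup>T * (K' @\<^sub>r (- U')) = U\<^sup>T * K' + K\<^sup>T * (- U')"
    by (rule append_rows_transpose_mult) (use c in auto)
  ultimately show ?thesis using c by (simp add: add_uminus_minus_mat[of _ k l])
qed

text \<open>Two independent points are allowed because two choices matter: \<open>W' = W\<close>
  yields the symmetry of the image, and \<open>W'\<close> the conjugate of \<open>W\<close> yields
  the Hermitian form whose definiteness is the condition \<open>Im W > 0\<close>.\<close>

lemma Sp_preserves_pairing:
  assumes g: "is_Sp n g"
    and c: "W \<in> carrier_mat n n" "U \<in> carrier_mat n n" "K \<in> carrier_mat n n"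
      "W' \<in> carrier_mat n n" "U' \<in> carrier_mat n n" "K' \<in> carrier_mat n n"
    and e: "cplx g * (W @\<^sub>r 1\<^sub>m n) = U @\<^sub>r K" "cplx g * (W' @\<^sub>r 1\<^sub>m n) = U' @\<^sub>r K'"
  shows "U'\<^sup>T * K - K'\<^sup>T * U = W'\<^sup>T - W"
proof -
  note [simp] = is_Sp_dim[OF g]
  let ?L = "W @\<^sub>r 1\<^sub>m n" and ?L' = "W' @\<^sub>r 1\<^sub>m n"
  have [simp]: "dim_row ?L = 2*n" "dim_row ?L' = 2*n" "dim_col ?L = n" "dim_col ?L' = n"
    using c unfolding append_rows_def by auto
  have "U'\<^sup>T * K - K'\<^sup>T * U = (U' @\<^sub>r K')\<^sup>T * (cplx (Jmat n) * (U @\<^sub>r K))"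
    using lagrangian_pairing[of U' n n K' U n K] c by simp
  also have "\<dots> = ?L'\<^sup>T * (((cplx g)\<^sup>T * (cplx (Jmat n) * cplx g)) * ?L)"
    unfolding e[symmetric] by (simp add: mat_dim_simps)
  also have "\<dots> = ?L'\<^sup>T * (cplx (Jmat n) * ?L)" unfolding cplx_Sp[OF g] ..
  also have "\<dots> = W'\<^sup>T * 1\<^sub>m n - (1\<^sub>m n)\<^sup>T * W"
    by (rule lagrangian_pairing) (use c in auto)
  finally show ?thesis using c by (simp add: mat_dim_simps)
qed

lemma conj_cplx [simp]: "conj_mat (cplx g) = cplx g"
  by (intro eq_matI) auto

lemma conj_lagrangian:
  assumes g: "g \<in> carrier_mat (2*n) (2*n)"
    and c: "W \<in> carrier_mat n n" "U \<in> carrier_mat n n" "K \<in> carrier_mat n n"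
    and e: "cplx g * (W @\<^sub>r 1\<^sub>m n) = U @\<^sub>r K"
  shows "cplx g * (conj_mat W @\<^sub>r 1\<^sub>m n) = conj_mat U @\<^sub>r conj_mat K"
proof -
  have o: "conj_mat (1\<^sub>m n) = 1\<^sub>m n" by (intro eq_matI) auto
  have "conj_mat (cplx g * (W @\<^sub>r 1\<^sub>m n)) = conj_mat (cplx g) * conj_mat (W @\<^sub>r 1\<^sub>m n)"
    by (rule cnj_hom.mat_hom_mult[of _ "2*n" "2*n" _ n]) (use g c in \<open>auto simp: mult_2\<close>)
  then show ?thesis unfolding e using c o
    by (simp add: map_append_rows[of _ n n _ n])
qed

lemma lagrangian_image:
  assumes g: "g \<in> carrier_mat (2*n) (2*n)" and W: "W \<in> carrier_mat n n"
  shows "cplx g * (W @\<^sub>r 1\<^sub>m n)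
     = (blkA n (cplx g) * W + blkB n (cplx g)) @\<^sub>r (blkC n (cplx g) * W + blkD n (cplx g))"
proof -
  have "cplx g \<in> carrier_mat (2*n) (2*n)" using g by simp
  then have "cplx g * (W @\<^sub>r 1\<^sub>m n) = four_block_mat (blkA n (cplx g)) (blkB n (cplx g))
      (blkC n (cplx g)) (blkD n (cplx g)) * (W @\<^sub>r 1\<^sub>m n)"
    using block_decomp[of "cplx g" n] by metis
  also have "\<dots> = (blkA n (cplx g) * W + blkB n (cplx g) * 1\<^sub>m n) @\<^sub>r
      (blkC n (cplx g) * W + blkD n (cplx g) * 1\<^sub>m n)"
    by (rule four_block_mult_append_rows) (use W in auto)
  finally show ?thesis by (simp add: one_mult_mat_dim)
qed

lemma siegel_imaginary:
  assumes "siegel n W"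
  shows "(conj_mat W)\<^sup>T - W = (- 2 * \<i>) \<cdot>\<^sub>m cplx (map_mat Im W)"
proof -
  have W: "W \<in> carrier_mat n n" "W\<^sup>T = W" using assms unfolding siegel_def by auto
  have "W $$ (i, j) = W $$ (j, i)" if "i < n" "j < n" for i j
    using that W(1) by (subst W(2)[symmetric]) simp
  then show ?thesis using W(1) by (intro eq_matI) (auto simp: complex_eq_iff)
qed

text \<open>If \<open>K x = 0\<close>, both terms of the Hermitian form \<open>U^* K - K^* U\<close>
  vanish at \<open>x\<close>. By invariance this form is \<open>-2i Im W\<close>, which is definite,
  so \<open>x = 0\<close>.\<close>

lemma Sp_denominator_invertible:
  assumes g: "is_Sp n g" and W: "siegel n W"
    and c: "U \<in> carrier_mat n n" "K \<in> carrier_mat n n"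
    and e: "cplx g * (W @\<^sub>r 1\<^sub>m n) = U @\<^sub>r K"
  shows "minv K \<in> carrier_mat n n" "K * minv K = 1\<^sub>m n" "minv K * K = 1\<^sub>m n"
proof -
  have Wc: "W \<in> carrier_mat n n" using W unfolding siegel_def by auto
  have form: "(conj_mat U)\<^sup>T * K - (conj_mat K)\<^sup>T * U = (- 2 * \<i>) \<cdot>\<^sub>m cplx (map_mat Im W)"
    using Sp_preserves_pairing[OF g Wc c _ _ _ e conj_lagrangian[OF is_Sp_carrier[OF g] Wc c e]] Wc c
      siegel_imaginary[OF W] by simp
  have "x = 0\<^sub>v n" if x: "x \<in> carrier_vec n" and Kx: "K *\<^sub>v x = 0\<^sub>v n" for x
  proof (rule ccontr)
    assume nz: "x \<noteq> 0\<^sub>v n"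
    let ?x = "map_vec cnj x"
    have xc: "?x \<in> carrier_vec n" using x by simp
    have Kx': "conj_mat K *\<^sub>v ?x = 0\<^sub>v n"
    proof -
      have "map_vec cnj (0\<^sub>v n) = 0\<^sub>v n" by (intro eq_vecI) auto
      then show ?thesis using cnj_hom.mult_mat_vec_hom[OF c(2) x] Kx by simp
    qed
    have "?x \<bullet> (((conj_mat U)\<^sup>T * K - (conj_mat K)\<^sup>T * U) *\<^sub>v x)
        = ?x \<bullet> ((conj_mat U)\<^sup>T *\<^sub>v (K *\<^sub>v x)) - ?x \<bullet> ((conj_mat K)\<^sup>T *\<^sub>v (U *\<^sub>v x))"
      using c x by (simp add: minus_mult_distrib_mat_vec[of _ n n] assoc_mult_mat_vec[of _ n n _ n]
          scalar_prod_minus_distrib[of _ n])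
    also have "?x \<bullet> ((conj_mat K)\<^sup>T *\<^sub>v (U *\<^sub>v x)) = (conj_mat K *\<^sub>v ?x) \<bullet> (U *\<^sub>v x)"
      by (rule scalar_prod_transpose_mult[of _ n n]) (use c x in \<open>auto intro!: mult_mat_vec_carrier\<close>)
    finally have "?x \<bullet> (((- 2 * \<i>) \<cdot>\<^sub>m cplx (map_mat Im W)) *\<^sub>v x) = 0"
      unfolding form Kx Kx' using c xc x by (simp add: mult_mat_vec_carrier mult_mat_zero_vec[of _ n n])
    moreover have "((- 2 * \<i>) \<cdot>\<^sub>m cplx (map_mat Im W)) *\<^sub>v x = (- 2 * \<i>) \<cdot>\<^sub>v (cplx (map_mat Im W) *\<^sub>v x)"
      using Wc x by (intro eq_vecI) auto
    ultimately have "sesq (map_mat Im W) x x = 0"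
      unfolding sesq_def using Wc x by simp
    with sesq_pos[of n "map_mat Im W" x] W x nz show False unfolding siegel_def by simp
  qed
  from inverse_if_kernel_trivial[OF c(2) this]
  show "minv K \<in> carrier_mat n n" "K * minv K = 1\<^sub>m n" "minv K * K = 1\<^sub>m n" by auto
qed

text \<open>Nothing is assumed of \<open>V\<close> beyond its size. Pairing the equation with itself
  gives \<open>K^T (V^T - V) K = 0\<close>, and pairing it with its conjugate gives the
  transformation law of imaginary parts; as \<open>K\<close> is invertible, symmetry and positivity
  pass from \<open>W\<close> to \<open>V\<close>.\<close>

lemma lagrangian_transport:
  assumes g: "is_Sp n g" and W: "siegel n W"
    and c: "V \<in> carrier_mat n n" "K \<in> carrier_mat n n"
    and e: "cplx g * (W @\<^sub>r 1\<^sub>m n) = (V @\<^sub>r 1\<^sub>m n) * K"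
  shows "siegel n V" "(conj_mat K)\<^sup>T * cplx (map_mat Im V) * K = cplx (map_mat Im W)"
proof -
  have Wc: "W \<in> carrier_mat n n" and Ws: "W\<^sup>T = W" and Wp: "pos_def n (map_mat Im W)"
    using W unfolding siegel_def by auto
  have VK: "V * K \<in> carrier_mat n n" using c by simp
  have e': "cplx g * (W @\<^sub>r 1\<^sub>m n) = (V * K) @\<^sub>r K"
    unfolding e using c by (simp add: append_rows_mult[of _ n n _ n _ n] mat_dim_simps)
  note inv = Sp_denominator_invertible[OF g W VK c(2) e']
  let ?I = "minv K"
  have "(V * K)\<^sup>T * K - K\<^sup>T * (V * K) = W\<^sup>T - W"
    by (rule Sp_preserves_pairing[OF g Wc VK c(2) Wc VK c(2) e' e'])
  then have z: "K\<^sup>T * ((V\<^sup>T - V) * K) = 0\<^sub>m n n"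
    using Ws Wc c by (simp add: mat_dim_simps minus_r_inv_mat[of _ n n])
  have "(K * ?I)\<^sup>T * ((V\<^sup>T - V) * (K * ?I)) = ?I\<^sup>T * (K\<^sup>T * ((V\<^sup>T - V) * K)) * ?I"
    using c inv(1) by (simp add: mat_dim_simps)
  also have "\<dots> = 0\<^sub>m n n" unfolding z using inv(1) by (simp add: mat_dim_simps)
  finally have d: "V\<^sup>T - V = 0\<^sub>m n n" unfolding inv(2) using c by (simp add: one_mult_mat_dim)
  have Vs: "V\<^sup>T = V"
  proof (rule eq_matI)
    fix i j assume ij: "i < dim_row V" "j < dim_col V"
    have "(V\<^sup>T - V) $$ (i, j) = 0" unfolding d using ij c by simp
    then show "V\<^sup>T $$ (i, j) = V $$ (i, j)" using ij c by simp
  qed (use c in auto)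
  have Vi: "V $$ (i, j) = V $$ (j, i)" if "i < n" "j < n" for i j
    using that c by (subst Vs[symmetric]) simp
  have Vim: "(conj_mat V)\<^sup>T - V = (- 2 * \<i>) \<cdot>\<^sub>m cplx (map_mat Im V)"
    using c Vi by (intro eq_matI) (auto simp: complex_eq_iff)
  have cVK: "conj_mat (V * K) = conj_mat V * conj_mat K"
    using cnj_hom.mat_hom_mult[OF c] .
  have "(conj_mat (V * K))\<^sup>T * K - (conj_mat K)\<^sup>T * (V * K) = (conj_mat W)\<^sup>T - W"
    by (rule Sp_preserves_pairing[OF g Wc VK c(2) _ _ _ e' conj_lagrangian[OF is_Sp_carrier[OF g] Wc VK c(2) e']])
      (use Wc c VK in auto)
  then have "(conj_mat K)\<^sup>T * (((conj_mat V)\<^sup>T - V) * K) = (conj_mat W)\<^sup>T - W"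
    unfolding cVK using c by (simp add: mat_dim_simps)
  then have "(- 2 * \<i>) \<cdot>\<^sub>m ((conj_mat K)\<^sup>T * cplx (map_mat Im V) * K) = (- 2 * \<i>) \<cdot>\<^sub>m cplx (map_mat Im W)"
    unfolding Vim siegel_imaginary[OF W] using c by (simp add: mat_dim_simps)
  then have "(\<i> / 2) \<cdot>\<^sub>m ((- 2 * \<i>) \<cdot>\<^sub>m ((conj_mat K)\<^sup>T * cplx (map_mat Im V) * K))
      = (\<i> / 2) \<cdot>\<^sub>m ((- 2 * \<i>) \<cdot>\<^sub>m cplx (map_mat Im W))" by (rule arg_cong)
  moreover have "(\<i> / 2) \<cdot>\<^sub>m ((- 2 * \<i>) \<cdot>\<^sub>m M) = M" for M :: "complex mat"
    by (intro eq_matI) auto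
  ultimately show main: "(conj_mat K)\<^sup>T * cplx (map_mat Im V) * K = cplx (map_mat Im W)"
    by simp
  have "pos_def n (map_mat Im V)"
    unfolding pos_def_def
  proof (intro conjI ballI impI)
    show "(map_mat Im V)\<^sup>T = map_mat Im V" using c Vi by (intro eq_matI) auto
  next
    fix x :: "real vec" assume x: "x \<in> carrier_vec n" "x \<noteq> 0\<^sub>v n"
    let ?x = "map_vec complex_of_real x"
    \<comment> \<open>The real test vector is pulled back through \<open>K\<close>, which is
      complex; this is why positivity is needed for complex vectors, in the form
      \<open>sesq_pos\<close>.\<close>
    let ?c = "?I *\<^sub>v ?x"
    have cc: "?c \<in> carrier_vec n" using inv(1) x by (simp add: mult_mat_vec_carrier)
    have Kc: "K *\<^sub>v ?c = ?x" using assoc_mult_mat_vec[OF c(2) inv(1), of ?x] inv(2) x by simp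
    have xn: "?x \<noteq> 0\<^sub>v n"
    proof
      assume "?x = 0\<^sub>v n"
      then have "?x $ i = 0" if "i < n" for i using that by simp
      then have "x = 0\<^sub>v n" using x(1) by (intro eq_vecI) auto
      with x(2) show False ..
    qed
    have "?c \<noteq> 0\<^sub>v n"
    proof
      assume "?c = 0\<^sub>v n"
      with Kc mult_mat_zero_vec[OF c(2)] have "?x = 0\<^sub>v n" by metis
      with xn show False ..
    qed
    from sesq_pos[OF Wp cc this] have "0 < Re (sesq (map_mat Im V) ?x ?x)"
      using sesq_congruence[OF c(2) _ _ cc cc main] c Wc Kc by simp
    also have "\<dots> = x \<bullet> (map_mat Im V *\<^sub>v x)"
      using x c by (subst Re_sesq_self[of _ n]) (auto simp: scalar_prod_def)
    finally show "0 < x \<bullet> (map_mat Im V *\<^sub>v x)" .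
  qed (use c in auto)
  with Vs c show "siegel n V" unfolding siegel_def by simp
qed

text \<open>The factor is \<open>K = C W + D\<close>. From here on the action is handled through
  this equation, in which composition of maps is multiplication of matrices.\<close>

lemma sp_act_lagrangian:
  assumes g: "is_Sp n g" and W: "siegel n W"
  obtains K where "K \<in> carrier_mat n n" "minv K \<in> carrier_mat n n" "K * minv K = 1\<^sub>m n"
    "cplx g * (W @\<^sub>r 1\<^sub>m n) = (sp_act n g W @\<^sub>r 1\<^sub>m n) * K" "siegel n (sp_act n g W)"
proof -
  have Wc: "W \<in> carrier_mat n n" using W unfolding siegel_def by auto
  define U where "U = blkA n (cplx g) * W + blkB n (cplx g)"
  define K where "K = blkC n (cplx g) * W + blkD n (cplx g)"
  have c: "U \<in> carrier_mat n n" "K \<in> carrier_mat n n" unfolding U_def K_def using Wc by auto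
  have e: "cplx g * (W @\<^sub>r 1\<^sub>m n) = U @\<^sub>r K"
    unfolding U_def K_def by (rule lagrangian_image[OF is_Sp_carrier[OF g] Wc])
  note inv = Sp_denominator_invertible[OF g W c e]
  have V: "sp_act n g W = U * minv K" unfolding sp_act_def U_def K_def Let_def ..
  have Vc: "sp_act n g W \<in> carrier_mat n n" unfolding V using c inv by simp
  have "U * minv K * K = U" using c inv by (simp add: mat_dim_simps)
  then have e': "cplx g * (W @\<^sub>r 1\<^sub>m n) = (sp_act n g W @\<^sub>r 1\<^sub>m n) * K"
    unfolding e using c Vc by (simp add: append_rows_mult[of _ n n _ n _ n] mat_dim_simps V)
  show ?thesis
    by (rule that[OF c(2) inv(1,2) e' lagrangian_transport(1)[OF g W Vc c(2) e']])
qed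

text \<open>The lower rows force \<open>K = C W + D\<close>; the upper rows then give
  \<open>V = (A W + B) K^{-1}\<close>.\<close>

lemma sp_act_eqI:
  assumes g: "is_Sp n g" and W: "siegel n W"
    and c: "V \<in> carrier_mat n n" "K \<in> carrier_mat n n"
    and e: "cplx g * (W @\<^sub>r 1\<^sub>m n) = (V @\<^sub>r 1\<^sub>m n) * K"
  shows "sp_act n g W = V"
proof -
  have Wc: "W \<in> carrier_mat n n" using W unfolding siegel_def by auto
  have VK: "V * K \<in> carrier_mat n n" using c by simp
  have e': "cplx g * (W @\<^sub>r 1\<^sub>m n) = (V * K) @\<^sub>r K"
    unfolding e using c by (simp add: append_rows_mult[of _ n n _ n _ n] mat_dim_simps)
  note inv = Sp_denominator_invertible[OF g W VK c(2) e']
  have "blkA n (cplx g) * W + blkB n (cplx g) = V * K" "blkC n (cplx g) * W + blkD n (cplx g) = K"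
    by (rule append_rows_inject[OF _ _ VK c(2) 
      trans[OF lagrangian_image[OF is_Sp_carrier[OF g] Wc, symmetric] e']], use Wc in auto)+
  then show ?thesis unfolding sp_act_def Let_def using inv c by (simp add: mat_dim_simps)
qed

subsection \<open>Fixed points near the boundary for an antisymplectic involution\<close>

lemma mult_scalar_mat:
  fixes X :: "'a::comm_ring_1 mat"
  shows "dim_col X = 1 \<Longrightarrow> X * mat 1 1 (\<lambda>_. a) = a \<cdot>\<^sub>m X"
    "dim_row X = 1 \<Longrightarrow> mat 1 1 (\<lambda>_. a) * X = a \<cdot>\<^sub>m X"
  by (intro eq_matI; auto simp: scalar_prod_def)+

lemma four_block_mat_inject:
  assumes e: "four_block_mat A B C D = four_block_mat A' B' C' D'"
    and c: "A \<in> carrier_mat n k" "B \<in> carrier_mat n l" "C \<in> carrier_mat p k" "D \<in> carrier_mat p l"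
      "A' \<in> carrier_mat n k" "B' \<in> carrier_mat n l" "C' \<in> carrier_mat p k" "D' \<in> carrier_mat p l"
  shows "A = A'" "B = B'" "C = C'" "D = D'"
proof -
  have ix: "four_block_mat A B C D $$ (i, j) = four_block_mat A' B' C' D' $$ (i, j)" for i j using e by simp
  show "A = A'"
  proof (rule eq_matI)
    fix i j assume "i < dim_row A'" "j < dim_col A'"
    then show "A $$ (i, j) = A' $$ (i, j)" using ix[of i j] c by simp
  qed (use c in auto)
  show "B = B'"
  proof (rule eq_matI)
    fix i j assume "i < dim_row B'" "j < dim_col B'"
    then show "B $$ (i, j) = B' $$ (i, j)" using ix[of i "j + k"] c by simp
  qed (use c in auto)
  show "C = C'"
  proof (rule eq_matI)
    fix i j assume "i < dim_row C'" "j < dim_col C'"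
    then show "C $$ (i, j) = C' $$ (i, j)" using ix[of "i + n" j] c by simp
  qed (use c in auto)
  show "D = D'"
  proof (rule eq_matI)
    fix i j assume "i < dim_row D'" "j < dim_col D'"
    then show "D $$ (i, j) = D' $$ (i, j)" using ix[of "i + n" "j + k"] c by simp
  qed (use c in auto)
qed

text \<open>The hypothesis says \<open>h T h = T\<close>. Together with \<open>h^T J h = J\<close>
  it makes \<open>J T h\<close> symmetric, which contains the first three claims; the last two are
  the upper blocks of \<open>h T h = T\<close>.\<close>

lemma involution_blocks:
  assumes h: "is_Sp n h" and inv: "Tmat n * h * Tmat n * h = 1\<^sub>m (2*n)"
  shows "(blkB n h)\<^sup>T = blkB n h" "(blkC n h)\<^sup>T = blkC n h" "blkD n h = (blkA n h)\<^sup>T"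
    "blkA n h * blkA n h - blkB n h * blkC n h = 1\<^sub>m n"
    "blkA n h * blkB n h = blkB n h * blkD n h"
proof -
  note hc = is_Sp_carrier[OF h] 
  note [simp] = is_Sp_dim[OF h]
  let ?T = "Tmat n" and ?J = "Jmat n"
  let ?A = "blkA n h" and ?B = "blkB n h" and ?C = "blkC n h" and ?D = "blkD n h"
  have hb: "h = four_block_mat ?A ?B ?C ?D" by (rule block_decomp[OF hc])
  have Tb: "?T = four_block_mat (1\<^sub>m n) (0\<^sub>m n n) (0\<^sub>m n n) (- 1\<^sub>m n)" by (rule Tmat_def)
  have Jb: "?J = four_block_mat (0\<^sub>m n n) (1\<^sub>m n) (- 1\<^sub>m n) (0\<^sub>m n n)" by (rule Jmat_def)
  have hTh: "h * (?T * h) = ?T"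
  proof -
    have "?T * (?T * h * ?T * h) = ?T" unfolding inv by (simp add: one_mult_mat_dim)
    moreover have "?T * (?T * h * ?T * h) = (?T * ?T) * (h * (?T * h))" by (simp add: mat_dim_simps)
    ultimately show ?thesis unfolding Tmat_Tmat by (simp add: one_mult_mat_dim)
  qed
  have Th: "?T * h = four_block_mat ?A ?B (- ?C) (- ?D)"
    by (subst hb, subst Tb, subst mult_four_block_mat[where ?n1.0=n and ?n2.0=n and ?nc1.0=n and ?nc2.0=n])
       (auto simp: mat_dim_simps)
  have "h * (?T * h) = four_block_mat (?A * ?A + ?B * (- ?C)) (?A * ?B + ?B * (- ?D))
      (?C * ?A + ?D * (- ?C)) (?C * ?B + ?D * (- ?D))"
    unfolding Th by (subst hb, subst mult_four_block_mat[where ?n1.0=n and ?n2.0=n and ?nc1.0=n and ?nc2.0=n]) auto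
  then have e: "four_block_mat (?A * ?A + ?B * (- ?C)) (?A * ?B + ?B * (- ?D))
      (?C * ?A + ?D * (- ?C)) (?C * ?B + ?D * (- ?D)) 
     = four_block_mat (1\<^sub>m n) (0\<^sub>m n n) (0\<^sub>m n n) (- 1\<^sub>m n)" using hTh Tb by simp
  have e11: "?A * ?A + ?B * (- ?C) = 1\<^sub>m n" 
    by (rule four_block_mat_inject(1)[OF e]) auto
  have e12: "?A * ?B + ?B * (- ?D) = 0\<^sub>m n n" 
    by (rule four_block_mat_inject(2)[OF e]) auto
  show "?A * ?A - ?B * ?C = 1\<^sub>m n" using e11 add_uminus_minus_mat[of "?A * ?A" n n "?B * ?C", OF carrier_matI carrier_matI] by simp
  show "?A * ?B = ?B * ?D"
  proof (rule eq_matI)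
    fix i j assume ij: "i < dim_row (?B * ?D)" "j < dim_col (?B * ?D)"
    have "(?A * ?B + ?B * (- ?D)) $$ (i,j) = 0" unfolding e12 using ij by simp
    then show "(?A * ?B) $$ (i,j) = (?B * ?D) $$ (i,j)" using ij by (simp del: index_mult_mat(1))
  qed auto
  have hJh: "h\<^sup>T * (?J * h) = ?J" using h unfolding is_Sp_def by (simp add: mat_dim_simps)
  have "(?J * (?T * h))\<^sup>T = h\<^sup>T * (?T * - ?J)" by (simp add: mat_dim_simps)
  also have "?T * - ?J = ?J * ?T" using Tmat_Jmat[of n] by simp
  also have "h\<^sup>T * (?J * ?T) = h\<^sup>T * (?J * (h * (?T * h)))" unfolding hTh ..
  also have "\<dots> = (h\<^sup>T * (?J * h)) * (?T * h)" by (simp add: mat_dim_simps)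
  also have "\<dots> = ?J * (?T * h)" unfolding hJh ..
  finally have sym: "(?J * (?T * h))\<^sup>T = ?J * (?T * h)" .
  have "?J * (?T * h) = four_block_mat (- ?C) (- ?D) (- ?A) (- ?B)"
    unfolding Th by (subst Jb, subst mult_four_block_mat[where ?n1.0=n and ?n2.0=n and ?nc1.0=n and ?nc2.0=n])
       (auto simp: mat_dim_simps)
  with sym have "(four_block_mat (- ?C) (- ?D) (- ?A) (- ?B))\<^sup>T = four_block_mat (- ?C) (- ?D) (- ?A) (- ?B)" by metis
  then have s: "four_block_mat ((- ?C)\<^sup>T) ((- ?A)\<^sup>T) ((- ?D)\<^sup>T) ((- ?B)\<^sup>T) = four_block_mat (- ?C) (- ?D) (- ?A) (- ?B)"
    by (subst (asm) transpose_four_block_mat[of _ n n _ n _ n]) auto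
  have um: "X = Y" if "- X = - Y" for X Y :: "real mat"
    using that uminus_uminus_mat[of X] uminus_uminus_mat[of Y] by metis
  have "(- ?C)\<^sup>T = - ?C" by (rule four_block_mat_inject(1)[OF s]) auto
  then show "?C\<^sup>T = ?C" using um[of "?C\<^sup>T" "?C"] by (simp only: transpose_uminus)
  have "(- ?B)\<^sup>T = - ?B" by (rule four_block_mat_inject(4)[OF s]) auto
  then show "?B\<^sup>T = ?B" using um[of "?B\<^sup>T" "?B"] by (simp only: transpose_uminus)
  have "(- ?A)\<^sup>T = - ?D" by (rule four_block_mat_inject(2)[OF s]) auto
  then show "?D = ?A\<^sup>T" using um[of "?A\<^sup>T" "?D"] by (simp only: transpose_uminus)
qed

text \<open>Over a fixed \<open>Z\<close> the antiholomorphic involution acts on the off-diagonal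
  column by \<open>w \<mapsto> -a ((A + Z C) conj w + b + Z al)\<close>. This is real affine, so the
  midpoint of an orbit is fixed, and the given \<open>w\<close> is the midpoint of 0 and its image.
  The second claim is the corner equation: it determines the real part of the last diagonal entry
  and is satisfied for every imaginary part.\<close>

lemma fixed_point_blocks:
  fixes A B C Z al b :: "complex mat" and a be :: real
  assumes c [simp]: "A \<in> carrier_mat q q" "B \<in> carrier_mat q q" "C \<in> carrier_mat q q" "Z \<in> carrier_mat q q"
      "al \<in> carrier_mat q 1" "b \<in> carrier_mat q 1"
    and real: "conj_mat A = A" "conj_mat C = C" "conj_mat al = al" "conj_mat b = b"
    and sym: "C\<^sup>T = C" "Z\<^sup>T = Z"
    and e11: "A * Z + B = - (conj_mat Z * (C * Z + A\<^sup>T))"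
    and r1: "A\<^sup>T * al + of_real a \<cdot>\<^sub>m al = C * b"
    and r2: "A * b = B * al + of_real a \<cdot>\<^sub>m b"
    and a: "a * a = 1"
    and w: "w = (- of_real a / 2) \<cdot>\<^sub>m (b + Z * al)"
  shows "A * w + b = - (conj_mat Z * (C * w + al) + of_real a \<cdot>\<^sub>m conj_mat w)"
    and "\<exists>r. \<forall>y. al\<^sup>T * w + mat 1 1 (\<lambda>_. of_real a) * mat 1 1 (\<lambda>_. Complex r y) + mat 1 1 (\<lambda>_. of_real be)
       = - ((conj_mat w)\<^sup>T * (C * w + al) + conj_mat (mat 1 1 (\<lambda>_. Complex r y)) * mat 1 1 (\<lambda>_. of_real a))"
proof -
  have dims [simp]: "dim_row A = q" "dim_col A = q" "dim_row B = q" "dim_col B = q" "dim_row C = q" "dim_col C = q"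
    "dim_row Z = q" "dim_col Z = q" "dim_row al = q" "dim_col al = 1" "dim_row b = q" "dim_col b = 1"
    using c by (simp_all only: carrier_matD)
  let ?a = "complex_of_real a"
  let ?c = "b + conj_mat Z * al"
  have wd [simp]: "dim_row w = q" "dim_col w = 1" unfolding w by auto
  have cZal: "conj_mat (Z * al) = conj_mat Z * al"
    using cnj_hom.mat_hom_mult[OF c(4,5)] real by simp
  have cw: "conj_mat w = (- ?a / 2) \<cdot>\<^sub>m ?c"
  proof -
    have "conj_mat w = (- ?a / 2) \<cdot>\<^sub>m (conj_mat b + conj_mat (Z * al))"
      unfolding w by (intro eq_matI) (auto simp del: index_mult_mat(1))
    then show ?thesis unfolding cZal real .
  qed
  \<comment> \<open>\<open>e11\<close> multiplied by \<open>al\<close>, with the terms in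
    \<open>A\<close> and \<open>C\<close> collected on one side as they occur in the image of
    \<open>Z * al\<close>.\<close>
  have ZA: "A * (Z * al) + conj_mat Z * (C * (Z * al)) = - (B * al) - conj_mat Z * (A\<^sup>T * al)"
  proof -
    have "(A * Z + B) * al = (- (conj_mat Z * (C * Z + A\<^sup>T))) * al" using e11 by simp
    then have e: "A * (Z * al) + B * al = - (conj_mat Z * (C * (Z * al)) + conj_mat Z * (A\<^sup>T * al))"
      by (simp add: mat_dim_simps)
    show ?thesis
    proof (rule eq_matI)
      fix i j assume ij: "i < dim_row (- (B * al) - conj_mat Z * (A\<^sup>T * al))" "j < dim_col (- (B * al) - conj_mat Z * (A\<^sup>T * al))"
      have aux: "x + u = - y - v" if "x + y = - (u + v)" for x y u v :: complex
      proof -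
        have "x = - (u + v) - y" using that by (simp add: eq_diff_eq)
        then show ?thesis by simp
      qed
      have "(A * (Z * al)) $$ (i,j) + (B * al) $$ (i,j) =
          - ((conj_mat Z * (C * (Z * al))) $$ (i,j) + (conj_mat Z * (A\<^sup>T * al)) $$ (i,j))"
        using arg_cong[OF e, of "\<lambda>X. X $$ (i,j)"] ij by (simp del: index_mult_mat(1))
      from aux[OF this] ij
      show "(A * (Z * al) + conj_mat Z * (C * (Z * al))) $$ (i,j) = (- (B * al) - conj_mat Z * (A\<^sup>T * al)) $$ (i,j)"
        by (simp del: index_mult_mat(1))
    qed auto
  qed
  have M: "A * w + conj_mat Z * (C * w) = (- 1 / 2) \<cdot>\<^sub>m ?c"
  proof -
    have "A * w + conj_mat Z * (C * w) = (- ?a / 2) \<cdot>\<^sub>m (A * b + A * (Z * al)) + (- ?a / 2) \<cdot>\<^sub>m (conj_mat Z * (C * b) + conj_mat Z * (C * (Z * al)))"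
      unfolding w by (simp add: mat_dim_simps)
    also have "\<dots> = (- ?a / 2) \<cdot>\<^sub>m (A * b + conj_mat Z * (C * b) + (A * (Z * al) + conj_mat Z * (C * (Z * al))))"
      by (intro eq_matI) (auto simp: algebra_simps simp del: index_mult_mat(1))
    also have "\<dots> = (- ?a / 2) \<cdot>\<^sub>m ((B * al + ?a \<cdot>\<^sub>m b) + (conj_mat Z * (A\<^sup>T * al) + ?a \<cdot>\<^sub>m (conj_mat Z * al)) + (- (B * al) - conj_mat Z * (A\<^sup>T * al)))"
      unfolding ZA r2 r1[symmetric] by (simp add: mat_dim_simps)
    also have "\<dots> = (- ?a / 2) \<cdot>\<^sub>m (?a \<cdot>\<^sub>m ?c)"
      by (intro eq_matI) (auto simp: algebra_simps simp del: index_mult_mat(1))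
    also have "\<dots> = (- (?a * ?a) / 2) \<cdot>\<^sub>m ?c"
      by (intro eq_matI) (auto simp: algebra_simps simp del: index_mult_mat(1))
    also have "?a * ?a = 1" using a by (metis of_real_1 of_real_mult)
    finally show ?thesis .
  qed
  have aa: "?a * ?a = 1" using a by (metis of_real_1 of_real_mult)
  have acw: "?a \<cdot>\<^sub>m conj_mat w = (- 1 / 2) \<cdot>\<^sub>m ?c"
  proof -
    have "?a \<cdot>\<^sub>m conj_mat w = (- (?a * ?a) / 2) \<cdot>\<^sub>m ?c"
      unfolding cw by (intro eq_matI) (auto simp: algebra_simps simp del: index_mult_mat(1))
    then show ?thesis unfolding aa .
  qed
  have "A * w + b = (A * w + conj_mat Z * (C * w)) + b - conj_mat Z * (C * w)"
    by (intro eq_matI) (auto simp: algebra_simps simp del: index_mult_mat(1))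
  also have "\<dots> = - (conj_mat Z * (C * w) + conj_mat Z * al + (- 1 / 2) \<cdot>\<^sub>m ?c)"
    unfolding M by (intro eq_matI) (auto simp: field_simps simp del: index_mult_mat(1))
  also have "\<dots> = - (conj_mat Z * (C * w + al) + ?a \<cdot>\<^sub>m conj_mat w)"
    unfolding acw by (simp add: mat_dim_simps)
  finally show "A * w + b = - (conj_mat Z * (C * w + al) + of_real a \<cdot>\<^sub>m conj_mat w)" .
  have wc: "w \<in> carrier_mat q 1" by (rule carrier_matI) auto
  \<comment> \<open>The part of the corner equation in \<open>w\<close> alone. It is Hermitian of
    size 1, hence real, which is what allows a real number to balance it.\<close>
  define S where "S = al\<^sup>T * w + (conj_mat w)\<^sup>T * (C * w) + (conj_mat w)\<^sup>T * al"
  have cm: "conj_mat (X * Y) = conj_mat X * conj_mat Y" if "dim_col X = dim_row Y" for X Y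
    by (rule cnj_hom.mat_hom_mult[of _ "dim_row X" "dim_col X" _ "dim_col Y"]) (use that in auto)
  have ct: "conj_mat (X\<^sup>T) = (conj_mat X)\<^sup>T" for X by (intro eq_matI) auto
  have cc: "conj_mat (conj_mat X) = X" for X by (intro eq_matI) auto
  have ca: "conj_mat (X + Y) = conj_mat X + conj_mat Y" if "dim_row X = dim_row Y" "dim_col X = dim_col Y" for X Y
    using that by (intro eq_matI) auto
  have "(conj_mat S)\<^sup>T = (conj_mat w)\<^sup>T * al + ((conj_mat w)\<^sup>T * C) * w + al\<^sup>T * w"
    unfolding S_def by (simp add: cm ct cc ca real sym transpose_add_dim mat_dim_simps)
  also have "\<dots> = S" unfolding S_def
    by (intro eq_matI) (auto simp: algebra_simps mat_dim_simps simp del: index_mult_mat(1))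
  finally have "(conj_mat S)\<^sup>T $$ (0, 0) = S $$ (0, 0)" by simp
  then have "cnj (S $$ (0, 0)) = S $$ (0, 0)" unfolding S_def by (simp del: index_mult_mat(1))
  then obtain s where s: "S $$ (0, 0) = of_real s" using Reals_cnj_iff by (metis Reals_cases)
  \<comment> \<open>Solves \<open>2 * a * r = - (s + be)\<close>, as \<open>a * a = 1\<close>. The
    imaginary part cancels because the last entry and its conjugate carry the same real coefficient
    \<open>a\<close>.\<close>
  let ?r = "- (a / 2) * (s + be)"
  show "\<exists>r. \<forall>y. al\<^sup>T * w + mat 1 1 (\<lambda>_. of_real a) * mat 1 1 (\<lambda>_. Complex r y) + mat 1 1 (\<lambda>_. of_real be)
       = - ((conj_mat w)\<^sup>T * (C * w + al) + conj_mat (mat 1 1 (\<lambda>_. Complex r y)) * mat 1 1 (\<lambda>_. of_real a))"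
  proof (rule exI[of _ ?r], rule allI, rule eq_matI)
    fix y i j
    assume "i < dim_row (- ((conj_mat w)\<^sup>T * (C * w + al) + conj_mat (mat 1 1 (\<lambda>_. Complex ?r y)) * mat 1 1 (\<lambda>_. of_real a)))"
      "j < dim_col (- ((conj_mat w)\<^sup>T * (C * w + al) + conj_mat (mat 1 1 (\<lambda>_. Complex ?r y)) * mat 1 1 (\<lambda>_. of_real a)))"
    then have ij: "i = 0" "j = 0" by auto
    have s': "(al\<^sup>T * w) $$ (0, 0) + ((conj_mat w)\<^sup>T * (C * w)) $$ (0, 0) + ((conj_mat w)\<^sup>T * al) $$ (0, 0) = of_real s"
      using s unfolding S_def by (simp del: index_mult_mat(1))
    have re: "?a * Complex ?r y + cnj (Complex ?r y) * ?a = - of_real (s + be)"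
    proof -
      have "?a * Complex ?r y + cnj (Complex ?r y) * ?a = of_real (2 * a * ?r)"
        by (simp add: complex_eq_iff)
      also have "2 * a * ?r = - (a * a) * (s + be)" by (simp add: algebra_simps)
      finally show ?thesis unfolding a by simp
    qed
    have aux: "p + x + t = - (q + r + z)" if "p + q + r = u" "x + z = - (u + t)" for p q r t u x z :: complex
    proof -
      have "p + x + t + (q + r + z) = (p + q + r) + (x + z) + t" by simp
      also have "\<dots> = 0" unfolding that by simp
      finally show ?thesis by (simp only: eq_neg_iff_add_eq_0)
    qed
    have l: "(al\<^sup>T * w + mat 1 1 (\<lambda>_. of_real a) * mat 1 1 (\<lambda>_. Complex ?r y) + mat 1 1 (\<lambda>_. of_real be)) $$ (0, 0)
      = (al\<^sup>T * w) $$ (0, 0) + ?a * Complex ?r y + of_real be"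
      by (simp add: mult_scalar_mat[unfolded One_nat_def] del: index_mult_mat(1))
    have rr: "(- ((conj_mat w)\<^sup>T * (C * w + al) + conj_mat (mat 1 1 (\<lambda>_. Complex ?r y)) * mat 1 1 (\<lambda>_. of_real a))) $$ (0, 0)
      = - (((conj_mat w)\<^sup>T * (C * w)) $$ (0, 0) + ((conj_mat w)\<^sup>T * al) $$ (0, 0) + cnj (Complex ?r y) * ?a)"
      by (simp add: mult_scalar_mat[unfolded One_nat_def] mat_dim_simps del: index_mult_mat(1) complex_cnj)
    show "(al\<^sup>T * w + mat 1 1 (\<lambda>_. of_real a) * mat 1 1 (\<lambda>_. Complex ?r y) + mat 1 1 (\<lambda>_. of_real be)) $$ (i, j)
      = (- ((conj_mat w)\<^sup>T * (C * w + al) + conj_mat (mat 1 1 (\<lambda>_. Complex ?r y)) * mat 1 1 (\<lambda>_. of_real a))) $$ (i, j)"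
      unfolding ij l rr by (rule aux[OF s' re[unfolded of_real_add]])
  qed auto
qed

section \<open>Extending a point by one row and column\<close>

lemma pos_def_inverse:
  assumes "pos_def n Y"
  shows "minv Y \<in> carrier_mat n n" "Y * minv Y = 1\<^sub>m n"
proof -
  have Y: "Y \<in> carrier_mat n n" using assms unfolding pos_def_def by auto
  have "x = 0\<^sub>v n" if "x \<in> carrier_vec n" "Y *\<^sub>v x = 0\<^sub>v n" for x
    using assms that unfolding pos_def_def by (metis order_less_irrefl scalar_prod_right_zero)
  from inverse_if_kernel_trivial[OF Y this] show "minv Y \<in> carrier_mat n n" "Y * minv Y = 1\<^sub>m n" by auto
qed

text \<open>Completing the square: with \<open>u = Y^{-1} y\<close>, the form at
  \<open>(x, s)\<close> equals
  \<open>(x + s u)^T Y (x + s u) + s^2 (eta - y^T Y^{-1} y)\<close>.\<close>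

lemma pos_def_extend:
  assumes Y: "pos_def q Y" and y: "y \<in> carrier_vec q"
    and t: "eta - y \<bullet> (minv Y *\<^sub>v y) > 0"
    and E: "E = four_block_mat Y (mat q 1 (\<lambda>(i,_). y $ i)) (mat 1 q (\<lambda>(_,j). y $ j)) (mat 1 1 (\<lambda>_. eta))"
  shows "pos_def (Suc q) E"
proof -
  have Yc: "Y \<in> carrier_mat q q" and Ys: "Y\<^sup>T = Y" using Y unfolding pos_def_def by auto
  have [simp]: "dim_row Y = q" "dim_col Y = q" "dim_vec y = q" using Yc y by auto
  note iv = pos_def_inverse[OF Y]
  define u where "u = minv Y *\<^sub>v y"
  have u: "u \<in> carrier_vec q" unfolding u_def using iv y by simp
  have Yu: "Y *\<^sub>v u = y" unfolding u_def using assoc_mult_mat_vec[OF Yc iv(1) y] iv(2) y by simp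
  have Ec: "E \<in> carrier_mat (Suc q) (Suc q)" unfolding E by (rule carrier_matI) auto
  have Ysym: "Y $$ (i, j) = Y $$ (j, i)" if "i < q" "j < q" for i j
    using that by (subst Ys[symmetric]) simp
  show ?thesis unfolding pos_def_def
  proof (intro conjI ballI impI Ec)
    show "E\<^sup>T = E" unfolding E by (intro eq_matI) (auto simp: Ysym)
  next
    fix v :: "real vec" assume v: "v \<in> carrier_vec (Suc q)" "v \<noteq> 0\<^sub>v (Suc q)"
    define x where "x = vec q (\<lambda>i. v $ i)"
    define s where "s = v $ q"
    have x: "x \<in> carrier_vec q" unfolding x_def by simp
    have "v \<bullet> (E *\<^sub>v v) = (\<Sum>i<Suc q. v $ i * (\<Sum>j<Suc q. E $$ (i, j) * v $ j))"
      using v Ec by (simp add: scalar_prod_def atLeast0LessThan)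
    also have "\<dots> = (\<Sum>i<q. x $ i * ((\<Sum>j<q. Y $$ (i, j) * x $ j) + y $ i * s)) + s * ((\<Sum>j<q. y $ j * x $ j) + eta * s)"
      unfolding E x_def s_def by simp
    also have "\<dots> = (\<Sum>i<q. x $ i * (\<Sum>j<q. Y $$ (i, j) * x $ j)) + 2 * s * (\<Sum>j<q. x $ j * y $ j) + s\<^sup>2 * eta"
    proof -
      have 1: "(\<Sum>i<q. x $ i * (f i + y $ i * s)) = (\<Sum>i<q. x $ i * f i) + s * (\<Sum>i<q. x $ i * y $ i)" for f
        unfolding distrib_left sum.distrib sum_distrib_left by (simp add: ac_simps)
      have 2: "(\<Sum>j<q. y $ j * x $ j) = (\<Sum>j<q. x $ j * y $ j)" by (intro sum.cong refl mult.commute)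
      show ?thesis unfolding 1 2 by (simp only: distrib_left power2_eq_square) simp
    qed
    also have "(\<Sum>i<q. x $ i * (\<Sum>j<q. Y $$ (i, j) * x $ j)) = x \<bullet> (Y *\<^sub>v x)"
      using x by (simp add: scalar_prod_def atLeast0LessThan)
    also have "(\<Sum>j<q. x $ j * y $ j) = x \<bullet> y"
      using x y by (simp add: scalar_prod_def atLeast0LessThan)
    finally have vEv: "v \<bullet> (E *\<^sub>v v) = x \<bullet> (Y *\<^sub>v x) + 2 * s * (x \<bullet> y) + s\<^sup>2 * eta" .
    define z where "z = x + s \<cdot>\<^sub>v u"
    have z: "z \<in> carrier_vec q" unfolding z_def using x u by simp
    have uYx: "u \<bullet> (Y *\<^sub>v x) = x \<bullet> y"
    proof -
      have "u \<bullet> (Y\<^sup>T *\<^sub>v x) = (Y *\<^sub>v u) \<bullet> x" by (rule scalar_prod_transpose_mult[OF Yc u x])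
      then show ?thesis unfolding Ys Yu using comm_scalar_prod[OF x y] by simp
    qed
    have Yz: "Y *\<^sub>v z = Y *\<^sub>v x + s \<cdot>\<^sub>v y"
      unfolding z_def using Yc x u Yu
      by (simp add: mult_add_distrib_mat_vec[OF Yc] mult_mat_vec[OF Yc])
    have zz: "z \<bullet> (Y *\<^sub>v z) = x \<bullet> (Y *\<^sub>v x) + s * (x \<bullet> y) + (s * (u \<bullet> (Y *\<^sub>v x)) + s * (s * (u \<bullet> y)))"
      unfolding Yz unfolding z_def using Yc x u y
      by (simp add: add_scalar_prod_distrib[of _ q] scalar_prod_add_distrib[of _ q] algebra_simps mult_mat_vec_carrier[OF Yc])
    have yu: "y \<bullet> (minv Y *\<^sub>v y) = u \<bullet> y" unfolding u_def[symmetric] by (rule comm_scalar_prod[OF y u])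
    have sq: "v \<bullet> (E *\<^sub>v v) = z \<bullet> (Y *\<^sub>v z) + s\<^sup>2 * (eta - y \<bullet> (minv Y *\<^sub>v y))"
      unfolding vEv yu zz uYx by (simp add: right_diff_distrib power2_eq_square)
    show "0 < v \<bullet> (E *\<^sub>v v)"
    proof (cases "s = 0")
      case True
      have "x \<noteq> 0\<^sub>v q"
      proof
        assume "x = 0\<^sub>v q"
        then have "v $ i = 0" if "i < q" for i using that unfolding x_def by (metis index_vec index_zero_vec(1))
        then have "v = 0\<^sub>v (Suc q)" using v(1) True unfolding s_def by (intro eq_vecI) (auto simp: less_Suc_eq)
        with v(2) show False ..
      qed
      then show ?thesis using Y x True unfolding vEv pos_def_def by simp
    next
      case False
      have "z \<bullet> (Y *\<^sub>v z) \<ge> 0" using Y z Yc unfolding pos_def_def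
        by (cases "z = 0\<^sub>v q") (auto intro!: less_imp_le)
      moreover have "s\<^sup>2 * (eta - y \<bullet> (minv Y *\<^sub>v y)) > 0" using False t by simp
      ultimately show ?thesis unfolding sq by linarith
    qed
  qed
qed

text \<open>The height is the Schur complement of \<open>Im Z\<close> in \<open>Im W\<close>.
  Increasing \<open>eta\<close> therefore raises the height at will, and a positive height is enough
  for membership in the Siegel space.\<close>

lemma siegel_extend:
  assumes Z: "siegel q Z" and w: "w \<in> carrier_mat q 1"
    and W: "W = four_block_mat Z w (w\<^sup>T) (mat 1 1 (\<lambda>_. Complex r eta))"
    and y: "y = vec q (\<lambda>i. Im (w $$ (i, 0)))"
  shows "height (Suc q) W = eta - y \<bullet> (minv (map_mat Im Z) *\<^sub>v y)"
    "height (Suc q) W > 0 \<Longrightarrow> siegel (Suc q) W"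
proof -
  have Zc: "Z \<in> carrier_mat q q" and Zs: "Z\<^sup>T = Z" and Zp: "pos_def q (map_mat Im Z)"
    using Z unfolding siegel_def by auto
  have [simp]: "dim_row Z = q" "dim_col Z = q" "dim_row w = q" "dim_col w = 1" using Zc w by auto
  have 1: "mat q q (\<lambda>(i, j). map_mat Im W $$ (i, j)) = map_mat Im Z"
    unfolding W by (intro eq_matI) auto
  have 2: "vec q (\<lambda>i. map_mat Im W $$ (i, q)) = y"
    unfolding W y by (intro eq_vecI) auto
  have 3: "map_mat Im W $$ (q, q) = eta" unfolding W by simp
  show ht: "height (Suc q) W = eta - y \<bullet> (minv (map_mat Im Z) *\<^sub>v y)"
    unfolding height_def Let_def diff_Suc_1 1 2 3 ..
  have Zsym: "Z $$ (i, j) = Z $$ (j, i)" if "i < q" "j < q" for i j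
    using that by (subst Zs[symmetric]) simp
  assume pos: "height (Suc q) W > 0"
  have "pos_def (Suc q) (map_mat Im W)"
  proof (rule pos_def_extend[OF Zp])
    show "y \<in> carrier_vec q" unfolding y by simp
    show "0 < eta - y \<bullet> (minv (map_mat Im Z) *\<^sub>v y)" using pos unfolding ht .
    show "map_mat Im W = four_block_mat (map_mat Im Z) (mat q 1 (\<lambda>(i, _). y $ i)) (mat 1 q (\<lambda>(_, j). y $ j)) (mat 1 1 (\<lambda>_. eta))"
      unfolding W y by (intro eq_matI) auto
  qed
  moreover have "W\<^sup>T = W" unfolding W by (intro eq_matI) (auto simp: Zsym)
  moreover have "W \<in> carrier_mat (Suc q) (Suc q)" unfolding W by (rule carrier_matI) auto
  ultimately show "siegel (Suc q) W" unfolding siegel_def by simp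
qed

section \<open>From a boundary point to fixed points in the interior\<close>

lemma blk_cplx:
  assumes "h \<in> carrier_mat (2*n) (2*n)"
  shows "blkA n (cplx h) = cplx (blkA n h)" "blkB n (cplx h) = cplx (blkB n h)"
    "blkC n (cplx h) = cplx (blkC n h)" "blkD n (cplx h) = cplx (blkD n h)"
  unfolding blkA_def blkB_def blkC_def blkD_def using assms by (intro eq_matI; auto)+

lemma tau_pt_eq: "tau_pt Z = - conj_mat Z"
  unfolding tau_pt_def by (intro eq_matI) auto

text \<open>The condition \<open>h W = \<tau>(W)\<close> cleared of its denominator: since
  \<open>\<tau>(W)\<close> is minus the conjugate of \<open>W\<close>, it becomes one polynomial
  equation between blocks, with automorphy factor \<open>C W + D\<close>.\<close>

lemma lagrangian_image_eqI:
  assumes h: "h \<in> carrier_mat (2*n) (2*n)" and W: "W \<in> carrier_mat n n"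
    and e: "cplx (blkA n h) * W + cplx (blkB n h) = - (conj_mat W * (cplx (blkC n h) * W + cplx (blkD n h)))"
  shows "cplx h * (W @\<^sub>r 1\<^sub>m n) = (tau_pt W @\<^sub>r 1\<^sub>m n) * (cplx (blkC n h) * W + cplx (blkD n h))"
proof -
  have "(tau_pt W @\<^sub>r 1\<^sub>m n) * (cplx (blkC n h) * W + cplx (blkD n h))
    = (tau_pt W * (cplx (blkC n h) * W + cplx (blkD n h))) @\<^sub>r (1\<^sub>m n * (cplx (blkC n h) * W + cplx (blkD n h)))"
    by (rule append_rows_mult[of _ n n _ n _ n]) (use W in \<open>auto simp: tau_pt_eq intro!: carrier_matI\<close>)
  also have "tau_pt W * (cplx (blkC n h) * W + cplx (blkD n h)) = cplx (blkA n h) * W + cplx (blkB n h)"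
    unfolding e tau_pt_eq using W by simp
  also have "1\<^sub>m n * (cplx (blkC n h) * W + cplx (blkD n h)) = cplx (blkC n h) * W + cplx (blkD n h)"
    using W by (simp add: one_mult_mat_dim)
  finally show ?thesis unfolding lagrangian_image[OF h W] blk_cplx[OF h] ..
qed

text \<open>The lower rows identify the unknown factor \<open>M\<close> as \<open>C W + D\<close>,
  which may then be substituted in the upper rows.\<close>

lemma lagrangian_image_eqD:
  assumes h: "h \<in> carrier_mat (2*n) (2*n)" and W: "W \<in> carrier_mat n n" and M: "M \<in> carrier_mat n n"
    and e: "cplx h * (W @\<^sub>r 1\<^sub>m n) = (tau_pt W @\<^sub>r 1\<^sub>m n) * M"
  shows "cplx (blkA n h) * W + cplx (blkB n h) = - (conj_mat W * (cplx (blkC n h) * W + cplx (blkD n h)))"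
proof -
  have t: "tau_pt W \<in> carrier_mat n n" using W unfolding tau_pt_def by simp
  have "(tau_pt W @\<^sub>r 1\<^sub>m n) * M = (tau_pt W * M) @\<^sub>r (1\<^sub>m n * M)"
    by (rule append_rows_mult[of _ n n _ n _ n]) (use t M in auto)
  then have e': "(cplx (blkA n h) * W + cplx (blkB n h)) @\<^sub>r (cplx (blkC n h) * W + cplx (blkD n h)) = (tau_pt W * M) @\<^sub>r M"
    using e M unfolding lagrangian_image[OF h W] blk_cplx[OF h] by (simp add: one_mult_mat_dim)
  have "cplx (blkA n h) * W + cplx (blkB n h) = tau_pt W * M"
    by (rule append_rows_inject(1)[OF _ _ _ _ e']) (use W M t in \<open>auto intro!: carrier_matI\<close>)
  moreover have "cplx (blkC n h) * W + cplx (blkD n h) = M"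
    by (rule append_rows_inject(2)[OF _ _ _ _ e']) (use W M t in \<open>auto intro!: carrier_matI\<close>)
  ultimately show ?thesis unfolding tau_pt_eq using W M by simp
qed

text \<open>For \<open>W = (Z, w; w^T, omega)\<close> the equation \<open>h W = \<tau>(W)\<close>
  splits into four blocks. The upper left one is the hypothesis on \<open>Z\<close>, the upper right
  one is solved by \<open>w\<close>, the lower left one is the conjugate transpose of the upper
  right one rearranged, and the corner leaves \<open>Im omega\<close> free to make the height
  large.\<close>

lemma boundary_fixed_point:
  assumes n: "n = Suc q" and h: "is_Sp n h" and inv: "Tmat n * h * Tmat n * h = 1\<^sub>m (2*n)"
    and stab: "stab_bc n h" and Z: "siegel q Z" and M: "M \<in> carrier_mat q q"
    and e: "cplx (levi_proj n h) * (Z @\<^sub>r 1\<^sub>m q) = (tau_pt Z @\<^sub>r 1\<^sub>m q) * M"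
  obtains W M' where "siegel n W" "\<And>i j. i < q \<Longrightarrow> j < q \<Longrightarrow> W $$ (i, j) = Z $$ (i, j)"
    "height n W > t" "M' \<in> carrier_mat n n" "cplx h * (W @\<^sub>r 1\<^sub>m n) = (tau_pt W @\<^sub>r 1\<^sub>m n) * M'"
proof -
  note hc = is_Sp_carrier[OF h]
  note [simp] = is_Sp_dim[OF h]
  define A B C where ABC: "A = blkA n h" "B = blkB n h" "C = blkC n h"
  have D: "blkD n h = A\<^sup>T" and Bs: "B\<^sup>T = B" and Cs: "C\<^sup>T = C" 
    and AA: "A * A - B * C = 1\<^sub>m n" and AB: "A * B = B * A\<^sup>T"
    using involution_blocks[OF h inv] unfolding ABC by auto
  have d [simp]: "dim_row A = Suc q" "dim_col A = Suc q" "dim_row B = Suc q" "dim_col B = Suc q"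
    "dim_row C = Suc q" "dim_col C = Suc q" unfolding ABC n by auto
  have st: "A $$ (i, q) = 0" if "i < q" for i
    using stab that unfolding stab_bc_def ABC blkA_def n by auto
  have stC: "C $$ (i, q) = 0" if "i < Suc q" for i
    using stab that unfolding stab_bc_def ABC blkC_def n by auto
  have Bsym: "B $$ (i, j) = B $$ (j, i)" if "i < Suc q" "j < Suc q" for i j
    using that by (subst Bs[symmetric]) simp
  have Csym: "C $$ (i, j) = C $$ (j, i)" if "i < Suc q" "j < Suc q" for i j
    using that by (subst Cs[symmetric]) simp
  have Bsym': "B $$ (q, j) = B $$ (j, q)" if "j < q" for j using Bsym that by simp
  \<comment> \<open>Symmetry of \<open>C\<close>, a consequence of the involution property, turns
    the vanishing last column into a vanishing last row.\<close>
  have stC': "C $$ (q, j) = 0" if "j < Suc q" for j using Csym[of q j] stC that by simp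
  define A1 B1 C1 where A1: "A1 = mat q q (\<lambda>(i,j). A $$ (i, j))" and B1: "B1 = mat q q (\<lambda>(i,j). B $$ (i, j))"
    and C1: "C1 = mat q q (\<lambda>(i,j). C $$ (i, j))"
  define al b where al: "al = mat q 1 (\<lambda>(j, _). A $$ (q, j))" and b: "b = mat q 1 (\<lambda>(i, _). B $$ (i, q))"
  define a be where a: "a = A $$ (q, q)" and be: "be = B $$ (q, q)"
  have d1 [simp]: "dim_row A1 = q" "dim_col A1 = q" "dim_row B1 = q" "dim_col B1 = q"
    "dim_row C1 = q" "dim_col C1 = q" "dim_row al = q" "dim_col al = 1" "dim_row b = q" "dim_col b = 1"
    unfolding A1 B1 C1 al b by auto
  have c1 [simp]: "A1 \<in> carrier_mat q q" "B1 \<in> carrier_mat q q" "C1 \<in> carrier_mat q q"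
    "al \<in> carrier_mat q 1" "b \<in> carrier_mat q 1" by (auto intro: carrier_matI)
  have Ab: "A = four_block_mat A1 (0\<^sub>m q 1) (al\<^sup>T) (mat 1 1 (\<lambda>_. a))"
    unfolding A1 al a by (intro eq_matI) (auto simp: st less_Suc_eq)
  have ATb: "A\<^sup>T = four_block_mat (A1\<^sup>T) al (0\<^sub>m 1 q) (mat 1 1 (\<lambda>_. a))"
    unfolding A1 al a by (intro eq_matI) (auto simp: st less_Suc_eq)
  have Bb: "B = four_block_mat B1 b (b\<^sup>T) (mat 1 1 (\<lambda>_. be))"
    unfolding B1 b be by (intro eq_matI) (auto simp: less_Suc_eq Bsym')
  have Cb: "C = four_block_mat C1 (0\<^sub>m q 1) (0\<^sub>m 1 q) (0\<^sub>m 1 1)"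
    unfolding C1 by (intro eq_matI) (auto simp: less_Suc_eq stC stC')
  have C1s: "C1\<^sup>T = C1" unfolding C1 by (intro eq_matI) (auto intro: Csym)
  note mfb = mult_four_block_mat[where ?nr1.0=q and ?n1.0=q and ?nc1.0=q and ?nr2.0=1 and ?n2.0=1 and ?nc2.0=1]
  have AAb: "A * A = four_block_mat (A1 * A1 + 0\<^sub>m q 1 * al\<^sup>T) (A1 * 0\<^sub>m q 1 + 0\<^sub>m q 1 * mat 1 1 (\<lambda>_. a))
      (al\<^sup>T * A1 + mat 1 1 (\<lambda>_. a) * al\<^sup>T) (al\<^sup>T * 0\<^sub>m q 1 + mat 1 1 (\<lambda>_. a) * mat 1 1 (\<lambda>_. a))"
    unfolding Ab by (rule mfb) auto
  have BCb: "B * C = four_block_mat (B1 * C1 + b * 0\<^sub>m 1 q) (B1 * 0\<^sub>m q 1 + b * 0\<^sub>m 1 1)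
      (b\<^sup>T * C1 + mat 1 1 (\<lambda>_. be) * 0\<^sub>m 1 q) (b\<^sup>T * 0\<^sub>m q 1 + mat 1 1 (\<lambda>_. be) * 0\<^sub>m 1 1)"
    unfolding Bb Cb by (rule mfb) auto
  have AA': "(A * A) $$ (i, j) = (B * C) $$ (i, j) + (if i = j then 1 else 0)" if "i < Suc q" "j < Suc q" for i j
    using arg_cong[OF AA, of "\<lambda>X. X $$ (i,j)"] that n by (auto simp del: index_mult_mat(1))
  \<comment> \<open>Corner of \<open>A * A - B * C = 1\<close>: the last column of \<open>C\<close>
    is zero, and that of \<open>A\<close> is zero above \<open>a\<close>.\<close>
  have aa: "a * a = 1"
    using AA'[of q q] unfolding AAb BCb
    by (simp add: mat_dim_simps mult_scalar_mat[unfolded One_nat_def] del: index_mult_mat(1))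
  \<comment> \<open>The rest of the last row of the same identity; its transpose is the relation
    \<open>r1\<close>.\<close>
  have "al\<^sup>T * A1 + a \<cdot>\<^sub>m al\<^sup>T = b\<^sup>T * C1"
  proof (rule eq_matI)
    fix i j assume ij: "i < dim_row (b\<^sup>T * C1)" "j < dim_col (b\<^sup>T * C1)"
    then show "(al\<^sup>T * A1 + a \<cdot>\<^sub>m al\<^sup>T) $$ (i, j) = (b\<^sup>T * C1) $$ (i, j)"
      using AA'[of q j] unfolding AAb BCb
      by (simp add: mat_dim_simps mult_scalar_mat[unfolded One_nat_def] del: index_mult_mat(1))
  qed auto
  then have "(al\<^sup>T * A1 + a \<cdot>\<^sub>m al\<^sup>T)\<^sup>T = (b\<^sup>T * C1)\<^sup>T" by simp
  moreover have "(a \<cdot>\<^sub>m al\<^sup>T)\<^sup>T = a \<cdot>\<^sub>m al" by (intro eq_matI) auto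
  ultimately have r1: "A1\<^sup>T * al + a \<cdot>\<^sub>m al = C1 * b"
    by (simp add: transpose_add_dim mat_dim_simps C1s)
  have ABb: "A * B = four_block_mat (A1 * B1 + 0\<^sub>m q 1 * b\<^sup>T) (A1 * b + 0\<^sub>m q 1 * mat 1 1 (\<lambda>_. be))
      (al\<^sup>T * B1 + mat 1 1 (\<lambda>_. a) * b\<^sup>T) (al\<^sup>T * b + mat 1 1 (\<lambda>_. a) * mat 1 1 (\<lambda>_. be))"
    unfolding Ab Bb by (rule mfb) auto
  have BATb: "B * A\<^sup>T = four_block_mat (B1 * A1\<^sup>T + b * 0\<^sub>m 1 q) (B1 * al + b * mat 1 1 (\<lambda>_. a))
      (b\<^sup>T * A1\<^sup>T + mat 1 1 (\<lambda>_. be) * 0\<^sub>m 1 q) (b\<^sup>T * al + mat 1 1 (\<lambda>_. be) * mat 1 1 (\<lambda>_. a))"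
    unfolding ATb Bb by (rule mfb) auto
  have "A1 * b + 0\<^sub>m q 1 * mat 1 1 (\<lambda>_. be) = B1 * al + b * mat 1 1 (\<lambda>_. a)"
    by (rule four_block_mat_inject(2)[OF AB[unfolded ABb BATb]]) (auto intro!: carrier_matI)
  then have r2: "A1 * b = B1 * al + a \<cdot>\<^sub>m b"
    by (simp add: mat_dim_simps mult_scalar_mat[unfolded One_nat_def])
  have Zc: "Z \<in> carrier_mat q q" and Zs: "Z\<^sup>T = Z" using Z unfolding siegel_def by auto
  have [simp]: "dim_row Z = q" "dim_col Z = q" using Zc by auto
  define L where "L = levi_proj n h"
  have Lc: "L \<in> carrier_mat (2*q) (2*q)" unfolding L_def levi_proj_def n by simp
  have LA: "blkA q L = A1" "blkB q L = B1" "blkC q L = C1"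
    unfolding L_def levi_proj_def n A1 B1 C1 ABC blkA_def blkB_def blkC_def by (intro eq_matI; simp)+
  have LD: "blkD q L = A1\<^sup>T"
  proof -
    have "blkD q L = mat q q (\<lambda>(i,j). blkD n h $$ (i, j))"
      unfolding L_def levi_proj_def n blkD_def by (intro eq_matI) auto
    also have "\<dots> = A1\<^sup>T" unfolding D A1 by (intro eq_matI) auto
    finally show ?thesis .
  qed
  have "cplx (blkA q L) * Z + cplx (blkB q L) = - (conj_mat Z * (cplx (blkC q L) * Z + cplx (blkD q L)))"
    by (rule lagrangian_image_eqD[OF Lc Zc M]) (use e in \<open>simp add: L_def\<close>)
  then have e11: "cplx A1 * Z + cplx B1 = - (conj_mat Z * (cplx C1 * Z + (cplx A1)\<^sup>T))"
    unfolding LA LD cplx_transpose .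
  define w where "w = (- of_real a / 2) \<cdot>\<^sub>m (cplx b + Z * cplx al)"
  have wd [simp]: "dim_row w = q" "dim_col w = 1" unfolding w_def by auto
  have wc: "w \<in> carrier_mat q 1" by (rule carrier_matI) auto
  have r1c: "(cplx A1)\<^sup>T * cplx al + of_real a \<cdot>\<^sub>m cplx al = cplx C1 * cplx b"
    using arg_cong[OF r1, of cplx] by (simp add: cplx_mult cplx_add cplx_transpose cplx_smult)
  have r2c: "cplx A1 * cplx b = cplx B1 * cplx al + of_real a \<cdot>\<^sub>m cplx b"
    using arg_cong[OF r2, of cplx] by (simp add: cplx_mult cplx_add cplx_transpose cplx_smult)
  have C1sc: "(cplx C1)\<^sup>T = cplx C1" using C1s by (metis cplx_transpose)
  have f1: "cplx A1 * w + cplx b = - (conj_mat Z * (cplx C1 * w + cplx al) + of_real a \<cdot>\<^sub>m conj_mat w)"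
    by (rule fixed_point_blocks(1)[OF _ _ _ Zc _ _ _ _ _ _ C1sc Zs e11 r1c r2c aa w_def]) auto
  have "\<exists>r. \<forall>y. (cplx al)\<^sup>T * w + mat 1 1 (\<lambda>_. of_real a) * mat 1 1 (\<lambda>_. Complex r y) + mat 1 1 (\<lambda>_. of_real be)
       = - ((conj_mat w)\<^sup>T * (cplx C1 * w + cplx al) + conj_mat (mat 1 1 (\<lambda>_. Complex r y)) * mat 1 1 (\<lambda>_. of_real a))"
    by (rule fixed_point_blocks(2)[OF _ _ _ Zc _ _ _ _ _ _ C1sc Zs e11 r1c r2c aa w_def]) auto
  then obtain r where f2: "\<And>y. (cplx al)\<^sup>T * w + mat 1 1 (\<lambda>_. of_real a) * mat 1 1 (\<lambda>_. Complex r y) + mat 1 1 (\<lambda>_. of_real be)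
       = - ((conj_mat w)\<^sup>T * (cplx C1 * w + cplx al) + conj_mat (mat 1 1 (\<lambda>_. Complex r y)) * mat 1 1 (\<lambda>_. of_real a))"
    by blast
  have f3: "(cplx al)\<^sup>T * Z + of_real a \<cdot>\<^sub>m w\<^sup>T + (cplx b)\<^sup>T
      = - ((conj_mat w)\<^sup>T * (cplx C1 * Z + (cplx A1)\<^sup>T))"
  proof -
    have cm: "conj_mat (X * Y) = conj_mat X * conj_mat Y" if "dim_col X = dim_row Y" for X Y
      by (rule cnj_hom.mat_hom_mult[of _ "dim_row X" "dim_col X" _ "dim_col Y"]) (use that in auto)
    have cc: "conj_mat (conj_mat X) = X" for X by (intro eq_matI) auto
    have ca: "conj_mat (X + Y) = conj_mat X + conj_mat Y" if "dim_row X = dim_row Y" "dim_col X = dim_col Y" for X Y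
      using that by (intro eq_matI) auto
    have cu: "conj_mat (- X) = - conj_mat X" for X by (intro eq_matI) auto
    have cs: "conj_mat (of_real s \<cdot>\<^sub>m X) = of_real s \<cdot>\<^sub>m conj_mat X" for s X by (intro eq_matI) auto
    have ts: "(s \<cdot>\<^sub>m X)\<^sup>T = s \<cdot>\<^sub>m X\<^sup>T" for s :: complex and X by (intro eq_matI) auto
    have "conj_mat (cplx A1 * w + cplx b) = conj_mat (- (conj_mat Z * (cplx C1 * w + cplx al) + of_real a \<cdot>\<^sub>m conj_mat w))"
      using f1 by simp
    then have "cplx A1 * conj_mat w + cplx b = - (Z * (cplx C1 * conj_mat w) + Z * cplx al + of_real a \<cdot>\<^sub>m w)"
      by (simp add: cm cc ca cu cs mat_dim_simps)
    then have "(cplx A1 * conj_mat w + cplx b)\<^sup>T = (- (Z * (cplx C1 * conj_mat w) + Z * cplx al + of_real a \<cdot>\<^sub>m w))\<^sup>T"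
      by simp
    then have g: "(conj_mat w)\<^sup>T * (cplx A1)\<^sup>T + (cplx b)\<^sup>T =
        - ((conj_mat w)\<^sup>T * (cplx C1 * Z) + (cplx al)\<^sup>T * Z + of_real a \<cdot>\<^sub>m w\<^sup>T)"
      by (simp add: transpose_add_dim transpose_uminus ts mat_dim_simps C1sc Zs)
    show ?thesis
    proof (rule eq_matI)
      fix i j assume ij: "i < dim_row (- ((conj_mat w)\<^sup>T * (cplx C1 * Z + (cplx A1)\<^sup>T)))"
        "j < dim_col (- ((conj_mat w)\<^sup>T * (cplx C1 * Z + (cplx A1)\<^sup>T)))"
      have aux: "u + v + y = - (z + x)" if "x + y = - (z + u + v)" for x y z u v :: complex
      proof -
        have "u + v + y + (z + x) = (x + y) + (z + u + v)" by simp
        also have "\<dots> = 0" unfolding that by simp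
        finally show ?thesis by (simp only: eq_neg_iff_add_eq_0)
      qed
      have g': "((conj_mat w)\<^sup>T * (cplx A1)\<^sup>T) $$ (i,j) + (cplx b)\<^sup>T $$ (i,j) =
        - (((conj_mat w)\<^sup>T * (cplx C1 * Z)) $$ (i,j) + ((cplx al)\<^sup>T * Z) $$ (i,j) + (of_real a \<cdot>\<^sub>m w\<^sup>T) $$ (i,j))"
        using arg_cong[OF g, of "\<lambda>X. X $$ (i,j)"] ij by (simp del: index_mult_mat(1) minus_add_distrib)
      show "((cplx al)\<^sup>T * Z + of_real a \<cdot>\<^sub>m w\<^sup>T + (cplx b)\<^sup>T) $$ (i,j) = (- ((conj_mat w)\<^sup>T * (cplx C1 * Z + (cplx A1)\<^sup>T))) $$ (i,j)"
        using aux[OF g'] ij by (simp add: mat_dim_simps del: index_mult_mat(1) minus_add_distrib)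
    qed auto
  qed
  define y where "y = vec q (\<lambda>i. Im (w $$ (i, 0)))"
  \<comment> \<open>The height of \<open>W\<close> becomes \<open>\<bar>t\<bar> + 1\<close>, which
    exceeds both \<open>t\<close> and 0.\<close>
  define eta where "eta = \<bar>t\<bar> + 1 + y \<bullet> (minv (map_mat Im Z) *\<^sub>v y)"
  let ?om = "mat 1 1 (\<lambda>_. Complex r eta)"
  define W where "W = four_block_mat Z w (w\<^sup>T) ?om"
  note ext = siegel_extend[OF Z wc W_def y_def]
  have ht: "height n W > t" "height n W > 0" unfolding n ext(1) eta_def by auto
  have sW: "siegel n W" using ext(2) ht(2) unfolding n by simp
  have Wc: "W \<in> carrier_mat n n" using sW unfolding siegel_def by simp
  have WZ: "W $$ (i, j) = Z $$ (i, j)" if "i < q" "j < q" for i j using that unfolding W_def by simp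
  have cAb: "cplx A = four_block_mat (cplx A1) (0\<^sub>m q 1) ((cplx al)\<^sup>T) (mat 1 1 (\<lambda>_. of_real a))"
    unfolding Ab by (intro eq_matI) auto
  have cATb: "cplx (A\<^sup>T) = four_block_mat ((cplx A1)\<^sup>T) (cplx al) (0\<^sub>m 1 q) (mat 1 1 (\<lambda>_. of_real a))"
    unfolding ATb by (intro eq_matI) auto
  have cBb: "cplx B = four_block_mat (cplx B1) (cplx b) ((cplx b)\<^sup>T) (mat 1 1 (\<lambda>_. of_real be))"
    unfolding Bb by (intro eq_matI) auto
  have cCb: "cplx C = four_block_mat (cplx C1) (0\<^sub>m q 1) (0\<^sub>m 1 q) (0\<^sub>m 1 1)"
    unfolding Cb by (intro eq_matI) auto
  have cWb: "conj_mat W = four_block_mat (conj_mat Z) (conj_mat w) ((conj_mat w)\<^sup>T) (conj_mat ?om)"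
    unfolding W_def by (intro eq_matI) auto
  have "cplx C * W = four_block_mat (cplx C1 * Z + 0\<^sub>m q 1 * w\<^sup>T) (cplx C1 * w + 0\<^sub>m q 1 * ?om)
      (0\<^sub>m 1 q * Z + 0\<^sub>m 1 1 * w\<^sup>T) (0\<^sub>m 1 q * w + 0\<^sub>m 1 1 * ?om)"
    unfolding cCb W_def by (rule mfb) (use Zc wc in auto)
  also have "\<dots> = four_block_mat (cplx C1 * Z) (cplx C1 * w) (0\<^sub>m 1 q) (0\<^sub>m 1 1)"
    by (intro cong_four_block_mat) (simp_all add: mat_dim_simps)
  also have "\<dots> + cplx (A\<^sup>T) = four_block_mat (cplx C1 * Z + (cplx A1)\<^sup>T) (cplx C1 * w + cplx al)
     (0\<^sub>m 1 q + 0\<^sub>m 1 q) (0\<^sub>m 1 1 + mat 1 1 (\<lambda>_. of_real a))"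
    unfolding cATb by (rule add_four_block_mat) (auto intro!: carrier_matI)
  also have "\<dots> = four_block_mat (cplx C1 * Z + (cplx A1)\<^sup>T) (cplx C1 * w + cplx al) (0\<^sub>m 1 q) (mat 1 1 (\<lambda>_. of_real a))"
    by (intro cong_four_block_mat) (simp_all add: mat_dim_simps)
  finally have K: "cplx C * W + cplx (A\<^sup>T) = four_block_mat (cplx C1 * Z + (cplx A1)\<^sup>T) (cplx C1 * w + cplx al) (0\<^sub>m 1 q) (mat 1 1 (\<lambda>_. of_real a))" .
  have "conj_mat W * (cplx C * W + cplx (A\<^sup>T)) =
    four_block_mat (conj_mat Z * (cplx C1 * Z + (cplx A1)\<^sup>T) + conj_mat w * 0\<^sub>m 1 q)
      (conj_mat Z * (cplx C1 * w + cplx al) + conj_mat w * mat 1 1 (\<lambda>_. of_real a))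
      ((conj_mat w)\<^sup>T * (cplx C1 * Z + (cplx A1)\<^sup>T) + conj_mat ?om * 0\<^sub>m 1 q)
      ((conj_mat w)\<^sup>T * (cplx C1 * w + cplx al) + conj_mat ?om * mat 1 1 (\<lambda>_. of_real a))"
    unfolding K cWb by (rule mfb) (use Zc wc in \<open>auto intro!: carrier_matI\<close>)
  also have "\<dots> = four_block_mat (conj_mat Z * (cplx C1 * Z + (cplx A1)\<^sup>T))
      (conj_mat Z * (cplx C1 * w + cplx al) + of_real a \<cdot>\<^sub>m conj_mat w)
      ((conj_mat w)\<^sup>T * (cplx C1 * Z + (cplx A1)\<^sup>T))
      ((conj_mat w)\<^sup>T * (cplx C1 * w + cplx al) + conj_mat ?om * mat 1 1 (\<lambda>_. of_real a))" (is "_ = four_block_mat ?P ?Q ?R ?S")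
    by (intro cong_four_block_mat) (simp_all add: zero_mult_mat_dim zero_add_mat_dim mult_scalar_mat[unfolded One_nat_def])
  finally have rhs: "conj_mat W * (cplx C * W + cplx (A\<^sup>T)) = four_block_mat ?P ?Q ?R ?S" .
  have "cplx A * W = four_block_mat (cplx A1 * Z + 0\<^sub>m q 1 * w\<^sup>T) (cplx A1 * w + 0\<^sub>m q 1 * ?om)
      ((cplx al)\<^sup>T * Z + mat 1 1 (\<lambda>_. of_real a) * w\<^sup>T) ((cplx al)\<^sup>T * w + mat 1 1 (\<lambda>_. of_real a) * ?om)"
    unfolding cAb W_def by (rule mfb; intro carrier_matI; simp)
  also have "\<dots> = four_block_mat (cplx A1 * Z) (cplx A1 * w)
      ((cplx al)\<^sup>T * Z + of_real a \<cdot>\<^sub>m w\<^sup>T) ((cplx al)\<^sup>T * w + mat 1 1 (\<lambda>_. of_real a) * ?om)"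
    by (intro cong_four_block_mat) (simp_all add: zero_mult_mat_dim zero_add_mat_dim mult_scalar_mat[unfolded One_nat_def])
  also have "\<dots> + cplx B = four_block_mat (cplx A1 * Z + cplx B1) (cplx A1 * w + cplx b)
      ((cplx al)\<^sup>T * Z + of_real a \<cdot>\<^sub>m w\<^sup>T + (cplx b)\<^sup>T)
      ((cplx al)\<^sup>T * w + mat 1 1 (\<lambda>_. of_real a) * ?om + mat 1 1 (\<lambda>_. of_real be))"
    unfolding cBb by (rule add_four_block_mat) (auto intro!: carrier_matI)
  also have "\<dots> = four_block_mat (- ?P) (- ?Q) (- ?R) (- ?S)"
    unfolding f1 f2 f3 e11 ..
  also have "\<dots> = - four_block_mat ?P ?Q ?R ?S"
    by (intro eq_matI) (auto simp del: index_mult_mat(1))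
  finally have "cplx A * W + cplx B = - (conj_mat W * (cplx C * W + cplx (A\<^sup>T)))" unfolding rhs .
  then have "cplx h * (W @\<^sub>r 1\<^sub>m n) = (tau_pt W @\<^sub>r 1\<^sub>m n) * (cplx (blkC n h) * W + cplx (blkD n h))"
    unfolding ABC(1)[symmetric] ABC(3)[symmetric] D
    by (intro lagrangian_image_eqI[OF hc Wc, unfolded D ABC[symmetric]])
  moreover have "cplx (blkC n h) * W + cplx (blkD n h) \<in> carrier_mat n n" using Wc by (auto intro!: carrier_matI)
  ultimately show ?thesis using that[OF sW WZ ht(1)] by blast
qed

declare One_nat_def [simp del]

subsection \<open>The parabolic subgroup and its Levi projection\<close>

text \<open>The shift by one jumps over \<open>n - 1\<close>. The index \<open>2*n - 1\<close> is
  avoided because arguments stay below \<open>2*(n-1)\<close>, so values stay below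
  \<open>2*n - 1\<close>.\<close>

definition lidx :: "nat \<Rightarrow> nat \<Rightarrow> nat" where
  "lidx n i = (if i < n - 1 then i else i + 1)"

lemma levi_proj_eq: "levi_proj n h = mat (2*(n-1)) (2*(n-1)) (\<lambda>(i,j). h $$ (lidx n i, lidx n j))"
  unfolding levi_proj_def lidx_def Let_def ..

lemma levi_proj_dim [simp]: "dim_row (levi_proj n h) = 2*(n-1)" "dim_col (levi_proj n h) = 2*(n-1)"
  unfolding levi_proj_eq by auto

lemma levi_proj_carrier [simp]: "levi_proj n h \<in> carrier_mat (2*(n-1)) (2*(n-1))"
  unfolding levi_proj_eq by auto

lemma index_levi_proj [simp]:
  "i < 2*(n-1) \<Longrightarrow> j < 2*(n-1) \<Longrightarrow> levi_proj n h $$ (i, j) = h $$ (lidx n i, lidx n j)"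
  unfolding levi_proj_eq by auto

lemma lidx_less: "i < 2*(n-1) \<Longrightarrow> lidx n i < 2*n" "i < 2*(n-1) \<Longrightarrow> lidx n i \<noteq> n - 1" 
  "i < 2*(n-1) \<Longrightarrow> lidx n i \<noteq> 2*n - 1"
  unfolding lidx_def by auto

lemma lidx_eq_iff: "lidx n i = lidx n j \<longleftrightarrow> i = j"
  unfolding lidx_def by auto

text \<open>Deleting the conjugate pair \<open>n - 1\<close>, \<open>2*n - 1\<close> keeps all other
  conjugate pairs; hence \<open>J\<close> projects to the \<open>J\<close> of the smaller
  size.\<close>

lemma lidx_shift:
  assumes "i < 2*(n-1)" "j < 2*(n-1)"
  shows "lidx n j = lidx n i + n \<longleftrightarrow> j = i + (n-1)"
proof (cases "i < n - 1"; cases "j < n - 1")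
qed (use assms in \<open>simp_all add: lidx_def, arith+\<close>)

lemma lidx_surj: 
  assumes "k < 2*n" "k \<noteq> n - 1" "k \<noteq> 2*n - 1" obtains i where "i < 2*(n-1)" "k = lidx n i"
proof (cases "k < n - 1")
  case True
  then show ?thesis using that[of k] by (simp add: lidx_def)
next
  case False
  then show ?thesis using that[of "k - 1"] assms by (simp add: lidx_def)
qed

lemma sum_lidx:
  fixes f :: "nat \<Rightarrow> 'a::comm_monoid_add"
  assumes "n \<ge> 1"
  shows "(\<Sum>k<2*n. f k) = (\<Sum>k<2*(n-1). f (lidx n k)) + (f (n-1) + f (2*n-1))"
proof -
  have s: "{..<2*n} = lidx n ` {..<2*(n-1)} \<union> {n-1, 2*n-1}"
    using assms lidx_less by (auto elim: lidx_surj)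
  have "(\<Sum>k<2*n. f k) = sum f (lidx n ` {..<2*(n-1)}) + sum f {n-1, 2*n-1}"
    unfolding s by (rule sum.union_disjoint) (use lidx_less(2,3)[of _ n] in \<open>force+\<close>)
  also have "sum f (lidx n ` {..<2*(n-1)}) = (\<Sum>k<2*(n-1). f (lidx n k))"
    by (subst sum.reindex) (auto simp: inj_on_def lidx_eq_iff)
  finally show ?thesis using assms by simp
qed

lemma index_mult_lidx:
  fixes X :: "'a::semiring_0 mat"
  assumes "n \<ge> 1" "X \<in> carrier_mat (2*n) (2*n)" "Y \<in> carrier_mat (2*n) (2*n)" "i < 2*n" "j < 2*n"
  shows "(X * Y) $$ (i, j) = (\<Sum>k<2*(n-1). X $$ (i, lidx n k) * Y $$ (lidx n k, j))
    + (X $$ (i, n-1) * Y $$ (n-1, j) + X $$ (i, 2*n-1) * Y $$ (2*n-1, j))"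
  using assms sum_lidx[OF assms(1), of "\<lambda>k. X $$ (i, k) * Y $$ (k, j)"]
  by (simp add: scalar_prod_def atLeast0LessThan)

text \<open>Deletion of indices is multiplicative as soon as the deleted indices contribute nothing
  to the sums. The conditions are on products because in some applications the left factor vanishes
  and in others the right one.\<close>

lemma levi_proj_mult:
  assumes n: "n \<ge> 1" and c: "X \<in> carrier_mat (2*n) (2*n)" "Y \<in> carrier_mat (2*n) (2*n)"
    and z: "\<And>i j. i < 2*(n-1) \<Longrightarrow> j < 2*(n-1) \<Longrightarrow> X $$ (lidx n i, n-1) * Y $$ (n-1, lidx n j) = 0"
      "\<And>i j. i < 2*(n-1) \<Longrightarrow> j < 2*(n-1) \<Longrightarrow> X $$ (lidx n i, 2*n-1) * Y $$ (2*n-1, lidx n j) = 0"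
  shows "levi_proj n (X * Y) = levi_proj n X * levi_proj n Y"
proof (rule eq_matI)
  fix i j assume "i < dim_row (levi_proj n X * levi_proj n Y)" "j < dim_col (levi_proj n X * levi_proj n Y)"
  then have ij: "i < 2*(n-1)" "j < 2*(n-1)" by auto
  have "levi_proj n (X * Y) $$ (i, j) = (X * Y) $$ (lidx n i, lidx n j)" using ij by simp
  also have "\<dots> = (\<Sum>k<2*(n-1). X $$ (lidx n i, lidx n k) * Y $$ (lidx n k, lidx n j))"
    unfolding index_mult_lidx[OF n c lidx_less(1)[OF ij(1)] lidx_less(1)[OF ij(2)]] z[OF ij] by simp
  also have "\<dots> = (levi_proj n X * levi_proj n Y) $$ (i, j)"
    using ij by (simp add: scalar_prod_def atLeast0LessThan)
  finally show "levi_proj n (X * Y) $$ (i, j) = (levi_proj n X * levi_proj n Y) $$ (i, j)" .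
qed auto

text \<open>The algebra spanned by the stabiliser of the boundary component: for symplectic matrices the
  condition on the last row follows from the one on column \<open>n - 1\<close>.\<close>

definition parabolic :: "nat \<Rightarrow> real mat \<Rightarrow> bool" where
  "parabolic n X \<longleftrightarrow> X \<in> carrier_mat (2*n) (2*n) \<and> (\<forall>i<2*n. i \<noteq> n - 1 \<longrightarrow> X $$ (i, n-1) = 0)
     \<and> (\<forall>j<2*n. j \<noteq> 2*n - 1 \<longrightarrow> X $$ (2*n-1, j) = 0)"

lemma parabolicD:
  assumes "parabolic n X"
  shows "X \<in> carrier_mat (2*n) (2*n)" "dim_row X = 2*n" "dim_col X = 2*n"
    "i < 2*n \<Longrightarrow> i \<noteq> n - 1 \<Longrightarrow> X $$ (i, n-1) = 0" "j < 2*n \<Longrightarrow> j \<noteq> 2*n - 1 \<Longrightarrow> X $$ (2*n-1, j) = 0"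
  using assms unfolding parabolic_def by auto

text \<open>With index \<open>n - 1\<close> put first and \<open>2*n - 1\<close> put last, a
  \<open>parabolic\<close> matrix is block upper triangular with diagonal blocks of sizes 1,
  \<open>2*(n-1)\<close>, 1. The three diagonal blocks multiply separately.\<close>

lemma parabolic_mult:
  assumes n: "n \<ge> 1" and p: "parabolic n X" "parabolic n Y"
  shows "parabolic n (X * Y)" "levi_proj n (X * Y) = levi_proj n X * levi_proj n Y"
    "(X * Y) $$ (n-1, n-1) = X $$ (n-1, n-1) * Y $$ (n-1, n-1)"
    "(X * Y) $$ (2*n-1, 2*n-1) = X $$ (2*n-1, 2*n-1) * Y $$ (2*n-1, 2*n-1)"
proof -
  note X = parabolicD[OF p(1)] and Y = parabolicD[OF p(2)]
  note ix = index_mult_lidx[OF n X(1) Y(1)]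
  have ne: "n - 1 < 2*n" "2*n - 1 < 2*n" "n - 1 \<noteq> 2*n - 1" "2*n - 1 \<noteq> n - 1" using n by auto
  have Y0: "Y $$ (lidx n k, n - 1) = 0" if "k < 2*(n-1)" for k using Y(4) lidx_less[OF that] by blast
  have X0: "X $$ (2*n-1, lidx n k) = 0" if "k < 2*(n-1)" for k using X(5) lidx_less[OF that] by blast
  have Y1: "Y $$ (2*n-1, n-1) = 0" using Y(4) ne by blast
  have X1: "X $$ (2*n-1, n-1) = 0" using X(4) ne by blast
  show "(X * Y) $$ (n-1, n-1) = X $$ (n-1, n-1) * Y $$ (n-1, n-1)"
    unfolding ix[OF ne(1) ne(1)] by (simp add: Y0 Y1)
  show "(X * Y) $$ (2*n-1, 2*n-1) = X $$ (2*n-1, 2*n-1) * Y $$ (2*n-1, 2*n-1)"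
    unfolding ix[OF ne(2) ne(2)] by (simp add: X0 X1)
  show "levi_proj n (X * Y) = levi_proj n X * levi_proj n Y"
    by (rule levi_proj_mult[OF n X(1) Y(1)]) (use X Y lidx_less in auto)
  show "parabolic n (X * Y)" unfolding parabolic_def
  proof (intro conjI allI impI)
    show "X * Y \<in> carrier_mat (2*n) (2*n)" using X(1) Y(1) by simp
    fix i assume i: "i < 2*n" 
    show "(X * Y) $$ (i, n - 1) = 0" if "i \<noteq> n - 1"
      unfolding ix[OF i ne(1)] using X(4)[OF i that] by (simp add: Y0 Y1)
    show "(X * Y) $$ (2*n-1, i) = 0" if "i \<noteq> 2*n - 1"
      unfolding ix[OF ne(2) i] using Y(5)[OF i that] by (simp add: X0 X1)
  qed
qed

lemma parabolic_one: "n \<ge> 1 \<Longrightarrow> parabolic n (1\<^sub>m (2*n))"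
  unfolding parabolic_def by auto

lemma levi_proj_one: "n \<ge> 1 \<Longrightarrow> levi_proj n (1\<^sub>m (2*n)) = 1\<^sub>m (2*(n-1))"
  by (intro eq_matI) (auto simp: lidx_less lidx_eq_iff)

lemma parabolic_Tmat: "n \<ge> 1 \<Longrightarrow> parabolic n (Tmat n)"
  unfolding parabolic_def by (auto simp: index_Tmat)

lemma levi_proj_Tmat: "n \<ge> 1 \<Longrightarrow> levi_proj n (Tmat n) = Tmat (n-1)"
  by (intro eq_matI) (auto simp: index_Tmat lidx_less lidx_eq_iff, auto simp: lidx_def)

lemma levi_proj_Jmat: "n \<ge> 1 \<Longrightarrow> levi_proj n (Jmat n) = Jmat (n-1)"
  by (intro eq_matI) (simp_all add: index_Jmat lidx_less lidx_shift)

lemma parabolic_add: "parabolic n X \<Longrightarrow> parabolic n Y \<Longrightarrow> parabolic n (X + Y)"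
  unfolding parabolic_def by auto

lemma parabolic_smult: "parabolic n X \<Longrightarrow> parabolic n (c \<cdot>\<^sub>m X)"
  unfolding parabolic_def by auto

lemma levi_proj_add:
  "X \<in> carrier_mat (2*n) (2*n) \<Longrightarrow> Y \<in> carrier_mat (2*n) (2*n) \<Longrightarrow> levi_proj n (X + Y) = levi_proj n X + levi_proj n Y"
  by (intro eq_matI) (auto simp: lidx_less)

lemma levi_proj_smult:
  "X \<in> carrier_mat (2*n) (2*n) \<Longrightarrow> levi_proj n (c \<cdot>\<^sub>m X) = c \<cdot>\<^sub>m levi_proj n X"
  by (intro eq_matI) (auto simp: lidx_less)

lemma parabolic_pow:
  assumes n: "n \<ge> 1" and p: "parabolic n X"
  shows "parabolic n (X ^\<^sub>m j)" "levi_proj n (X ^\<^sub>m j) = levi_proj n X ^\<^sub>m j"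
proof (induction j)
  case 0
  { case 1 then show ?case using parabolic_one[OF n] parabolicD[OF p] by simp }
  { case 2 then show ?case using levi_proj_one[OF n] parabolicD[OF p] by simp }
next
  case (Suc j)
  { case 1 then show ?case using parabolic_mult(1)[OF n Suc(1) p] by simp }
  { case 2 then show ?case using parabolic_mult(2)[OF n Suc(1) p] Suc(2) by simp }
qed

text \<open>Row \<open>n - 1\<close> of \<open>h^T J h = J\<close> says that
  \<open>h $$ (n-1, n-1)\<close> times the last row of \<open>h\<close> is the last unit row.
  Geometrically, \<open>h\<close> preserves the symplectic complement of the line it stabilises and
  acts on the quotient by the inverse scalar.\<close>

lemma Sp_stab_parabolic:
  assumes n: "n \<ge> 1" and h: "is_Sp n h" and stab: "stab_bc n h"
  shows "parabolic n h" "h $$ (n-1, n-1) * h $$ (2*n-1, 2*n-1) = 1"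
proof -
  note hc = is_Sp_carrier[OF h] 
  note [simp] = is_Sp_dim[OF h]
  have col: "h $$ (i, n-1) = 0" if "i < 2*n" "i \<noteq> n - 1" for i
    using stab that unfolding stab_bc_def by auto
  have ne: "n - 1 < 2*n" "2*n - 1 < 2*n" "n - 1 \<noteq> 2*n - 1" using n by auto
  have eq: "h $$ (n-1, n-1) * h $$ (2*n-1, j) = (if j = 2*n-1 then 1 else 0)" if j: "j < 2*n" for j
  proof -
    have "(h\<^sup>T * (Jmat n * h)) $$ (n-1, j) = Jmat n $$ (n-1, j)"
      using h unfolding is_Sp_def by (simp add: mat_dim_simps)
    also have "(h\<^sup>T * (Jmat n * h)) $$ (n-1, j) = (\<Sum>k<2*n. h $$ (k, n-1) * (Jmat n * h) $$ (k, j))"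
      using ne j by (subst index_mult_mat(1)) (auto simp: scalar_prod_def atLeast0LessThan simp del: index_mult_mat(1))
    also have "\<dots> = h $$ (n-1, n-1) * (Jmat n * h) $$ (n-1, j)"
      using ne col by (subst sum.remove[of _ "n-1"]) (auto simp del: index_mult_mat(1))
    also have "(Jmat n * h) $$ (n-1, j) = (\<Sum>k<2*n. Jmat n $$ (n-1, k) * h $$ (k, j))"
      using ne j by (simp add: scalar_prod_def atLeast0LessThan)
    also have "\<dots> = h $$ (2*n-1, j)"
      using ne by (subst sum.remove[of _ "2*n-1"]) (auto simp: index_Jmat)
    also have "Jmat n $$ (n-1, j) = (if j = 2*n-1 then 1 else 0)"
      using ne j by (auto simp: index_Jmat)
    finally show ?thesis .
  qed
  show a: "h $$ (n-1, n-1) * h $$ (2*n-1, 2*n-1) = 1" using eq[of "2*n-1"] ne by simp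
  then have "h $$ (n-1, n-1) \<noteq> 0" by auto
  then have "h $$ (2*n-1, j) = 0" if "j < 2*n" "j \<noteq> 2*n - 1" for j using eq[of j] that by simp
  then show "parabolic n h" unfolding parabolic_def using col hc by auto
qed

text \<open>\<open>J\<close> is not \<open>parabolic\<close>, and neither is \<open>h^T\<close> in
  general, so the entries that must vanish for multiplicativity are checked one by one.\<close>

lemma levi_proj_Sp:
  assumes n: "n \<ge> 1" and h: "is_Sp n h" and p: "parabolic n h"
  shows "is_Sp (n-1) (levi_proj n h)"
proof -
  note hc = is_Sp_carrier[OF h] 
  note [simp] = is_Sp_dim[OF h]
  have ne: "n - 1 < 2*n" "2*n - 1 < 2*n" "n - 1 \<noteq> 2*n - 1" using n by auto
  have J: "levi_proj n (Jmat n * h) = levi_proj n (Jmat n) * levi_proj n h"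
    by (rule levi_proj_mult[OF n _ hc]) (use n lidx_less in \<open>auto simp: index_Jmat lidx_def\<close>)
  have h0: "h $$ (2*n-1, lidx n k) = 0" if "k < 2*(n-1)" for k
    using parabolicD(5)[OF p] lidx_less[OF that] by blast
  have Jh: "(Jmat n * h) $$ (n-1, lidx n j) = 0" if "j < 2*(n-1)" for j
  proof -
    have "(Jmat n * h) $$ (n-1, lidx n j) = (\<Sum>k<2*n. Jmat n $$ (n-1, k) * h $$ (k, lidx n j))"
      using ne that lidx_less by (simp add: scalar_prod_def atLeast0LessThan)
    also have "\<dots> = h $$ (2*n-1, lidx n j)"
      using ne by (subst sum.remove[of _ "2*n-1"]) (auto simp: index_Jmat)
    finally show ?thesis using h0 that by simp
  qed
  have "levi_proj n (h\<^sup>T * (Jmat n * h)) = levi_proj n (h\<^sup>T) * levi_proj n (Jmat n * h)"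
    by (rule levi_proj_mult[OF n]) (use n lidx_less hc ne Jh h0 in \<open>auto simp del: index_mult_mat(1)\<close>)
  also have "levi_proj n (h\<^sup>T) = (levi_proj n h)\<^sup>T" by (intro eq_matI) (auto simp: lidx_less)
  also have "h\<^sup>T * (Jmat n * h) = Jmat n" using h unfolding is_Sp_def by (simp add: mat_dim_simps)
  finally show ?thesis unfolding is_Sp_def J levi_proj_Jmat[OF n] by (simp add: mat_dim_simps)
qed

subsection \<open>Integral matrices\<close>

definition integral_mat :: "real mat \<Rightarrow> bool" where
  "integral_mat X \<longleftrightarrow> (\<forall>i<dim_row X. \<forall>j<dim_col X. X $$ (i, j) \<in> \<int>)"

lemma integral_mat_mult: 
  "integral_mat X \<Longrightarrow> integral_mat Y \<Longrightarrow> dim_col X = dim_row Y \<Longrightarrow> integral_mat (X * Y)"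
  unfolding integral_mat_def by (auto simp: scalar_prod_def intro!: Ints_sum Ints_mult)

lemma integral_mat_one: "integral_mat (1\<^sub>m n)"
  unfolding integral_mat_def by auto

lemma integral_mat_pow: 
  assumes "integral_mat X" "X \<in> carrier_mat n n" shows "integral_mat (X ^\<^sub>m j)"
proof (induction j)
  case (Suc j)
  have "X ^\<^sub>m j \<in> carrier_mat n n" using assms(2) by (rule pow_carrier_mat)
  then show ?case using integral_mat_mult[OF Suc assms(1)] assms(2) by auto
qed (use assms integral_mat_one in auto)

lemma common_denominator:
  fixes f :: "nat \<Rightarrow> real"
  assumes "\<And>i. i < n \<Longrightarrow> f i \<in> \<rat>"
  shows "\<exists>d::nat. d > 0 \<and> (\<forall>i<n. of_nat d * f i \<in> \<int>)"
  using assms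
proof (induction n)
  case 0
  then show ?case by auto
next
  case (Suc n)
  then obtain d :: nat where d: "d > 0" "\<And>i. i < n \<Longrightarrow> of_nat d * f i \<in> \<int>" by force
  have "f n \<in> \<rat>" using Suc by simp
  then obtain p e :: int where pe: "e > 0" "f n = of_int p / of_int e" by (auto elim: Rats_cases')
  have 1: "of_nat (d * nat e) * f i \<in> \<int>" if "i < Suc n" for i
  proof (cases "i = n")
    case True
    have "of_nat (d * nat e) * f i = of_int (int d * p)" using pe True by simp
    then show ?thesis by (metis Ints_of_int)
  next
    case False
    have "of_nat (d * nat e) * f i = of_nat (nat e) * (of_nat d * f i)" by simp
    also have "\<dots> \<in> \<int>" by (rule Ints_mult[OF Ints_of_nat]) (use d(2)[of i] that False in auto)
    finally show ?thesis .
  qed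
  show ?case by (rule exI[of _ "d * nat e"]) (use 1 d pe in auto)
qed

lemma integral_small_zero: "x \<in> \<int> \<Longrightarrow> \<bar>x\<bar> < 1 \<Longrightarrow> x = (0::real)"
  by (elim Ints_cases) simp

text \<open>After clearing denominators in \<open>v\<close>, the vectors
  \<open>V^m v = a^m v\<close> are integral for all \<open>m\<close>. If
  \<open>\<bar>a\<bar> < 1\<close> they tend to 0, so some \<open>a^m v\<close> is 0.\<close>

lemma integral_eigenvalue_ge_1:
  assumes V: "V \<in> carrier_mat n n" "integral_mat V"
    and v: "v \<in> carrier_vec n" "\<And>i. i < n \<Longrightarrow> v $ i \<in> \<rat>" "v \<noteq> 0\<^sub>v n"
    and e: "V *\<^sub>v v = a \<cdot>\<^sub>v v" and a: "a \<noteq> 0"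
  shows "\<bar>a\<bar> \<ge> 1"
proof (rule ccontr)
  assume "\<not> ?thesis"
  then have a1: "\<bar>a\<bar> < 1" by simp
  obtain d :: nat where d: "d > 0" "\<And>i. i < n \<Longrightarrow> of_nat d * v $ i \<in> \<int>"
    using common_denominator[of n "\<lambda>i. v $ i"] v(2) by blast
  have int: "a ^ m * (of_nat d * v $ i) \<in> \<int>" if "i < n" for i m
    using that
  proof (induction m arbitrary: i)
    case (Suc m)
    have "a * v $ i = (V *\<^sub>v v) $ i" unfolding e using Suc v(1) by simp
    also have "\<dots> = (\<Sum>j<n. V $$ (i, j) * v $ j)" using Suc v(1) V(1) by (simp add: scalar_prod_def atLeast0LessThan)
    finally have "a ^ Suc m * (of_nat d * v $ i) = a ^ m * of_nat d * (\<Sum>j<n. V $$ (i, j) * v $ j)" by simp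
    also have "\<dots> = (\<Sum>j<n. V $$ (i, j) * (a ^ m * (of_nat d * v $ j)))"
      by (simp add: sum_distrib_left ac_simps)
    also have "\<dots> \<in> \<int>" 
    proof (rule Ints_sum)
      fix j assume "j \<in> {..<n}"
      then show "V $$ (i, j) * (a ^ m * (of_nat d * v $ j)) \<in> \<int>"
        using Suc V unfolding integral_mat_def by (intro Ints_mult[of "V $$ (i, j)"]) auto
    qed
    finally show ?case .
  qed (use d in auto)
  obtain i where i: "i < n" "v $ i \<noteq> 0" using v(1,3) by (metis carrier_vecD eq_vecI index_zero_vec)
  have "(\<lambda>m. a ^ m * (of_nat d * v $ i)) \<longlonglongrightarrow> 0 * (of_nat d * v $ i)"
    using a1 by (intro tendsto_intros LIMSEQ_power_zero) simp
  then have "(\<lambda>m. a ^ m * (of_nat d * v $ i)) \<longlonglongrightarrow> 0" by simp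
  from LIMSEQ_D[OF this, of 1] obtain m where m: "\<bar>a ^ m * (of_nat d * v $ i)\<bar> < 1" by auto
  from integral_small_zero[OF int[OF i(1)] m] show False using a d i by simp
qed

text \<open>The integral inverse has eigenvalue \<open>1 / a\<close> on the same vector, so the
  lower bound applies to \<open>a\<close> and to \<open>1 / a\<close>.\<close>

lemma integral_eigenvalue_unit:
  assumes V: "V \<in> carrier_mat n n" "integral_mat V"
    and V': "V' \<in> carrier_mat n n" "integral_mat V'" "V' * V = 1\<^sub>m n"
    and v: "v \<in> carrier_vec n" "\<And>i. i < n \<Longrightarrow> v $ i \<in> \<rat>" "v \<noteq> 0\<^sub>v n"
    and e: "V *\<^sub>v v = a \<cdot>\<^sub>v v"
  shows "\<bar>a\<bar> = 1"
proof -
  have v': "v = a \<cdot>\<^sub>v (V' *\<^sub>v v)"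
  proof -
    have "v = (V' * V) *\<^sub>v v" using V' v by simp
    also have "\<dots> = V' *\<^sub>v (a \<cdot>\<^sub>v v)" using assoc_mult_mat_vec[OF V'(1) V(1) v(1)] e by simp
    also have "\<dots> = a \<cdot>\<^sub>v (V' *\<^sub>v v)" using mult_mat_vec[OF V'(1) v(1)] .
    finally show ?thesis .
  qed
  have a: "a \<noteq> 0"
  proof
    assume "a = 0"
    then have "v = 0 \<cdot>\<^sub>v (V' *\<^sub>v v)" using v' by simp
    also have "\<dots> = 0\<^sub>v n" using V'(1) by (intro eq_vecI) auto
    finally have "v = 0\<^sub>v n" .
    with v(3) show False ..
  qed
  have "V' *\<^sub>v v = (1 / a) \<cdot>\<^sub>v v"
  proof -
    have "(1 / a) \<cdot>\<^sub>v v = (1 / a) \<cdot>\<^sub>v (a \<cdot>\<^sub>v (V' *\<^sub>v v))" using v' by simp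
    then show ?thesis using a by (simp add: smult_smult_assoc)
  qed
  from integral_eigenvalue_ge_1[OF V'(1,2) v this] a have "\<bar>1 / a\<bar> \<ge> 1" by simp
  moreover have "\<bar>a\<bar> \<ge> 1" by (rule integral_eigenvalue_ge_1[OF V v e a])
  ultimately show ?thesis using a by (auto simp: field_simps abs_if split: if_splits)
qed

lemma smult_pow_mat:
  fixes X :: "'a::comm_ring_1 mat"
  assumes "X \<in> carrier_mat n n"
  shows "(c \<cdot>\<^sub>m X) ^\<^sub>m j = c ^ j \<cdot>\<^sub>m X ^\<^sub>m j"
proof (induction j)
  case 0
  then show ?case using assms by (intro eq_matI) auto
next
  case (Suc j)
  have d: "dim_row (X ^\<^sub>m j) = n" "dim_col (X ^\<^sub>m j) = n" using pow_carrier_mat[OF assms, of j] by auto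
  have "(c \<cdot>\<^sub>m X) ^\<^sub>m Suc j = c \<cdot>\<^sub>m (c ^ j \<cdot>\<^sub>m (X ^\<^sub>m j * X))"
    using Suc d assms by (simp add: smult_mult_mat_dim mult_smult_mat_dim)
  also have "\<dots> = c ^ Suc j \<cdot>\<^sub>m X ^\<^sub>m Suc j"
    using d assms by (intro eq_matI) (auto simp: ac_simps simp del: index_mult_mat(1))
  finally show ?case .
qed

lemma integral_nilpotent:
  assumes X: "X \<in> carrier_mat n n" "integral_mat X"
    and ev: "\<And>x. eigenvalue (cplx X) x \<Longrightarrow> cmod x \<le> 1/4"
  shows "\<exists>j. X ^\<^sub>m j = 0\<^sub>m n n"
proof (cases "n = 0")
  case True
  then show ?thesis using X by (intro exI[of _ 0] eq_matI) auto
next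
  case False
  \<comment> \<open>Doubling uses the slack in the bound 1/4: the spectral radius of
    \<open>2 X\<close> is at most 1/2, so its powers are bounded by some \<open>c\<close>. The
    entries of \<open>X^k\<close> are then at most \<open>c / 2^k\<close>, and integral.\<close>
  let ?A = "2 \<cdot>\<^sub>m cplx X"
  have A: "?A \<in> carrier_mat n n" using X by simp
  from spectral_radius_mem_max(1)[OF A] False obtain m where m: "eigenvalue ?A m" "spectral_radius ?A = cmod m"
    unfolding spectrum_def by auto
  from m(1) obtain v where v: "v \<in> carrier_vec n" "v \<noteq> 0\<^sub>v n" "?A *\<^sub>v v = m \<cdot>\<^sub>v v"
    unfolding eigenvalue_def eigenvector_def using A by auto
  have "cplx X *\<^sub>v v = (m / 2) \<cdot>\<^sub>v v"
  proof -
    have "cplx X *\<^sub>v v = (1 / 2) \<cdot>\<^sub>v (?A *\<^sub>v v)" using X v(1) by (intro eq_vecI) auto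
    then show ?thesis unfolding v(3) by (simp add: smult_smult_assoc)
  qed
  then have "eigenvalue (cplx X) (m / 2)"
    unfolding eigenvalue_def eigenvector_def using v X by auto
  from ev[OF this] m(2) have "spectral_radius ?A < 1" by (simp add: norm_divide)
  from spectral_radius_jnf_norm_bound_less_1_upper_triangular[OF A this]
  obtain c where c: "\<And>k. norm_bound (?A ^\<^sub>m k) c" by auto
  have pw: "?A ^\<^sub>m k = 2 ^ k \<cdot>\<^sub>m cplx (X ^\<^sub>m k)" for k
    unfolding of_real_hom.mat_hom_pow[OF X(1)] by (rule smult_pow_mat[of _ n]) (use X in auto)
  obtain k where k: "c < 2 ^ k" using real_arch_pow[of 2 c] by auto
  have Xk: "dim_row (X ^\<^sub>m k) = n" "dim_col (X ^\<^sub>m k) = n" using pow_carrier_mat[OF X(1), of k] by auto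
  have "(X ^\<^sub>m k) $$ (i, j) = 0" if ij: "i < n" "j < n" for i j
  proof (rule integral_small_zero)
    show "(X ^\<^sub>m k) $$ (i, j) \<in> \<int>" using integral_mat_pow[OF X(2,1), of k] ij Xk unfolding integral_mat_def by auto
    have "norm ((?A ^\<^sub>m k) $$ (i, j)) \<le> c" using c[of k] ij Xk unfolding norm_bound_def pw by auto
    then have "2 ^ k * \<bar>(X ^\<^sub>m k) $$ (i, j)\<bar> \<le> c" unfolding pw using ij Xk by (simp add: norm_mult norm_power)
    then have "2 ^ k * \<bar>(X ^\<^sub>m k) $$ (i, j)\<bar> < 2 ^ k * 1" using k by linarith
    then show "\<bar>(X ^\<^sub>m k) $$ (i, j)\<bar> < 1" by (subst (asm) mult_less_cancel_left_pos) auto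
  qed
  then show ?thesis using Xk by (intro exI[of _ k] eq_matI) auto
qed

subsection \<open>Isotropy of a point of the Siegel space\<close>

lemma unitary_eigenvalue:
  assumes K: "K \<in> carrier_mat q q" and Y: "pos_def q Y"
    and u: "(conj_mat K)\<^sup>T * cplx Y * K = cplx Y" and ev: "eigenvalue K x"
  shows "cmod x = 1"
proof -
  have Yc: "Y \<in> carrier_mat q q" using Y unfolding pos_def_def by auto
  from ev obtain c where c: "c \<in> carrier_vec q" "c \<noteq> 0\<^sub>v q" "K *\<^sub>v c = x \<cdot>\<^sub>v c"
    unfolding eigenvalue_def eigenvector_def using K by auto
  have "sesq Y c c = sesq Y (x \<cdot>\<^sub>v c) (x \<cdot>\<^sub>v c)"
    using sesq_congruence[OF K Yc Yc c(1) c(1) u] unfolding c(3) by simp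
  also have "\<dots> = (cnj x * x) * sesq Y c c"
  proof -
    have "map_vec cnj (x \<cdot>\<^sub>v c) = cnj x \<cdot>\<^sub>v map_vec cnj c" by (intro eq_vecI) auto
    moreover have "cplx Y *\<^sub>v (x \<cdot>\<^sub>v c) = x \<cdot>\<^sub>v (cplx Y *\<^sub>v c)"
      using mult_mat_vec[of "cplx Y" q q c x] Yc c by simp
    ultimately show ?thesis unfolding sesq_def using Yc c(1) by simp
  qed
  also have "cnj x * x = of_real ((cmod x)\<^sup>2)" by (metis complex_norm_square mult.commute of_real_power)
  finally have "sesq Y c c = of_real ((cmod x)\<^sup>2) * sesq Y c c" .
  from arg_cong[OF this, of Re] have "Re (sesq Y c c) = (cmod x)\<^sup>2 * Re (sesq Y c c)"
    by (simp only: Re_complex_of_real Im_complex_of_real times_complex.sel mult_zero_left diff_zero)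
  then have "(cmod x)\<^sup>2 = 1" using sesq_pos[OF Y c(1,2)] by simp
  then show ?thesis using norm_ge_zero[of x] by (simp add: power2_eq_1_iff)
qed

lemma sesq_minus_left:
  assumes "Y \<in> carrier_mat q q" "c \<in> carrier_vec q" "d \<in> carrier_vec q" "z \<in> carrier_vec q"
  shows "sesq Y (c - d) z = sesq Y c z - sesq Y d z"
proof -
  have "map_vec cnj (c - d) = map_vec cnj c - map_vec cnj d" using assms by (intro eq_vecI) auto
  then show ?thesis unfolding sesq_def using assms
    by (simp add: minus_scalar_prod_distrib[of _ q] mult_mat_vec_carrier[of _ q q])
qed

text \<open>If \<open>N = K - 1\<close> kills \<open>z = N c\<close>, then \<open>K z = z\<close>,
  and invariance of the form gives \<open><z, z> = <K c, K z> - <c, z> = 0\<close>. So the kernels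
  of \<open>N^2\<close> and \<open>N\<close> agree, and a nilpotent \<open>N\<close> is 0.\<close>

lemma unitary_unipotent:
  assumes K: "K \<in> carrier_mat q q" and Y: "pos_def q Y"
    and u: "(conj_mat K)\<^sup>T * cplx Y * K = cplx Y" and nil: "(K - 1\<^sub>m q) ^\<^sub>m j = 0\<^sub>m q q"
  shows "K = 1\<^sub>m q"
proof -
  let ?N = "K - 1\<^sub>m q"
  have N: "?N \<in> carrier_mat q q" using K by (auto intro: minus_carrier_mat)
  have Yc: "Y \<in> carrier_mat q q" using Y unfolding pos_def_def by auto
  have Nv: "?N *\<^sub>v c = K *\<^sub>v c - c" if "c \<in> carrier_vec q" for c
    using minus_mult_distrib_mat_vec[OF K one_carrier_mat that] that by simp
  have step: "?N *\<^sub>v c = 0\<^sub>v q" if c: "c \<in> carrier_vec q" and NN: "?N *\<^sub>v (?N *\<^sub>v c) = 0\<^sub>v q" for c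
  proof (rule ccontr)
    assume nz: "?N *\<^sub>v c \<noteq> 0\<^sub>v q"
    define z where "z = ?N *\<^sub>v c"
    have z: "z \<in> carrier_vec q" unfolding z_def using N c by simp
    have Kz: "K *\<^sub>v z = z"
    proof (rule eq_vecI)
      fix i assume i: "i < dim_vec z"
      have "(K *\<^sub>v z - z) $ i = 0" using NN Nv[OF z] i z unfolding z_def[symmetric] by simp
      then show "(K *\<^sub>v z) $ i = z $ i" using i z K by simp
    qed (use z K in auto)
    have Kc: "K *\<^sub>v c \<in> carrier_vec q" using K c by simp
    have "sesq Y z z = sesq Y (K *\<^sub>v c - c) z" using Nv[OF c] unfolding z_def by simp
    also have "\<dots> = sesq Y (K *\<^sub>v c) (K *\<^sub>v z) - sesq Y c z"
      using sesq_minus_left[OF Yc Kc c z] Kz by simp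
    also have "\<dots> = 0" using sesq_congruence[OF K Yc Yc c z u] by simp
    finally show False using sesq_pos[OF Y z] nz unfolding z_def by simp
  qed
  have "?N *\<^sub>v c = 0\<^sub>v q" if "c \<in> carrier_vec q" "(?N ^\<^sub>m Suc k) *\<^sub>v c = 0\<^sub>v q" for c k
    using that
  proof (induction k arbitrary: c)
    case 0
    then show ?case using N by simp
  next
    case (Suc k)
    have Nc: "?N *\<^sub>v c \<in> carrier_vec q" using N Suc by simp
    have "(?N ^\<^sub>m Suc k) *\<^sub>v (?N *\<^sub>v c) = 0\<^sub>v q"
      using Suc(3) assoc_mult_mat_vec[OF pow_carrier_mat[OF N, of "Suc k"] N Suc(2)] by simp
    from Suc.IH[OF Nc this] show ?case using step Suc(2) by blast
  qed
  moreover have "(?N ^\<^sub>m Suc j) *\<^sub>v c = 0\<^sub>v q" if "c \<in> carrier_vec q" for c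
  proof -
    have "?N ^\<^sub>m Suc j = 0\<^sub>m q q" using nil N by simp
    then show ?thesis using that by (intro eq_vecI) auto
  qed
  ultimately have z: "?N *\<^sub>v c = 0\<^sub>v q" if "c \<in> carrier_vec q" for c using that by blast
  show ?thesis
  proof (rule eq_matI)
    fix i j assume ij: "i < dim_row (1\<^sub>m q :: complex mat)" "j < dim_col (1\<^sub>m q :: complex mat)"
    have "(?N *\<^sub>v unit_vec q j) $ i = 0" using z[of "unit_vec q j"] ij by simp
    then have "?N $$ (i, j) = 0" using ij K N by simp
    then show "K $$ (i, j) = (1\<^sub>m q :: complex mat) $$ (i, j)" using ij K by simp
  qed (use K in auto)
qed

text \<open>Let \<open>P\<close> be \<open>Z\<close> stacked on 1 and \<open>p = P^T J y\<close>.
  Since \<open>l\<close> is symplectic and \<open>l P = P K\<close>, one gets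
  \<open>p = x K^T p\<close>. A nonzero \<open>p\<close> thus makes \<open>1 / x\<close> an
  eigenvalue of \<open>K^T\<close>, hence of \<open>K\<close>, which is unitary for
  \<open>Im Z\<close>.\<close>

lemma isotropy_eigenvalue_aux:
  assumes l: "is_Sp q l" and Z: "siegel q Z" and K: "K \<in> carrier_mat q q"
    and e: "cplx l * (Z @\<^sub>r 1\<^sub>m q) = (Z @\<^sub>r 1\<^sub>m q) * K"
    and y: "y \<in> carrier_mat (2*q) 1" "cplx l * y = x \<cdot>\<^sub>m y"
    and nz: "(Z @\<^sub>r 1\<^sub>m q)\<^sup>T * (cplx (Jmat q) * y) \<noteq> 0\<^sub>m q 1"
  shows "cmod x = 1"
proof -
  note [simp] = is_Sp_dim[OF l]
  have Zc: "Z \<in> carrier_mat q q" and Zp: "pos_def q (map_mat Im Z)" using Z unfolding siegel_def by auto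
  let ?P = "Z @\<^sub>r 1\<^sub>m q"
  have Pd [simp]: "dim_row ?P = 2*q" "dim_col ?P = q" using Zc unfolding append_rows_def by auto
  have [simp]: "dim_row y = 2*q" "dim_col y = 1" "dim_row K = q" "dim_col K = q" using y K by auto
  define p where "p = ?P\<^sup>T * (cplx (Jmat q) * y)"
  have pd [simp]: "dim_row p = q" "dim_col p = 1" unfolding p_def by auto
  have "p = ?P\<^sup>T * (((cplx l)\<^sup>T * (cplx (Jmat q) * cplx l)) * y)" unfolding p_def cplx_Sp[OF l] ..
  also have "\<dots> = (cplx l * ?P)\<^sup>T * (cplx (Jmat q) * (cplx l * y))" by (simp add: mat_dim_simps)
  also have "\<dots> = x \<cdot>\<^sub>m (K\<^sup>T * p)" unfolding e y(2) p_def by (simp add: mat_dim_simps)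
  finally have pK: "p = x \<cdot>\<^sub>m (K\<^sup>T * p)" .
  have pn: "p \<noteq> 0\<^sub>m q 1" using nz unfolding p_def .
  have x: "x \<noteq> 0"
  proof
    assume "x = 0"
    then have "x \<cdot>\<^sub>m (K\<^sup>T * p) = 0\<^sub>m q 1" by (intro eq_matI) (auto simp del: index_mult_mat(1))
    with pK have "p = 0\<^sub>m q 1" by metis
    with pn show False ..
  qed
  define c where "c = col p 0"
  have cc: "c \<in> carrier_vec q" unfolding c_def by (simp add: carrier_vecI)
  have "c \<noteq> 0\<^sub>v q"
  proof
    assume z: "c = 0\<^sub>v q"
    have "p $$ (i, 0) = 0" if "i < q" for i using arg_cong[OF z, of "\<lambda>v. v $ i"] that unfolding c_def by simp
    then have "p = 0\<^sub>m q 1" by (intro eq_matI) auto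
    with pn show False ..
  qed
  moreover have "K\<^sup>T *\<^sub>v c = (1 / x) \<cdot>\<^sub>v c"
  proof (rule eq_vecI)
    fix i assume i: "i < dim_vec ((1 / x) \<cdot>\<^sub>v c)"
    then have i: "i < q" using cc by simp
    have "(K\<^sup>T *\<^sub>v c) $ i = (K\<^sup>T * p) $$ (i, 0)" unfolding c_def using i by simp
    moreover have "p $$ (i, 0) = x * (K\<^sup>T * p) $$ (i, 0)"
      using arg_cong[OF pK, of "\<lambda>X. X $$ (i, 0)"] i by (simp del: index_mult_mat(1))
    ultimately show "(K\<^sup>T *\<^sub>v c) $ i = ((1 / x) \<cdot>\<^sub>v c) $ i" using x i unfolding c_def by simp
  qed (use cc in simp)
  ultimately have "eigenvalue (K\<^sup>T) (1 / x)"
    unfolding eigenvalue_def eigenvector_def using cc by auto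
  then have "eigenvalue K (1 / x)"
    using eigenvalue_root_char_poly[of "K\<^sup>T" q] eigenvalue_root_char_poly[OF K] K by simp
  from unitary_eigenvalue[OF K Zp lagrangian_transport(2)[OF l Z Zc K e] this]
  show ?thesis by (simp add: norm_divide)
qed

text \<open>If \<open>\<bar>x\<bar> \<noteq> 1\<close>, the eigenvector \<open>y\<close> and its
  conjugate, with eigenvalue \<open>cnj x\<close>, both pair to 0 with the Lagrangian of
  \<open>Z\<close>. A Lagrangian is its own complement, so both lie in it; for the lower half
  \<open>c\<close> of \<open>y\<close> this gives \<open>Z c = conj Z c\<close>, hence
  \<open>Im Z c = 0\<close> and \<open>y = 0\<close>.\<close>

lemma isotropy_eigenvalue:
  assumes l: "is_Sp q l" and Z: "siegel q Z" and K: "K \<in> carrier_mat q q"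
    and e: "cplx l * (Z @\<^sub>r 1\<^sub>m q) = (Z @\<^sub>r 1\<^sub>m q) * K"
    and ev: "eigenvalue (cplx l) x"
  shows "cmod x = 1"
proof -
  note [simp] = is_Sp_dim[OF l]
  have Zc: "Z \<in> carrier_mat q q" and Zs: "Z\<^sup>T = Z" and Zp: "pos_def q (map_mat Im Z)" using Z unfolding siegel_def by auto
  have [simp]: "dim_row Z = q" "dim_col Z = q" using Zc by auto
  from ev obtain v where v: "v \<in> carrier_vec (2*q)" "v \<noteq> 0\<^sub>v (2*q)" "cplx l *\<^sub>v v = x \<cdot>\<^sub>v v"
    unfolding eigenvalue_def eigenvector_def by auto
  define y where "y = mat (2*q) 1 (\<lambda>(i, _). v $ i)"
  have yc: "y \<in> carrier_mat (2*q) 1" unfolding y_def by simp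
  have ly: "cplx l * y = x \<cdot>\<^sub>m y"
  proof (rule eq_matI)
    fix i j assume "i < dim_row (x \<cdot>\<^sub>m y)" "j < dim_col (x \<cdot>\<^sub>m y)"
    then have ij: "i < 2*q" "j = 0" unfolding y_def by auto
    have "col y 0 = v" unfolding y_def using v(1) by (intro eq_vecI) auto
    then have "(cplx l * y) $$ (i, 0) = (cplx l *\<^sub>v v) $ i" using ij unfolding y_def by simp
    also have "\<dots> = x * v $ i" unfolding v(3) using ij v(1) by simp
    finally show "(cplx l * y) $$ (i, j) = (x \<cdot>\<^sub>m y) $$ (i, j)" using ij unfolding y_def by simp
  qed (auto simp: y_def)
  have lcy: "cplx l * conj_mat y = cnj x \<cdot>\<^sub>m conj_mat y"
  proof -
    have "conj_mat (cplx l * y) = conj_mat (cplx l) * conj_mat y"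
      using cnj_hom.mat_hom_mult[OF _ yc, of "cplx l" "2*q"] is_Sp_carrier[OF l] by simp
    moreover have "conj_mat (x \<cdot>\<^sub>m y) = cnj x \<cdot>\<^sub>m conj_mat y" by (intro eq_matI) auto
    ultimately show ?thesis using ly by simp
  qed
  let ?P = "Z @\<^sub>r 1\<^sub>m q"
  show ?thesis
  proof (rule ccontr)
    assume neq: "cmod x \<noteq> 1"
    then have 1: "?P\<^sup>T * (cplx (Jmat q) * y) = 0\<^sub>m q 1"
      using isotropy_eigenvalue_aux[OF l Z K e yc ly] by blast
    have 2: "?P\<^sup>T * (cplx (Jmat q) * conj_mat y) = 0\<^sub>m q 1"
      using isotropy_eigenvalue_aux[OF l Z K e _ lcy] yc neq by fastforce
    define ya yb where ya: "ya = mat q 1 (\<lambda>(i, _). v $ i)" and yb: "yb = mat q 1 (\<lambda>(i, _). v $ (i + q))"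
    have yabc [simp]: "ya \<in> carrier_mat q 1" "yb \<in> carrier_mat q 1" unfolding ya yb by auto
    have yabd [simp]: "dim_row ya = q" "dim_row yb = q" "dim_col ya = 1" "dim_col yb = 1" unfolding ya yb by auto
    have yab: "y = ya @\<^sub>r yb"
    proof (rule eq_matI)
      show "dim_row y = dim_row (ya @\<^sub>r yb)" "dim_col y = dim_col (ya @\<^sub>r yb)"
        unfolding append_rows_def y_def by auto
      fix i j assume "i < dim_row (ya @\<^sub>r yb)" "j < dim_col (ya @\<^sub>r yb)"
      then have "i < q + q" "j < 1" unfolding append_rows_def by auto
      then show "y $$ (i, j) = (ya @\<^sub>r yb) $$ (i, j)"
        by (subst index_append_rows[of _ q 1 _ q]) (auto simp: y_def ya yb)
    qed
    have "Z\<^sup>T * yb - (1\<^sub>m q)\<^sup>T * ya = 0\<^sub>m q 1"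
      using 1 lagrangian_pairing[of Z q q "1\<^sub>m q" ya 1 yb] Zc unfolding yab by simp
    then have z1: "Z * yb - ya = 0\<^sub>m q 1" unfolding Zs by (simp add: mat_dim_simps)
    have "Z\<^sup>T * conj_mat yb - (1\<^sub>m q)\<^sup>T * conj_mat ya = 0\<^sub>m q 1"
      using 2 lagrangian_pairing[of Z q q "1\<^sub>m q" "conj_mat ya" 1 "conj_mat yb"] Zc 
      unfolding yab by (simp add: map_append_rows[of _ q 1 _ q])
    then have z2: "Z * conj_mat yb - conj_mat ya = 0\<^sub>m q 1" unfolding Zs by (simp add: mat_dim_simps)
    have Zyb: "(Z * yb) $$ (i, 0) = ya $$ (i, 0)" if "i < q" for i
      using arg_cong[OF z1, of "\<lambda>X. X $$ (i, 0)"] that by (simp del: index_mult_mat(1))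
    have Zyb': "(Z * conj_mat yb) $$ (i, 0) = cnj (ya $$ (i, 0))" if "i < q" for i
      using arg_cong[OF z2, of "\<lambda>X. X $$ (i, 0)"] that by (simp del: index_mult_mat(1))
    let ?c = "vec q (\<lambda>i. v $ (i + q))"
    have im0: "(cplx (map_mat Im Z) *\<^sub>v ?c) $ i = 0" if i: "i < q" for i
    proof -
      have "(\<Sum>j<q. Z $$ (i, j) * v $ (j + q)) = ya $$ (i, 0)"
        using Zyb[OF i] i by (simp add: yb scalar_prod_def atLeast0LessThan)
      moreover have "cnj (\<Sum>j<q. Z $$ (i, j) * cnj (v $ (j + q))) = ya $$ (i, 0)"
        using Zyb'[OF i] i by (simp add: yb scalar_prod_def atLeast0LessThan)
      ultimately have "(\<Sum>j<q. Z $$ (i, j) * v $ (j + q)) - (\<Sum>j<q. cnj (Z $$ (i, j)) * v $ (j + q)) = 0"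
        by simp
      moreover have "(\<Sum>j<q. Z $$ (i, j) * v $ (j + q)) - (\<Sum>j<q. cnj (Z $$ (i, j)) * v $ (j + q))
          = 2 * \<i> * (\<Sum>j<q. of_real (Im (Z $$ (i, j))) * v $ (j + q))"
        unfolding sum_subtractf[symmetric] sum_distrib_left
        by (intro sum.cong refl) (simp add: complex_eq_iff)
      ultimately show ?thesis using i by (simp add: scalar_prod_def atLeast0LessThan)
    qed
    have "?c = 0\<^sub>v q"
    proof (rule ccontr)
      assume "?c \<noteq> 0\<^sub>v q"
      from sesq_pos[OF Zp _ this] have "Re (sesq (map_mat Im Z) ?c ?c) > 0" by simp
      moreover have "sesq (map_mat Im Z) ?c ?c = 0"
        unfolding sesq_def scalar_prod_def using im0 by (intro sum.neutral) auto
      ultimately show False by simp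
    qed
    then have vb: "v $ (i + q) = 0" if "i < q" for i using that by (metis index_vec index_zero_vec(1))
    have va: "v $ i = 0" if "i < q" for i
    proof -
      have "v $ i = (Z * yb) $$ (i, 0)" using Zyb[OF that] that unfolding ya by simp
      also have "\<dots> = 0" using that vb by (simp add: yb scalar_prod_def)
      finally show ?thesis .
    qed
    have "v $ i = 0" if "i < 2*q" for i
      using va[of i] vb[of "i - q"] that by (cases "i < q") auto
    then have "v = 0\<^sub>v (2*q)" using v(1) by (intro eq_vecI) auto
    with v(2) show False ..
  qed
qed

text \<open>The automorphy factor is exactly 1: \<open>A Z + B = Z\<close> and
  \<open>C Z + D = 1\<close>. Imaginary parts give \<open>A = 1\<close> and \<open>C = 0\<close>,
  after which the equations themselves give \<open>B\<close> and \<open>D\<close>.\<close>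

lemma isotropy_trivial:
  assumes l: "is_Sp q l" and Z: "siegel q Z"
    and e: "cplx l * (Z @\<^sub>r 1\<^sub>m q) = Z @\<^sub>r 1\<^sub>m q"
  shows "l = 1\<^sub>m (2*q)"
proof -
  have Zc: "Z \<in> carrier_mat q q" and Zp: "pos_def q (map_mat Im Z)" using Z unfolding siegel_def by auto
  have [simp]: "dim_row Z = q" "dim_col Z = q" using Zc by auto
  note lc = is_Sp_carrier[OF l]
  let ?A = "blkA q l" and ?B = "blkB q l" and ?C = "blkC q l" and ?D = "blkD q l" and ?Y = "map_mat Im Z"
  have e': "(cplx ?A * Z + cplx ?B) @\<^sub>r (cplx ?C * Z + cplx ?D) = Z @\<^sub>r 1\<^sub>m q"
    using e unfolding lagrangian_image[OF lc Zc] blk_cplx[OF lc] .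
  have AB: "cplx ?A * Z + cplx ?B = Z"
    by (rule append_rows_inject(1)[OF _ _ _ _ e']) (auto intro!: carrier_matI)
  have CD: "cplx ?C * Z + cplx ?D = 1\<^sub>m q"
    by (rule append_rows_inject(2)[OF _ _ _ _ e']) (auto intro!: carrier_matI)
  have im: "map_mat Im (cplx X * Z + cplx X') = X * ?Y" if "X \<in> carrier_mat q q" "X' \<in> carrier_mat q q" for X X'
    using that by (intro eq_matI) (auto simp: scalar_prod_def)
  note iv = pos_def_inverse[OF Zp]
  have X: "X = M * minv ?Y" if "X * ?Y = M" "X \<in> carrier_mat q q" for X M
  proof -
    have "X = X * (?Y * minv ?Y)" unfolding iv(2) using that by simp
    also have "\<dots> = (X * ?Y) * minv ?Y" using that(2) iv(1) by (simp add: mat_dim_simps)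
    finally show ?thesis unfolding that(1) .
  qed
  have "?A * ?Y = ?Y" using im[of ?A ?B] unfolding AB by simp
  then have A: "?A = 1\<^sub>m q" using X[of ?A ?Y] iv(2) by simp
  have "map_mat Im (1\<^sub>m q) = 0\<^sub>m q q" by (intro eq_matI) auto
  then have "?C * ?Y = 0\<^sub>m q q" using im[of ?C ?D] unfolding CD by simp
  then have C: "?C = 0\<^sub>m q q" using X[of ?C "0\<^sub>m q q"] iv(1) by simp
  have c1: "cplx (1\<^sub>m q) = 1\<^sub>m q" and c0: "cplx (0\<^sub>m q q) = 0\<^sub>m q q" by (intro eq_matI; simp)+
  have B: "?B = 0\<^sub>m q q"
  proof (rule eq_matI)
    fix i j assume ij: "i < dim_row (0\<^sub>m q q :: real mat)" "j < dim_col (0\<^sub>m q q :: real mat)"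
    then show "?B $$ (i, j) = 0\<^sub>m q q $$ (i, j)"
      using arg_cong[OF AB[unfolded A c1], of "\<lambda>X. X $$ (i, j)"] by (simp add: one_mult_mat_dim)
  qed auto
  have D: "?D = 1\<^sub>m q"
  proof (rule eq_matI)
    fix i j assume ij: "i < dim_row (1\<^sub>m q :: real mat)" "j < dim_col (1\<^sub>m q :: real mat)"
    then show "?D $$ (i, j) = 1\<^sub>m q $$ (i, j)"
      using arg_cong[OF CD[unfolded C c0], of "\<lambda>X. X $$ (i, j)"] by (simp add: mat_dim_simps split: if_splits)
  qed auto
  have "l = four_block_mat (1\<^sub>m q) (0\<^sub>m q q) (0\<^sub>m q q) (1\<^sub>m q)"
    using block_decomp[OF lc] unfolding A B C D .
  then show ?thesis by (simp add: mult_2)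
qed

section \<open>Elements fixing a boundary point\<close>

text \<open>By block triangularity an eigenvalue other than 1 forces the last coordinate of the
  eigenvector to vanish, and the middle part cannot vanish too; the middle part is then an
  eigenvector of the Levi block, which fixes \<open>Z\<close>.\<close>

lemma parabolic_eigenvalue:
  assumes n: "n \<ge> 1" and k: "is_Sp n k" "parabolic n k" "k $$ (n-1, n-1) = 1" "k $$ (2*n-1, 2*n-1) = 1"
    and Z: "siegel (n-1) Z" and K: "K \<in> carrier_mat (n-1) (n-1)"
    and e: "cplx (levi_proj n k) * (Z @\<^sub>r 1\<^sub>m (n-1)) = (Z @\<^sub>r 1\<^sub>m (n-1)) * K"
    and ev: "eigenvalue (cplx k) x"
  shows "cmod x = 1"
proof (cases "x = 1")
  case False
  note p = parabolicD[OF k(2)]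
  have ne: "n - 1 < 2*n" "2*n - 1 < 2*n" "n - 1 \<noteq> 2*n - 1" "2*n - 1 \<noteq> n - 1" using n by auto
  from ev obtain v where v: "v \<in> carrier_vec (2*n)" "v \<noteq> 0\<^sub>v (2*n)" "cplx k *\<^sub>v v = x \<cdot>\<^sub>v v"
    unfolding eigenvalue_def eigenvector_def using p by auto
  have row: "x * v $ i = (\<Sum>j<2*(n-1). of_real (k $$ (i, lidx n j)) * v $ lidx n j)
      + (of_real (k $$ (i, n-1)) * v $ (n-1) + of_real (k $$ (i, 2*n-1)) * v $ (2*n-1))" if i: "i < 2*n" for i
  proof -
    have "x * v $ i = (cplx k *\<^sub>v v) $ i" unfolding v(3) using i v(1) by simp
    also have "\<dots> = (\<Sum>j<2*n. of_real (k $$ (i, j)) * v $ j)"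
      using i v(1) p by (simp add: scalar_prod_def atLeast0LessThan)
    finally show ?thesis unfolding sum_lidx[OF n] .
  qed
  have last: "k $$ (2*n-1, lidx n j) = 0" if "j < 2*(n-1)" for j using p(5) lidx_less[OF that] by blast
  have col: "k $$ (lidx n j, n-1) = 0" if "j < 2*(n-1)" for j using p(4) lidx_less[OF that] by blast
  have "x * v $ (2*n-1) = v $ (2*n-1)"
    using row[OF ne(2)] last p(5)[OF ne(1) ne(3)] k(4) by simp
  then have v2: "v $ (2*n-1) = 0" using False by auto
  define v1 where "v1 = vec (2*(n-1)) (\<lambda>i. v $ lidx n i)"
  have lv: "cplx (levi_proj n k) *\<^sub>v v1 = x \<cdot>\<^sub>v v1"
  proof (rule eq_vecI)
    fix i assume "i < dim_vec (x \<cdot>\<^sub>v v1)"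
    then have i: "i < 2*(n-1)" unfolding v1_def by simp
    show "(cplx (levi_proj n k) *\<^sub>v v1) $ i = (x \<cdot>\<^sub>v v1) $ i"
      using row[OF lidx_less(1)[OF i]] i col v2 unfolding v1_def
      by (simp add: scalar_prod_def atLeast0LessThan)
  qed (simp add: v1_def)
  have "v1 \<noteq> 0\<^sub>v (2*(n-1))"
  proof
    assume z: "v1 = 0\<^sub>v (2*(n-1))"
    have vl: "v $ lidx n i = 0" if "i < 2*(n-1)" for i
      using arg_cong[OF z, of "\<lambda>w. w $ i"] that unfolding v1_def by simp
    have "x * v $ (n-1) = v $ (n-1)" using row[OF ne(1)] vl v2 k(3) by simp
    then have "v $ (n-1) = 0" using False by auto
    then have "v $ i = 0" if "i < 2*n" for i
      using vl v2 that lidx_surj[of i n] by metis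
    then have "v = 0\<^sub>v (2*n)" using v(1) by (intro eq_vecI) auto
    with v(2) show False ..
  qed
  then have "eigenvalue (cplx (levi_proj n k)) x"
    unfolding eigenvalue_def eigenvector_def using lv by (intro exI[of _ v1]) (auto simp: v1_def)
  then show ?thesis by (rule isotropy_eigenvalue[OF levi_proj_Sp[OF n k(1,2)] Z K e])
qed simp

lemma pow_mat_intertwine:
  fixes X :: "'a::comm_ring_1 mat"
  assumes "X \<in> carrier_mat n n" "Y \<in> carrier_mat p p" "P \<in> carrier_mat n p" and e: "X * P = P * Y"
  shows "X ^\<^sub>m j * P = P * Y ^\<^sub>m j"
proof (induction j)
  case 0
  then show ?case using assms by simp
next
  case (Suc j)
  have d: "X ^\<^sub>m j \<in> carrier_mat n n" "Y ^\<^sub>m j \<in> carrier_mat p p" using assms by (auto intro: pow_carrier_mat)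
  have "X ^\<^sub>m Suc j * P = X ^\<^sub>m j * (X * P)" using d assms by (simp add: assoc_mult_mat[OF d(1)])
  also have "\<dots> = (X ^\<^sub>m j * P) * Y" unfolding e using d assms by (simp add: assoc_mult_mat[OF d(1)])
  also have "\<dots> = P * Y ^\<^sub>m Suc j" unfolding Suc using d assms by (simp add: assoc_mult_mat[OF assms(3) d(2)])
  finally show ?case .
qed

text \<open>All three diagonal blocks are 0, so \<open>M\<close> is strictly block triangular of
  length 3.\<close>

lemma parabolic_strictly_unipotent:
  assumes n: "n \<ge> 1" and M: "parabolic n M" "M $$ (n-1, n-1) = 0" "M $$ (2*n-1, 2*n-1) = 0"
    and l: "levi_proj n M = 0\<^sub>m (2*(n-1)) (2*(n-1))"
  shows "M * (M * M) = 0\<^sub>m (2*n) (2*n)"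
proof -
  note p = parabolicD[OF M(1)]
  have col: "M $$ (i, n-1) = 0" if "i < 2*n" for i using p(4)[OF that] M(2) by (cases "i = n-1") auto
  have row: "M $$ (2*n-1, j) = 0" if "j < 2*n" for j using p(5)[OF that] M(3) by (cases "j = 2*n-1") auto
  have lev: "M $$ (lidx n i, lidx n j) = 0" if "i < 2*(n-1)" "j < 2*(n-1)" for i j
    using arg_cong[OF l, of "\<lambda>X. X $$ (i, j)"] that by simp
  have MM: "M * M \<in> carrier_mat (2*n) (2*n)" using p by simp
  have ne: "n - 1 < 2*n" "2*n - 1 < 2*n" using n by auto
  have MMl: "(M * M) $$ (lidx n i, j) = 0" if "i < 2*(n-1)" "j < 2*n" for i j
    unfolding index_mult_lidx[OF n p(1) p(1) lidx_less(1)[OF that(1)] that(2)]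
    using lev[OF that(1)] col[OF lidx_less(1)[OF that(1)]] row[OF that(2)] by simp
  have MMr: "(M * M) $$ (2*n-1, j) = 0" if "j < 2*n" for j
    unfolding index_mult_lidx[OF n p(1) p(1) ne(2) that] using row lidx_less ne that by simp
  show ?thesis
  proof (rule eq_matI)
    fix i j assume "i < dim_row (0\<^sub>m (2*n) (2*n) :: real mat)" "j < dim_col (0\<^sub>m (2*n) (2*n) :: real mat)"
    then have ij: "i < 2*n" "j < 2*n" by auto
    show "(M * (M * M)) $$ (i, j) = 0\<^sub>m (2*n) (2*n) $$ (i, j)"
      unfolding index_mult_lidx[OF n p(1) MM ij] using MMl[OF _ ij(2)] MMr[OF ij(2)] col[OF ij(1)] ij 
      by (simp del: index_mult_mat(1))
  qed (use p in auto)
qed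

text \<open>The group \<open>\<Gamma>(8m)\<close> is neat: an element fixing a boundary point acts on the Levi quotient as an
  isometry with algebraic integer eigenvalues congruent to 1 modulo \<open>8m\<close>, hence trivially.\<close>

lemma boundary_isotropy_unipotent:
  assumes n: "n \<ge> 1" and m: "m \<ge> 1" and g: "is_Sp n g" and u: "is_Sp n u"
    and X: "X \<in> carrier_mat (2*n) (2*n)" "integral_mat X" and uX: "u = 1\<^sub>m (2*n) + real (8*m) \<cdot>\<^sub>m X"
    and kd: "k = sp_inv n g * u * g"
    and k: "parabolic n k" "k $$ (n-1, n-1) = 1" "k $$ (2*n-1, 2*n-1) = 1"
    and Z: "siegel (n-1) Z" and K: "K \<in> carrier_mat (n-1) (n-1)"
    and e: "cplx (levi_proj n k) * (Z @\<^sub>r 1\<^sub>m (n-1)) = (Z @\<^sub>r 1\<^sub>m (n-1)) * K"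
  shows "levi_proj n k = 1\<^sub>m (2*(n-1))" "(u - 1\<^sub>m (2*n)) * ((u - 1\<^sub>m (2*n)) * (u - 1\<^sub>m (2*n))) = 0\<^sub>m (2*n) (2*n)"
proof -
  let ?i = "sp_inv n g" and ?I = "1\<^sub>m (2*n) :: real mat" and ?q = "n - 1" and ?c = "real (8*m)"
  note gc = is_Sp_carrier[OF g] and ic = sp_inv_carrier[OF is_Sp_carrier[OF g]] and uc = is_Sp_carrier[OF u]
  note [simp] = is_Sp_dim[OF g] is_Sp_dim[OF u]
  have [simp]: "dim_row X = 2*n" "dim_col X = 2*n" using X by auto
  note gi = sp_inv_right[OF g] and ig = sp_inv_left[OF g]
  have kSp: "is_Sp n k" unfolding kd by (intro is_Sp_mult is_Sp_sp_inv g u)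
  note [simp] = is_Sp_dim[OF kSp]
  note kc = is_Sp_carrier[OF kSp]
  have uk: "u = g * k * ?i"
  proof -
    have "g * k * ?i = (g * ?i) * (u * (g * ?i))" unfolding kd by (simp add: mat_dim_simps)
    then show ?thesis unfolding gi by (simp add: one_mult_mat_dim)
  qed
  have small: "cmod x \<le> 1/4" if ev: "eigenvalue (cplx X) x" for x
  proof -
    from ev obtain v where v: "v \<in> carrier_vec (2*n)" "v \<noteq> 0\<^sub>v (2*n)" "cplx X *\<^sub>v v = x \<cdot>\<^sub>v v"
      unfolding eigenvalue_def eigenvector_def by auto
    have "cplx u *\<^sub>v v = (1 + of_nat (8*m) * x) \<cdot>\<^sub>v v"
    proof -
      have "cplx u = 1\<^sub>m (2*n) + of_nat (8*m) \<cdot>\<^sub>m cplx X" unfolding uX by (intro eq_matI) auto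
      moreover have sv: "(of_nat (8*m) \<cdot>\<^sub>m cplx X) *\<^sub>v v = of_nat (8*m) \<cdot>\<^sub>v (cplx X *\<^sub>v v)"
        using v(1) by (intro eq_vecI) auto
      ultimately have "cplx u *\<^sub>v v = v + of_nat (8*m) \<cdot>\<^sub>v (cplx X *\<^sub>v v)"
        using add_mult_distrib_mat_vec[of "1\<^sub>m (2*n)" "2*n" "2*n" "of_nat (8*m) \<cdot>\<^sub>m cplx X" v] X v(1) sv by simp
      then show ?thesis unfolding v(3) using v(1) by (intro eq_vecI) (auto simp: algebra_simps)
    qed
    then have "eigenvalue (cplx u) (1 + of_nat (8*m) * x)"
      unfolding eigenvalue_def eigenvector_def using v by auto
    moreover have "similar_mat (cplx u) (cplx k)"
    proof (rule similar_matI[of _ _ "cplx g" "cplx ?i" "2*n"])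
      have "cplx (1\<^sub>m (2*n)) = 1\<^sub>m (2*n)" by (intro eq_matI) auto
      then show "cplx g * cplx ?i = 1\<^sub>m (2*n)" "cplx ?i * cplx g = 1\<^sub>m (2*n)"
        using arg_cong[OF gi, of cplx] arg_cong[OF ig, of cplx] by (simp_all add: cplx_mult)
      show "cplx u = cplx g * cplx k * cplx ?i" by (subst uk) (simp add: cplx_mult)
    qed (use uc kc gc ic in auto)
    ultimately have "eigenvalue (cplx k) (1 + of_nat (8*m) * x)"
      using eigenvalue_root_char_poly[of "cplx u" "2*n"] eigenvalue_root_char_poly[of "cplx k" "2*n"]
        char_poly_similar uc kc by fastforce
    then have 1: "cmod (1 + of_nat (8*m) * x) = 1" by (rule parabolic_eigenvalue[OF n kSp k Z K e])
    have "cmod (of_nat (8*m) * x) \<le> cmod (1 + of_nat (8*m) * x) + cmod 1"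
      using norm_triangle_ineq4[of "1 + of_nat (8*m) * x" 1] by simp
    then have 2: "8 * (real m * cmod x) \<le> 2" unfolding 1 by (simp add: norm_mult)
    have "cmod x \<le> real m * cmod x" using m by (simp add: mult_le_cancel_right1)
    with 2 show ?thesis by simp
  qed
  from integral_nilpotent[OF X this] obtain j where j: "X ^\<^sub>m j = 0\<^sub>m (2*n) (2*n)" by auto
  define M where "M = k + (-1) \<cdot>\<^sub>m ?I"
  have Mc: "M \<in> carrier_mat (2*n) (2*n)" unfolding M_def by (auto intro: carrier_matI)
  have Md [simp]: "dim_row M = 2*n" "dim_col M = 2*n" using Mc by auto
  have Mp: "parabolic n M" unfolding M_def by (intro parabolic_add k parabolic_smult parabolic_one n)
  have lM: "levi_proj n M = levi_proj n k + (-1) \<cdot>\<^sub>m 1\<^sub>m (2*?q)"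
    unfolding M_def by (subst levi_proj_add) (use kc in \<open>auto simp: levi_proj_smult levi_proj_one[OF n]\<close>)
  have uM: "u - ?I = g * M * ?i"
  proof -
    have "g * M * ?i = g * k * ?i + (-1) \<cdot>\<^sub>m (g * ?i)" unfolding M_def by (simp add: mat_dim_simps)
    also have "\<dots> = u + (-1) \<cdot>\<^sub>m ?I" unfolding uk[symmetric] gi ..
    finally show ?thesis by (auto intro!: eq_matI)
  qed
  \<comment> \<open>Nilpotency is known for the integral matrix \<open>X\<close>; \<open>g\<close>
    intertwines \<open>8m X\<close> with \<open>M = k - 1\<close> and carries it over.\<close>
  have "(?c \<cdot>\<^sub>m X) * g = g * M"
  proof -
    have "u - ?I = ?c \<cdot>\<^sub>m X" unfolding uX by (intro eq_matI) auto
    then have "(?c \<cdot>\<^sub>m X) * g = g * M * ?i * g" using uM by simp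
    also have "\<dots> = g * (M * (?i * g))" by (simp add: mat_dim_simps)
    finally show ?thesis unfolding ig by (simp add: one_mult_mat_dim)
  qed
  then have "(?c \<cdot>\<^sub>m X) ^\<^sub>m j * g = g * M ^\<^sub>m j"
    using pow_mat_intertwine[of "?c \<cdot>\<^sub>m X" "2*n" M "2*n" g] X Mc gc by simp
  moreover have "(?c \<cdot>\<^sub>m X) ^\<^sub>m i = ?c ^ i \<cdot>\<^sub>m X ^\<^sub>m i" for i
    by (rule smult_pow_mat[OF X(1)])
  ultimately have "g * M ^\<^sub>m j = 0\<^sub>m (2*n) (2*n)" using j gc by simp
  then have "?i * (g * M ^\<^sub>m j) = 0\<^sub>m (2*n) (2*n)" using ic by simp
  moreover have "?i * (g * M ^\<^sub>m j) = M ^\<^sub>m j"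
    using assoc_mult_mat[OF ic gc pow_carrier_mat[OF Mc, of j]] pow_carrier_mat[OF Mc, of j] ig by simp
  ultimately have Mj: "M ^\<^sub>m j = 0\<^sub>m (2*n) (2*n)" by simp
  let ?P = "Z @\<^sub>r 1\<^sub>m ?q"
  have Zc: "Z \<in> carrier_mat ?q ?q" and Zp: "pos_def ?q (map_mat Im Z)" using Z unfolding siegel_def by auto
  have Pd [simp]: "dim_row ?P = 2*?q" "dim_col ?P = ?q" using Zc unfolding append_rows_def by auto
  have Pc: "?P \<in> carrier_mat (2*?q) ?q" by (rule carrier_matI) auto
  have Kd [simp]: "dim_row K = ?q" "dim_col K = ?q" using K by auto
  have lSp: "is_Sp ?q (levi_proj n k)" by (rule levi_proj_Sp[OF n kSp k(1)])
  have "levi_proj n M ^\<^sub>m j = levi_proj n (0\<^sub>m (2*n) (2*n))" using parabolic_pow(2)[OF n Mp, of j] Mj by simp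
  also have "\<dots> = 0\<^sub>m (2*?q) (2*?q)" by (intro eq_matI) (auto simp: lidx_less)
  finally have lMj: "levi_proj n M ^\<^sub>m j = 0\<^sub>m (2*?q) (2*?q)" .
  have KI: "K - 1\<^sub>m ?q \<in> carrier_mat ?q ?q" using K by (auto intro: carrier_matI)
  \<comment> \<open>The stacked matrix of \<open>Z\<close> intertwines the Levi part of
    \<open>M\<close> with \<open>K - 1\<close>. Its lower block is 1, so it is injective and
    \<open>K - 1\<close> is nilpotent as well.\<close>
  have "cplx (levi_proj n M) * ?P = ?P * (K - 1\<^sub>m ?q)"
  proof -
    have "cplx (levi_proj n M) = cplx (levi_proj n k) - 1\<^sub>m (2*?q)" unfolding lM by (intro eq_matI) auto
    then have "cplx (levi_proj n M) * ?P = cplx (levi_proj n k) * ?P - ?P" by (simp add: mat_dim_simps)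
    then show ?thesis unfolding e by (simp add: mat_dim_simps)
  qed
  then have "cplx (levi_proj n M) ^\<^sub>m j * ?P = ?P * (K - 1\<^sub>m ?q) ^\<^sub>m j"
    using pow_mat_intertwine[of "cplx (levi_proj n M)" "2*?q" "K - 1\<^sub>m ?q" ?q ?P j] KI Pc by simp
  moreover have "cplx (levi_proj n M) ^\<^sub>m j = cplx (levi_proj n M ^\<^sub>m j)"
    by (rule of_real_hom.mat_hom_pow[symmetric, of _ "2*?q"]) simp
  moreover have "cplx (0\<^sub>m (2*?q) (2*?q)) = 0\<^sub>m (2*?q) (2*?q)" by (intro eq_matI) auto
  ultimately have z: "?P * (K - 1\<^sub>m ?q) ^\<^sub>m j = 0\<^sub>m (2*?q) ?q" using Pc unfolding lMj by simp
  have Kj: "(K - 1\<^sub>m ?q) ^\<^sub>m j \<in> carrier_mat ?q ?q" by (rule pow_carrier_mat[OF KI])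
  have "?P * (K - 1\<^sub>m ?q) ^\<^sub>m j = (Z * (K - 1\<^sub>m ?q) ^\<^sub>m j) @\<^sub>r (1\<^sub>m ?q * (K - 1\<^sub>m ?q) ^\<^sub>m j)"
    by (rule append_rows_mult[OF Zc one_carrier_mat Kj])
  then have zz: "(Z * (K - 1\<^sub>m ?q) ^\<^sub>m j) @\<^sub>r ((K - 1\<^sub>m ?q) ^\<^sub>m j) = 0\<^sub>m ?q ?q @\<^sub>r 0\<^sub>m ?q ?q"
    unfolding z using Kj by (simp add: append_rows_def mult_2)
  have "(K - 1\<^sub>m ?q) ^\<^sub>m j = 0\<^sub>m ?q ?q"
    by (rule append_rows_inject(2)[OF _ Kj _ _ zz]) (use Kj Zc in auto)
  from unitary_unipotent[OF K Zp lagrangian_transport(2)[OF lSp Z Zc K e] this]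
  have "cplx (levi_proj n k) * ?P = ?P" using e Pc by simp
  then show lk: "levi_proj n k = 1\<^sub>m (2*?q)" by (rule isotropy_trivial[OF lSp Z])
  have ne: "n - 1 < 2*n" "2*n - 1 < 2*n" using n by auto
  have MMM: "M * (M * M) = 0\<^sub>m (2*n) (2*n)"
  proof (rule parabolic_strictly_unipotent[OF n Mp])
    show "M $$ (n-1, n-1) = 0" "M $$ (2*n-1, 2*n-1) = 0" unfolding M_def using k ne by simp_all
    show "levi_proj n M = 0\<^sub>m (2*?q) (2*?q)" unfolding lM lk by (intro eq_matI) auto
  qed
  have "(u - ?I) * ((u - ?I) * (u - ?I)) = g * (M * ((?i * g) * (M * ((?i * g) * (M * ?i)))))"
    unfolding uM by (simp add: mat_dim_simps)
  also have "\<dots> = g * ((M * (M * M)) * ?i)" unfolding ig by (simp add: mat_dim_simps)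
  also have "\<dots> = 0\<^sub>m (2*n) (2*n)" unfolding MMM by (simp add: mat_dim_simps)
  finally show "(u - ?I) * ((u - ?I) * (u - ?I)) = 0\<^sub>m (2*n) (2*n)" .
qed

section \<open>The inverse square root of a unipotent element\<close>

lemma Tmat_cancel: "dim_row X = 2*n \<Longrightarrow> Tmat n * (Tmat n * X) = X"
  by (subst assoc_mult_mat_dim[symmetric]) (simp_all add: Tmat_Tmat one_mult_mat_dim)

text \<open>\<open>u^T J = J u^{-1}\<close> with \<open>u^{-1} = 1 - N + N^2\<close>, so transposing
  a polynomial in \<open>u\<close> replaces \<open>u\<close> by \<open>u^{-1}\<close>. The result
  for \<open>r\<close> is \<open>1 + N/2 - N^2/8\<close>, the truncated binomial series of
  \<open>u^{1/2}\<close>, which is the inverse of \<open>r\<close>.\<close>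

lemma inverse_square_root_Sp:
  assumes u: "is_Sp n u" and N: "N = u - 1\<^sub>m (2*n)" and N3: "N * (N * N) = 0\<^sub>m (2*n) (2*n)"
    and r: "r = 1\<^sub>m (2*n) + (-1/2) \<cdot>\<^sub>m N + (3/8) \<cdot>\<^sub>m (N * N)"
  shows "is_Sp n r"
proof -
  note [simp] = is_Sp_dim[OF u]
  let ?I = "1\<^sub>m (2*n) :: real mat" and ?J = "Jmat n"
  have Nd [simp]: "dim_row N = 2*n" "dim_col N = 2*n" unfolding N by auto
  have uN: "u = ?I + N" unfolding N by (intro eq_matI) auto
  have dr [simp]: "dim_row r = 2*n" "dim_col r = 2*n" unfolding r by auto
  define V where "V = ?I - N + N * N"
  have Vd [simp]: "dim_row V = 2*n" "dim_col V = 2*n" unfolding V_def by auto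
  have uV: "u * V = ?I"
  proof -
    have "u * V = ?I + N - (N + N * N) + (N * N + N * (N * N))"
      unfolding uN V_def by (simp add: mat_dim_simps)
    also have "\<dots> = ?I" unfolding N3 by (intro eq_matI) (auto simp del: index_mult_mat(1))
    finally show ?thesis .
  qed
  have NJ: "N\<^sup>T * ?J = ?J * (N * N - N)"
  proof -
    have "u\<^sup>T * ?J = u\<^sup>T * ?J * (u * V)" unfolding uV by (simp add: one_mult_mat_dim)
    also have "\<dots> = (u\<^sup>T * ?J * u) * V" by (simp add: mat_dim_simps)
    also have "\<dots> = ?J * V" using u unfolding is_Sp_def by simp
    finally have e: "?J + N\<^sup>T * ?J = ?J - ?J * N + ?J * (N * N)"
      unfolding uN V_def by (simp add: mat_dim_simps transpose_add_dim)
    show ?thesis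
    proof (rule eq_matI)
      fix i j assume "i < dim_row (?J * (N * N - N))" "j < dim_col (?J * (N * N - N))"
      with arg_cong[OF e, of "\<lambda>X. X $$ (i, j)"]
      show "(N\<^sup>T * ?J) $$ (i, j) = (?J * (N * N - N)) $$ (i, j)"
        by (simp add: mat_dim_simps del: index_mult_mat(1))
    qed auto
  qed
  have N4: "N * (N * (N * N)) = 0\<^sub>m (2*n) (2*n)" unfolding N3 by (simp add: mat_dim_simps)
  have NNJ: "N\<^sup>T * (N\<^sup>T * ?J) = ?J * (N * N)"
  proof -
    have "N\<^sup>T * (N\<^sup>T * ?J) = N\<^sup>T * (?J * (N * N - N))" unfolding NJ ..
    also have "\<dots> = (N\<^sup>T * ?J) * (N * N - N)" by (rule assoc_mult_mat_dim[symmetric]) auto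
    also have "\<dots> = (?J * (N * N - N)) * (N * N - N)" unfolding NJ ..
    also have "\<dots> = ?J * (N * (N * (N * N)) - N * (N * N) - (N * (N * N) - N * N))"
      by (simp add: mat_dim_simps)
    also have "\<dots> = ?J * (N * N)" unfolding N4 N3 
      by (rule arg_cong[of _ _ "\<lambda>X. ?J * X"]) (intro eq_matI; simp del: index_mult_mat(1))
    finally show ?thesis .
  qed
  have ts: "(c \<cdot>\<^sub>m X)\<^sup>T = c \<cdot>\<^sub>m X\<^sup>T" for c :: real and X by (intro eq_matI) auto
  have rJ: "r\<^sup>T * ?J = ?J * (?I + (1/2) \<cdot>\<^sub>m N + (-1/8) \<cdot>\<^sub>m (N * N))"
  proof -
    have "r\<^sup>T * ?J = ?J + (-1/2) \<cdot>\<^sub>m (N\<^sup>T * ?J) + (3/8) \<cdot>\<^sub>m (N\<^sup>T * (N\<^sup>T * ?J))"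
      unfolding r by (simp add: mat_dim_simps transpose_add_dim ts)
    also have "\<dots> = ?J + (-1/2) \<cdot>\<^sub>m (?J * (N * N) - ?J * N) + (3/8) \<cdot>\<^sub>m (?J * (N * N))"
      unfolding NNJ unfolding NJ by (simp add: mat_dim_simps)
    also have "\<dots> = ?J + (1/2) \<cdot>\<^sub>m (?J * N) + (-1/8) \<cdot>\<^sub>m (?J * (N * N))"
      by (intro eq_matI) (auto simp: algebra_simps simp del: index_mult_mat(1))
    also have "\<dots> = ?J * (?I + (1/2) \<cdot>\<^sub>m N + (-1/8) \<cdot>\<^sub>m (N * N))" by (simp add: mat_dim_simps)
    finally show ?thesis .
  qed
  have "(?I + (1/2) \<cdot>\<^sub>m N + (-1/8) \<cdot>\<^sub>m (N * N)) * r = ?I"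
  proof -
    have "(?I + (1/2) \<cdot>\<^sub>m N + (-1/8) \<cdot>\<^sub>m (N * N)) * r
      = (?I + (1/2) \<cdot>\<^sub>m N + (-1/8) \<cdot>\<^sub>m (N * N))
        + (-1/2) \<cdot>\<^sub>m (N + (1/2) \<cdot>\<^sub>m (N * N) + (-1/8) \<cdot>\<^sub>m (N * (N * N)))
        + (3/8) \<cdot>\<^sub>m (N * N + (1/2) \<cdot>\<^sub>m (N * (N * N)) + (-1/8) \<cdot>\<^sub>m (N * (N * (N * N))))"
      unfolding r by (simp add: mat_dim_simps)
    also have "\<dots> = ?I" unfolding N3 N4 by (intro eq_matI) (auto simp: algebra_simps simp del: index_mult_mat(1))
    finally show ?thesis .
  qed
  moreover have "r\<^sup>T * ?J * r = ?J * ((?I + (1/2) \<cdot>\<^sub>m N + (-1/8) \<cdot>\<^sub>m (N * N)) * r)"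
    unfolding rJ by (rule assoc_mult_mat_dim) auto
  ultimately show ?thesis unfolding is_Sp_def by (auto intro: carrier_matI simp: one_mult_mat_dim)
qed

text \<open>\<open>\<tau>(u) \<gamma> = \<gamma> u\<close>, as both are
  \<open>\<gamma> \<tau>(\<gamma>) \<gamma>\<close>; the same holds for the polynomial
  \<open>r\<close> in \<open>u\<close>. Hence \<open>\<tau>(\<gamma> r) \<gamma> r =
  \<tau>(\<gamma>) \<gamma> r^2 = u r^2 = 1\<close>.\<close>

lemma inverse_square_root_involution:
  assumes \<gamma>: "\<gamma> \<in> carrier_mat (2*n) (2*n)" and u: "u = Tmat n * \<gamma> * Tmat n * \<gamma>"
    and N: "N = u - 1\<^sub>m (2*n)" and N3: "N * (N * N) = 0\<^sub>m (2*n) (2*n)"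
    and r: "r = 1\<^sub>m (2*n) + (-1/2) \<cdot>\<^sub>m N + (3/8) \<cdot>\<^sub>m (N * N)"
  shows "Tmat n * (\<gamma> * r) * Tmat n * (\<gamma> * r) = 1\<^sub>m (2*n)"
proof -
  let ?I = "1\<^sub>m (2*n) :: real mat" and ?T = "Tmat n"
  have [simp]: "dim_row \<gamma> = 2*n" "dim_col \<gamma> = 2*n" using \<gamma> by auto
  have ud [simp]: "dim_row u = 2*n" "dim_col u = 2*n" unfolding u by auto
  have Nd [simp]: "dim_row N = 2*n" "dim_col N = 2*n" unfolding N by auto
  have dr [simp]: "dim_row r = 2*n" "dim_col r = 2*n" unfolding r by auto
  have uN: "u = ?I + N" unfolding N by (intro eq_matI) auto
  have TN: "?T * (N * (?T * \<gamma>)) = \<gamma> * N"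
    unfolding N u by (simp add: mat_dim_simps Tmat_cancel)
  have TNN: "?T * (N * (N * (?T * \<gamma>))) = \<gamma> * (N * N)"
  proof -
    have "?T * (N * (N * (?T * \<gamma>))) = ?T * (N * (?T * (?T * (N * (?T * \<gamma>)))))" by (simp add: Tmat_cancel)
    also have "\<dots> = ?T * (N * (?T * (\<gamma> * N)))" unfolding TN ..
    also have "\<dots> = (?T * (N * (?T * \<gamma>))) * N" by (simp add: mat_dim_simps)
    also have "\<dots> = \<gamma> * (N * N)" unfolding TN by (simp add: mat_dim_simps)
    finally show ?thesis .
  qed
  have Tr: "?T * (r * (?T * \<gamma>)) = \<gamma> * r"
    unfolding r by (simp add: mat_dim_simps TN TNN Tmat_cancel)
  have N4: "N * (N * (N * N)) = 0\<^sub>m (2*n) (2*n)" unfolding N3 by (simp add: mat_dim_simps)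
  have "?T * (\<gamma> * r) * ?T * (\<gamma> * r) = ?T * (\<gamma> * (?T * (?T * (r * (?T * \<gamma>))))) * r"
    by (simp add: mat_dim_simps Tmat_cancel)
  also have "\<dots> = u * (r * r)" unfolding Tr u by (simp add: mat_dim_simps)
  also have "\<dots> = ?I"
  proof -
    have rr: "r * r = ?I - N + N * N"
    proof -
      have "r * r = ?I + (-1/2) \<cdot>\<^sub>m N + (3/8) \<cdot>\<^sub>m (N * N)
        + (-1/2) \<cdot>\<^sub>m (N + (-1/2) \<cdot>\<^sub>m (N * N) + (3/8) \<cdot>\<^sub>m (N * (N * N)))
        + (3/8) \<cdot>\<^sub>m (N * N + (-1/2) \<cdot>\<^sub>m (N * (N * N)) + (3/8) \<cdot>\<^sub>m (N * (N * (N * N))))"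
        unfolding r by (simp add: mat_dim_simps)
      also have "\<dots> = ?I - N + N * N" unfolding N3 N4 
        by (intro eq_matI) (auto simp: algebra_simps simp del: index_mult_mat(1))
      finally show ?thesis .
    qed
    have "u * (r * r) = ?I + N - (N + N * N) + (N * N + N * (N * N))"
      unfolding rr uN by (simp add: mat_dim_simps)
    also have "\<dots> = ?I" unfolding N3 by (intro eq_matI) (auto simp del: index_mult_mat(1))
    finally show ?thesis .
  qed
  finally show ?thesis .
qed

subsection \<open>Congruence subgroups\<close>

lemma Gamma_level_iff:
  "Gamma_level n N g \<longleftrightarrow> is_Sp n g \<and> (\<exists>X \<in> carrier_mat (2*n) (2*n). integral_mat X \<and> g = 1\<^sub>m (2*n) + real N \<cdot>\<^sub>m X)"
proof
  assume G: "Gamma_level n N g"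
  then have g: "is_Sp n g" and ex: "\<forall>i<2*n. \<forall>j<2*n. \<exists>k::int. g $$ (i,j) - (1\<^sub>m (2*n) :: real mat) $$ (i,j) = real N * of_int k"
    unfolding Gamma_level_def is_Sp_Z_def by auto
  define X where "X = mat (2*n) (2*n) (\<lambda>(i,j). real_of_int (SOME k. g $$ (i,j) - (1\<^sub>m (2*n) :: real mat) $$ (i,j) = real N * of_int k))"
  have Xc: "X \<in> carrier_mat (2*n) (2*n)" unfolding X_def by simp
  have Xi: "integral_mat X" unfolding X_def integral_mat_def by simp
  have "g $$ (i,j) - (1\<^sub>m (2*n) :: real mat) $$ (i,j) = real N * X $$ (i, j)" if "i < 2*n" "j < 2*n" for i j
    using someI_ex[of "\<lambda>k. g $$ (i,j) - (1\<^sub>m (2*n) :: real mat) $$ (i,j) = real N * of_int k"] ex that unfolding X_def by auto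
  then have "g $$ (i,j) = (1\<^sub>m (2*n) :: real mat) $$ (i,j) + real N * X $$ (i, j)" if "i < 2*n" "j < 2*n" for i j
    using that by (metis add_diff_cancel_left' diff_add_cancel add.commute)
  then have "g = 1\<^sub>m (2*n) + real N \<cdot>\<^sub>m X"
    using is_Sp_dim[OF g] Xc by (intro eq_matI) auto
  with g Xc Xi show "is_Sp n g \<and> (\<exists>X \<in> carrier_mat (2*n) (2*n). integral_mat X \<and> g = 1\<^sub>m (2*n) + real N \<cdot>\<^sub>m X)" by blast
next
  assume "is_Sp n g \<and> (\<exists>X \<in> carrier_mat (2*n) (2*n). integral_mat X \<and> g = 1\<^sub>m (2*n) + real N \<cdot>\<^sub>m X)"
  then obtain X where g: "is_Sp n g" and X: "X \<in> carrier_mat (2*n) (2*n)" "integral_mat X" "g = 1\<^sub>m (2*n) + real N \<cdot>\<^sub>m X" by blast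
  have d: "g $$ (i,j) - (1\<^sub>m (2*n) :: real mat) $$ (i,j) = real N * X $$ (i,j)" if "i < 2*n" "j < 2*n" for i j
    unfolding X(3) using X(1) that by simp
  have Xi: "X $$ (i,j) \<in> \<int>" if "i < 2*n" "j < 2*n" for i j using X(1,2) that unfolding integral_mat_def by auto
  have "g $$ (i,j) \<in> \<int>" if "i < 2*n" "j < 2*n" for i j
    unfolding X(3) using X(1) that Xi[OF that] by (auto intro!: Ints_add Ints_mult)
  moreover have "\<exists>k::int. g $$ (i,j) - (1\<^sub>m (2*n) :: real mat) $$ (i,j) = real N * of_int k" if "i < 2*n" "j < 2*n" for i j
    using d[OF that] Xi[OF that] by (auto elim!: Ints_cases)
  ultimately show "Gamma_level n N g" unfolding Gamma_level_def is_Sp_Z_def using g by blast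
qed

lemma integral_mat_add:
  "integral_mat X \<Longrightarrow> integral_mat Y \<Longrightarrow> dim_row X = dim_row Y \<Longrightarrow> dim_col X = dim_col Y \<Longrightarrow> integral_mat (X + Y)"
  unfolding integral_mat_def by auto

lemma integral_mat_smult: "c \<in> \<int> \<Longrightarrow> integral_mat X \<Longrightarrow> integral_mat (c \<cdot>\<^sub>m X)"
  unfolding integral_mat_def by auto

lemma integral_mat_uminus: "integral_mat X \<Longrightarrow> integral_mat (- X)"
  unfolding integral_mat_def by auto

lemma integral_mat_transpose: "integral_mat X \<Longrightarrow> integral_mat (X\<^sup>T)"
  unfolding integral_mat_def by auto

lemma integral_mat_Tmat: "integral_mat (Tmat n)"
  unfolding integral_mat_def by (auto simp: index_Tmat)

lemma integral_mat_Jmat: "integral_mat (Jmat n)"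
  unfolding integral_mat_def by (auto simp: index_Jmat)

text \<open>The mixed blocks of \<open>X\<close> cancel in \<open>X + TXT\<close> and the diagonal blocks double; this is the gain of a factor 2 in the level.\<close>

lemma twisted_square_level:
  assumes X: "X \<in> carrier_mat (2*n) (2*n)" "integral_mat X" and \<gamma>: "\<gamma> = 1\<^sub>m (2*n) + real (4*m) \<cdot>\<^sub>m X"
  shows "\<exists>Y \<in> carrier_mat (2*n) (2*n). integral_mat Y \<and> Tmat n * \<gamma> * Tmat n * \<gamma> = 1\<^sub>m (2*n) + real (8*m) \<cdot>\<^sub>m Y"
proof -
  let ?T = "Tmat n" and ?I = "1\<^sub>m (2*n) :: real mat"
  have [simp]: "dim_row X = 2*n" "dim_col X = 2*n" using X by auto
  define E where "E = mat (2*n) (2*n) (\<lambda>(i,j). if (i < n) = (j < n) then X $$ (i,j) else 0)"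
  have [simp]: "dim_row E = 2*n" "dim_col E = 2*n" unfolding E_def by auto
  have Ei: "integral_mat E" using X(2) unfolding E_def integral_mat_def by auto
  define S where "S = ?T * (X * ?T)"
  have [simp]: "dim_row S = 2*n" "dim_col S = 2*n" unfolding S_def by auto
  have Si: "integral_mat S" unfolding S_def by (intro integral_mat_mult integral_mat_Tmat X) auto
  have SE: "S + X = 2 \<cdot>\<^sub>m E"
  proof -
    have "S = tau_g n X" unfolding S_def tau_g_eq[OF X(1)] by (simp add: mat_dim_simps)
    then show ?thesis unfolding tau_g_def blkA_def blkB_def blkC_def blkD_def E_def
      by (intro eq_matI) auto
  qed
  \<comment> \<open>Here \<open>\<tau>(\<gamma>) \<gamma> = 1 + 4m (S + X) + 16 m^2 S X\<close> and
    \<open>S + X = 2 E\<close>; \<open>8m\<close> is then taken out.\<close>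
  define Y where "Y = E + real (2*m) \<cdot>\<^sub>m (S * X)"
  have Yc: "Y \<in> carrier_mat (2*n) (2*n)" unfolding Y_def by (auto intro: carrier_matI)
  have Yi: "integral_mat Y" unfolding Y_def 
    by (intro integral_mat_add integral_mat_smult integral_mat_mult Ei Si X) auto
  have "?T * \<gamma> * ?T * \<gamma> = ?I + real (4*m) \<cdot>\<^sub>m S + real (4*m) \<cdot>\<^sub>m (X + real (4*m) \<cdot>\<^sub>m (S * X))"
    unfolding \<gamma> S_def by (simp add: mat_dim_simps Tmat_Tmat Tmat_cancel)
  also have "\<dots> = ?I + real (4*m) \<cdot>\<^sub>m (S + X) + real (16*m*m) \<cdot>\<^sub>m (S * X)"
    by (intro eq_matI) (auto simp: algebra_simps simp del: index_mult_mat(1))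
  also have "\<dots> = ?I + real (8*m) \<cdot>\<^sub>m Y" unfolding SE Y_def
    by (intro eq_matI) (auto simp: algebra_simps simp del: index_mult_mat(1))
  finally show ?thesis using Yc Yi by blast
qed

text \<open>Level \<open>8m\<close> for \<open>u\<close> is what is used: \<open>N/2 = 4m Y\<close>
  and \<open>3 N^2 / 8 = 24 m^2 Y^2 = 4m (6m Y^2)\<close>.\<close>

lemma inverse_square_root_level:
  assumes \<gamma>: "Gamma_level n (4*m) \<gamma>" and rSp: "is_Sp n r"
    and Y: "Y \<in> carrier_mat (2*n) (2*n)" "integral_mat Y" and N: "N = real (8*m) \<cdot>\<^sub>m Y"
    and r: "r = 1\<^sub>m (2*n) + (-1/2) \<cdot>\<^sub>m N + (3/8) \<cdot>\<^sub>m (N * N)"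
  shows "Gamma_level n (4*m) (\<gamma> * r)"
proof -
  from \<gamma> obtain X where \<gamma>Sp: "is_Sp n \<gamma>" and X: "X \<in> carrier_mat (2*n) (2*n)" "integral_mat X" and \<gamma>X: "\<gamma> = 1\<^sub>m (2*n) + real (4*m) \<cdot>\<^sub>m X"
    unfolding Gamma_level_iff by auto
  have [simp]: "dim_row X = 2*n" "dim_col X = 2*n" "dim_row Y = 2*n" "dim_col Y = 2*n" using X Y by auto
  note [simp] = is_Sp_dim[OF \<gamma>Sp]
  have \<gamma>i: "integral_mat \<gamma>" unfolding \<gamma>X
    by (intro integral_mat_add integral_mat_one integral_mat_smult X) auto
  define R where "R = - Y + real (6*m) \<cdot>\<^sub>m (Y * Y)"
  have [simp]: "dim_row R = 2*n" "dim_col R = 2*n" unfolding R_def by auto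
  have Ri: "integral_mat R" unfolding R_def
    by (intro integral_mat_add integral_mat_uminus integral_mat_smult integral_mat_mult Y) auto
  have rR: "r = 1\<^sub>m (2*n) + real (4*m) \<cdot>\<^sub>m R"
    unfolding r N R_def by (simp add: mat_dim_simps, intro eq_matI) (auto simp: algebra_simps simp del: index_mult_mat(1))
  have "\<gamma> * r = \<gamma> + real (4*m) \<cdot>\<^sub>m (\<gamma> * R)" unfolding rR by (simp add: mat_dim_simps)
  also have "\<dots> = 1\<^sub>m (2*n) + real (4*m) \<cdot>\<^sub>m (X + \<gamma> * R)"
    by (subst (1) \<gamma>X, intro eq_matI) (auto simp: algebra_simps simp del: index_mult_mat(1))
  finally have e: "\<gamma> * r = 1\<^sub>m (2*n) + real (4*m) \<cdot>\<^sub>m (X + \<gamma> * R)" .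
  have "integral_mat (X + \<gamma> * R)" by (intro integral_mat_add integral_mat_mult X \<gamma>i Ri) auto
  moreover have "X + \<gamma> * R \<in> carrier_mat (2*n) (2*n)" by (auto intro: carrier_matI)
  ultimately show ?thesis unfolding Gamma_level_iff using is_Sp_mult[OF \<gamma>Sp rSp] e by blast
qed

section \<open>Compatibility with tau, and the conclusion\<close>

text \<open>This is \<open>\<tau>(g W) = \<tau>(g) \<tau>(W)\<close> with its automorphy factor. As
  \<open>g\<close> is real, the equation may be conjugated, and \<open>T\<close> exchanges the
  conjugate of \<open>(W; 1)\<close> with \<open>(\<tau>(W); 1)\<close> up to sign.\<close>

lemma tau_lagrangian:
  assumes g: "g \<in> carrier_mat (2*n) (2*n)" and c: "W \<in> carrier_mat n n" "V \<in> carrier_mat n n" "K \<in> carrier_mat n n"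
    and e: "cplx g * (W @\<^sub>r 1\<^sub>m n) = (V @\<^sub>r 1\<^sub>m n) * K"
  shows "cplx (Tmat n * g * Tmat n) * (tau_pt W @\<^sub>r 1\<^sub>m n) = (tau_pt V @\<^sub>r 1\<^sub>m n) * conj_mat K"
proof -
  have [simp]: "dim_row g = 2*n" "dim_col g = 2*n" "dim_row K = n" "dim_col K = n" using g c by auto
  have Pd [simp]: "dim_row (X @\<^sub>r 1\<^sub>m n) = 2*n" "dim_col (X @\<^sub>r 1\<^sub>m n) = n" if "X \<in> carrier_mat n n" for X :: "complex mat"
    using that unfolding append_rows_def by auto
  have TP: "cplx (Tmat n) * (tau_pt X @\<^sub>r 1\<^sub>m n) = - (conj_mat X @\<^sub>r 1\<^sub>m n)"
    "cplx (Tmat n) * (conj_mat X @\<^sub>r 1\<^sub>m n) = - (tau_pt X @\<^sub>r 1\<^sub>m n)" if X: "X \<in> carrier_mat n n" for X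
  proof -
    have T: "cplx (Tmat n) = four_block_mat (1\<^sub>m n) (0\<^sub>m n n) (0\<^sub>m n n) (- 1\<^sub>m n)"
      unfolding Tmat_def by (intro eq_matI) auto
    have "cplx (Tmat n) * (Y @\<^sub>r 1\<^sub>m n) = Y @\<^sub>r (- 1\<^sub>m n)" if "Y \<in> carrier_mat n n" for Y
      unfolding T by (subst four_block_mult_append_rows[of _ n n _ n _ n]) (use that in \<open>auto simp: mat_dim_simps\<close>)
    moreover have "Y @\<^sub>r (- 1\<^sub>m n) = - ((- Y) @\<^sub>r 1\<^sub>m n)" if "Y \<in> carrier_mat n n" for Y :: "complex mat"
      using that by (subst uminus_append_rows[of _ n n _ n]) auto
    ultimately show "cplx (Tmat n) * (tau_pt X @\<^sub>r 1\<^sub>m n) = - (conj_mat X @\<^sub>r 1\<^sub>m n)"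
      "cplx (Tmat n) * (conj_mat X @\<^sub>r 1\<^sub>m n) = - (tau_pt X @\<^sub>r 1\<^sub>m n)"
      using X unfolding tau_pt_eq by simp_all
  qed
  have t: "tau_pt W \<in> carrier_mat n n" "tau_pt V \<in> carrier_mat n n" "conj_mat W \<in> carrier_mat n n" "conj_mat V \<in> carrier_mat n n"
    using c unfolding tau_pt_def by auto
  have VK: "(V @\<^sub>r 1\<^sub>m n) * K = (V * K) @\<^sub>r K" using append_rows_mult[OF c(2) one_carrier_mat c(3)] c by simp
  have "cplx g * (conj_mat W @\<^sub>r 1\<^sub>m n) = conj_mat (V * K) @\<^sub>r conj_mat K"
    by (rule conj_lagrangian[OF g c(1) _ c(3)]) (use c e VK in auto)
  also have "\<dots> = (conj_mat V @\<^sub>r 1\<^sub>m n) * conj_mat K"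
    using append_rows_mult[OF t(4) one_carrier_mat, of "conj_mat K" n] c cnj_hom.mat_hom_mult[OF c(2,3)] by simp
  finally have gc: "cplx g * (conj_mat W @\<^sub>r 1\<^sub>m n) = (conj_mat V @\<^sub>r 1\<^sub>m n) * conj_mat K" .
  have "cplx (Tmat n * g * Tmat n) * (tau_pt W @\<^sub>r 1\<^sub>m n) = cplx (Tmat n) * (cplx g * (cplx (Tmat n) * (tau_pt W @\<^sub>r 1\<^sub>m n)))"
    using t by (simp add: cplx_mult mat_dim_simps)
  also have "\<dots> = - (cplx (Tmat n) * (cplx g * (conj_mat W @\<^sub>r 1\<^sub>m n)))"
    unfolding TP(1)[OF c(1)] using t by (simp add: mat_dim_simps)
  also have "\<dots> = - ((cplx (Tmat n) * (conj_mat V @\<^sub>r 1\<^sub>m n)) * conj_mat K)"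
    unfolding gc using t by (simp add: mat_dim_simps)
  also have "\<dots> = (tau_pt V @\<^sub>r 1\<^sub>m n) * conj_mat K"
    unfolding TP(2)[OF c(2)] using t by simp
  finally show ?thesis .
qed

lemma tau_pt_tau_pt [simp]: "tau_pt (tau_pt Z) = Z"
  unfolding tau_pt_def by (intro eq_matI) auto

theorem theorem9p2:
  fixes n m :: nat and g \<gamma> :: "real mat"
  assumes n: "n \<ge> 2" and m: "m \<ge> 1"
    and g: "is_Sp_Q n g"
    and \<gamma>: "Gamma_level n (4*m) \<gamma>"
    and nonempty: "bc_fixed n g \<gamma> \<noteq> {}"
  shows "\<forall>Z \<in> bc_fixed n g \<gamma>.
           in_satake_closure n (\<Union>\<gamma>'\<in>{\<gamma>'. Gamma_level n (4*m) \<gamma>'}. fixed_set n \<gamma>') g Z"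
proof
  fix Z assume "Z \<in> bc_fixed n g \<gamma>"
  then have Z: "siegel (n-1) Z" and stab0: "stab_bc n (minv (tau_g n g) * (\<gamma> * g))"
    and act0: "tau_pt Z = sp_act (n-1) (levi_proj n (minv (tau_g n g) * (\<gamma> * g))) Z"
    unfolding bc_fixed_def bpt_eq_def Let_def by auto
  let ?T = "Tmat n" and ?i = "sp_inv n g" and ?I = "1\<^sub>m (2*n) :: real mat" and ?q = "n - 1"
  have n1: "n \<ge> 1" using n by simp
  have gSp: "is_Sp n g" and gQ: "\<And>i j. i < 2*n \<Longrightarrow> j < 2*n \<Longrightarrow> g $$ (i,j) \<in> \<rat>"
    using g unfolding is_Sp_Q_def by auto
  from \<gamma> obtain X where \<gamma>Sp: "is_Sp n \<gamma>" and X: "X \<in> carrier_mat (2*n) (2*n)" "integral_mat X"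
    and \<gamma>X: "\<gamma> = ?I + real (4*m) \<cdot>\<^sub>m X" unfolding Gamma_level_iff by auto
  note [simp] = is_Sp_dim[OF gSp] is_Sp_dim[OF \<gamma>Sp]
  note gc = is_Sp_carrier[OF gSp] and \<gamma>c = is_Sp_carrier[OF \<gamma>Sp] and ic = sp_inv_carrier[OF is_Sp_carrier[OF gSp]]
  have gi: "g * ?i = ?I" and ig: "?i * g = ?I" using sp_inv_right[OF gSp] sp_inv_left[OF gSp] by auto
  have ig': "?i * (g * Y) = Y" if "dim_row Y = 2*n" for Y
    using that ig by (subst assoc_mult_mat_dim[symmetric]) (simp_all add: one_mult_mat_dim)
  have gi': "g * (?i * Y) = Y" if "dim_row Y = 2*n" for Y
    using that gi by (subst assoc_mult_mat_dim[symmetric]) (simp_all add: one_mult_mat_dim)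
  have minv_tau: "minv (tau_g n g) = ?T * ?i * ?T"
    unfolding tau_g_eq[OF gc]
    by (rule minv_eqI[of _ "2*n"]) (auto intro!: carrier_matI simp: mat_dim_simps Tmat_cancel gi' Tmat_Tmat)
  \<comment> \<open>This is \<open>\<tau>(g)^{-1} \<gamma> g\<close>: in the coordinates that
    \<open>g\<close> puts on \<open>F\<close>, the condition \<open>\<gamma> x = \<tau>(x)\<close>
    reads \<open>h Z = \<tau>(Z)\<close> on the standard component.\<close>
  define h where "h = ?T * (?i * (?T * (\<gamma> * g)))"
  have h0: "minv (tau_g n g) * (\<gamma> * g) = h" unfolding minv_tau h_def by (simp add: mat_dim_simps)
  have hSp: "is_Sp n h"
  proof -
    have "h = (?T * ?i * ?T) * (\<gamma> * g)" unfolding h_def by (simp add: mat_dim_simps)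
    then show ?thesis using is_Sp_mult[OF is_Sp_Tconj[OF is_Sp_sp_inv[OF gSp]] is_Sp_mult[OF \<gamma>Sp gSp]] by simp
  qed
  note [simp] = is_Sp_dim[OF hSp]
  note stab = stab0[unfolded h0] and act = act0[unfolded h0]
  note hpar = Sp_stab_parabolic[OF n1 hSp stab]
  note lSp = levi_proj_Sp[OF n1 hSp hpar(1)]
  have Zc: "Z \<in> carrier_mat ?q ?q" using Z unfolding siegel_def by simp
  have tZc: "tau_pt Z \<in> carrier_mat ?q ?q" using Zc unfolding tau_pt_def by simp
  obtain K1 where K1: "K1 \<in> carrier_mat ?q ?q"
    and lag: "cplx (levi_proj n h) * (Z @\<^sub>r 1\<^sub>m ?q) = (tau_pt Z @\<^sub>r 1\<^sub>m ?q) * K1"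
    using sp_act_lagrangian[OF lSp Z] unfolding act[symmetric] by metis
  define a where "a = h $$ (n-1, n-1)"
  have ne: "n - 1 < 2*n" "2*n - 1 < 2*n" "n - 1 < n" "\<not> 2*n - 1 < n" using n by auto
  have Tn: "?T $$ (n-1, n-1) = 1" "?T $$ (2*n-1, 2*n-1) = -1" using ne by (simp_all add: index_Tmat)
  note Tpar = parabolic_Tmat[OF n1]
  note Th = parabolic_mult[OF n1 Tpar hpar(1)]
  note ThT = parabolic_mult[OF n1 Th(1) Tpar]
  note ThTh = parabolic_mult[OF n1 ThT(1) hpar(1)]
  \<comment> \<open>From \<open>(T \<gamma>) g = g (T h)\<close>, the column of \<open>g\<close>
    with index \<open>n - 1\<close> is an eigenvector of \<open>T \<gamma>\<close> with eigenvalue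
    \<open>a\<close>. The column is rational, and \<open>T \<gamma>\<close> and its inverse are
    integral.\<close>
  have aa: "a * a = 1"
  proof -
    have V: "?T * \<gamma> \<in> carrier_mat (2*n) (2*n)" "integral_mat (?T * \<gamma>)"
      "sp_inv n \<gamma> * ?T \<in> carrier_mat (2*n) (2*n)" "integral_mat (sp_inv n \<gamma> * ?T)"
    proof -
      have "integral_mat \<gamma>" unfolding \<gamma>X using X
        by (intro integral_mat_add integral_mat_one integral_mat_smult) auto
      then show "integral_mat (?T * \<gamma>)" "integral_mat (sp_inv n \<gamma> * ?T)" unfolding sp_inv_def
        by (auto intro!: integral_mat_mult integral_mat_Tmat integral_mat_Jmat integral_mat_uminus integral_mat_transpose)
    qed (auto intro: carrier_matI)
    have inv: "sp_inv n \<gamma> * ?T * (?T * \<gamma>) = ?I"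
      using sp_inv_left[OF \<gamma>Sp] by (simp add: mat_dim_simps Tmat_cancel)
    define v where "v = col g (n-1)"
    have vc: "v \<in> carrier_vec (2*n)" unfolding v_def by (simp add: carrier_vecI)
    have vQ: "v $ i \<in> \<rat>" if "i < 2*n" for i unfolding v_def using gQ[OF that ne(1)] that ne by simp
    have v0: "v \<noteq> 0\<^sub>v (2*n)"
    proof
      assume z: "v = 0\<^sub>v (2*n)"
      have "(?i * g) $$ (n-1, n-1) = row ?i (n-1) \<bullet> v" unfolding v_def using ne by simp
      also have "\<dots> = 0" unfolding z by (rule scalar_prod_right_zero) (simp add: carrier_vecI)
      finally show False unfolding ig using ne by simp
    qed
    have "(?T * \<gamma>) *\<^sub>v v = a \<cdot>\<^sub>v v"
    proof (rule eq_vecI)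
      fix i assume "i < dim_vec (a \<cdot>\<^sub>v v)"
      then have i: "i < 2*n" unfolding v_def by simp
      have "((?T * \<gamma>) *\<^sub>v v) $ i = ((?T * \<gamma>) * g) $$ (i, n-1)" unfolding v_def using i ne by simp
      also have "(?T * \<gamma>) * g = g * (?T * h)" unfolding h_def by (simp add: mat_dim_simps Tmat_cancel gi')
      also have "(g * (?T * h)) $$ (i, n-1) = (\<Sum>k<2*n. g $$ (i, k) * (?T * h) $$ (k, n-1))"
        using i ne by (subst index_mult_mat(1)) (auto simp: scalar_prod_def atLeast0LessThan simp del: index_mult_mat(1))
      also have "\<dots> = g $$ (i, n-1) * (?T * h) $$ (n-1, n-1)"
        using ne parabolicD(4)[OF Th(1)] by (subst sum.remove[of _ "n-1"]) (auto simp del: index_mult_mat(1))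
      also have "\<dots> = (a \<cdot>\<^sub>v v) $ i" unfolding Th(3) Tn a_def v_def using i ne by simp
      finally show "((?T * \<gamma>) *\<^sub>v v) $ i = (a \<cdot>\<^sub>v v) $ i" .
    qed (simp add: v_def)
    from integral_eigenvalue_unit[OF V inv vc vQ v0 this] have "\<bar>a\<bar> = 1" .
    then show ?thesis by (auto simp: abs_if split: if_splits)
  qed
  define u where "u = ?T * \<gamma> * ?T * \<gamma>"
  have uSp: "is_Sp n u" unfolding u_def by (rule is_Sp_mult[OF is_Sp_Tconj[OF \<gamma>Sp] \<gamma>Sp])
  note [simp] = is_Sp_dim[OF uSp]
  obtain Y where Y: "Y \<in> carrier_mat (2*n) (2*n)" "integral_mat Y" and uY: "u = ?I + real (8*m) \<cdot>\<^sub>m Y"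
    using twisted_square_level[OF X \<gamma>X] unfolding u_def by blast
  have [simp]: "dim_row Y = 2*n" "dim_col Y = 2*n" using Y by auto
  define k where "k = ?T * h * ?T * h"
  \<comment> \<open>\<open>\<tau>(h) h\<close> is the element \<open>u\<close> seen in the
    coordinates given by \<open>g\<close>.\<close>
  have kd: "k = ?i * u * g" unfolding k_def h_def u_def by (simp add: mat_dim_simps Tmat_cancel gi')
  have k1: "k $$ (n-1, n-1) = 1" unfolding k_def ThTh(3) ThT(3) Th(3) Tn using aa unfolding a_def by simp
  have k2: "k $$ (2*n-1, 2*n-1) = 1"
  proof -
    let ?d = "h $$ (2*n-1, 2*n-1)"
    have "k $$ (2*n-1, 2*n-1) = ?d * ?d" unfolding k_def ThTh(4) ThT(4) Th(4) Tn by simp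
    also have "\<dots> = (a * a) * (?d * ?d)" unfolding aa by simp
    also have "\<dots> = (a * ?d) * (a * ?d)" by simp
    also have "\<dots> = 1" using hpar(2) unfolding a_def by simp
    finally show ?thesis .
  qed
  have levik: "levi_proj n k = Tmat ?q * levi_proj n h * Tmat ?q * levi_proj n h"
    unfolding k_def ThTh(2) ThT(2) Th(2) levi_proj_Tmat[OF n1] ..
  have Pd: "dim_row (A @\<^sub>r 1\<^sub>m ?q) = 2*?q" "dim_col (A @\<^sub>r 1\<^sub>m ?q) = ?q" if "A \<in> carrier_mat ?q ?q" for A :: "complex mat"
    using that unfolding append_rows_def by auto
  \<comment> \<open>On the Levi quotient \<open>h\<close> sends \<open>Z\<close> to
    \<open>\<tau>(Z)\<close> and \<open>\<tau>(h)\<close> sends it back; the automorphy factors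
    multiply.\<close>
  have lagk: "cplx (levi_proj n k) * (Z @\<^sub>r 1\<^sub>m ?q) = (Z @\<^sub>r 1\<^sub>m ?q) * (conj_mat K1 * K1)"
  proof -
    let ?L = "levi_proj n h"
    have "cplx (levi_proj n k) * (Z @\<^sub>r 1\<^sub>m ?q) = cplx (Tmat ?q * ?L * Tmat ?q) * (cplx ?L * (Z @\<^sub>r 1\<^sub>m ?q))"
      unfolding levik using Pd[OF Zc] by (simp add: cplx_mult mat_dim_simps)
    also have "\<dots> = (cplx (Tmat ?q * ?L * Tmat ?q) * (tau_pt Z @\<^sub>r 1\<^sub>m ?q)) * K1"
      unfolding lag using Pd[OF tZc] K1 by (simp add: assoc_mult_mat_dim)
    also have "\<dots> = ((Z @\<^sub>r 1\<^sub>m ?q) * conj_mat K1) * K1"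
      using tau_lagrangian[OF is_Sp_carrier[OF lSp] Zc tZc K1 lag] by simp
    also have "\<dots> = (Z @\<^sub>r 1\<^sub>m ?q) * (conj_mat K1 * K1)"
      using Pd[OF Zc] K1 by (simp add: assoc_mult_mat_dim)
    finally show ?thesis .
  qed
  have KK: "conj_mat K1 * K1 \<in> carrier_mat ?q ?q" using K1 by auto
  have kpar: "parabolic n k" unfolding k_def by (rule ThTh(1))
  note uni = boundary_isotropy_unipotent[OF n1 m gSp uSp Y uY kd kpar k1 k2 Z KK lagk]
  define N where "N = u - ?I"
  have [simp]: "dim_row N = 2*n" "dim_col N = 2*n" unfolding N_def by auto
  have N3: "N * (N * N) = 0\<^sub>m (2*n) (2*n)" unfolding N_def by (rule uni(2))
  have NY: "N = real (8*m) \<cdot>\<^sub>m Y" unfolding N_def uY by (intro eq_matI) auto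
  define r where "r = ?I + (-1/2) \<cdot>\<^sub>m N + (3/8) \<cdot>\<^sub>m (N * N)"
  have rSp: "is_Sp n r" by (rule inverse_square_root_Sp[OF uSp N_def N3 r_def])
  note [simp] = is_Sp_dim[OF rSp]
  define \<gamma>' where "\<gamma>' = \<gamma> * r"
  have \<gamma>': "Gamma_level n (4*m) \<gamma>'" unfolding \<gamma>'_def
    by (rule inverse_square_root_level[OF \<gamma> rSp Y NY r_def])
  then have \<gamma>'Sp: "is_Sp n \<gamma>'" unfolding Gamma_level_iff by simp
  note [simp] = is_Sp_dim[OF \<gamma>'Sp]
  have invol: "?T * (\<gamma>' * (?T * \<gamma>')) = ?I"
    using inverse_square_root_involution[OF \<gamma>c u_def N_def N3 r_def] unfolding \<gamma>'_def by (simp add: mat_dim_simps)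
  define h' where "h' = ?T * (?i * (?T * (\<gamma>' * g)))"
  have h'Sp: "is_Sp n h'"
  proof -
    have "h' = (?T * ?i * ?T) * (\<gamma>' * g)" unfolding h'_def by (simp add: mat_dim_simps)
    then show ?thesis using is_Sp_mult[OF is_Sp_Tconj[OF is_Sp_sp_inv[OF gSp]] is_Sp_mult[OF \<gamma>'Sp gSp]] by simp
  qed
  note [simp] = is_Sp_dim[OF h'Sp]
  have h'inv: "?T * h' * ?T * h' = ?I"
  proof -
    have "?T * h' * ?T * h' = ?i * ((?T * (\<gamma>' * (?T * \<gamma>'))) * g)"
      unfolding h'_def by (simp add: mat_dim_simps Tmat_cancel gi')
    then show ?thesis unfolding invol using ig by (simp add: one_mult_mat_dim)
  qed
  define M where "M = k + (-1) \<cdot>\<^sub>m ?I"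
  have kdim [simp]: "dim_row k = 2*n" "dim_col k = 2*n" using parabolicD[OF kpar] by auto
  have [simp]: "dim_row M = 2*n" "dim_col M = 2*n" unfolding M_def by auto
  have Mpar: "parabolic n M" unfolding M_def by (intro parabolic_add kpar parabolic_smult parabolic_one n1)
  have NM: "N * g = g * M"
  proof -
    have "g * M = u * g - g" unfolding M_def kd 
      by (simp add: mat_dim_simps gi') (intro eq_matI; simp del: index_mult_mat(1))
    then show ?thesis unfolding N_def by (simp add: mat_dim_simps)
  qed
  \<comment> \<open>\<open>\<rho>\<close> is \<open>g^{-1} r g\<close>, the correction in the
    coordinates given by \<open>g\<close>. As a polynomial in \<open>M\<close>, whose Levi part is
    0, it is \<open>parabolic\<close> and acts trivially on \<open>F\<close>.\<close>
  define \<rho> where "\<rho> = ?I + (-1/2) \<cdot>\<^sub>m M + (3/8) \<cdot>\<^sub>m (M * M)"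
  have [simp]: "dim_row \<rho> = 2*n" "dim_col \<rho> = 2*n" unfolding \<rho>_def by auto
  have rg: "r * g = g * \<rho>"
  proof -
    have "N * (N * g) = g * (M * M)"
    proof -
      have "N * (N * g) = (N * g) * M" unfolding NM by (simp add: mat_dim_simps flip: NM)
      then show ?thesis unfolding NM by (simp add: mat_dim_simps)
    qed
    then show ?thesis unfolding r_def \<rho>_def using NM by (simp add: mat_dim_simps)
  qed
  have h'h: "h' = h * \<rho>" unfolding h'_def h_def \<gamma>'_def using rg by (simp add: mat_dim_simps)
  have \<rho>par: "parabolic n \<rho>" unfolding \<rho>_def
    by (intro parabolic_add parabolic_smult parabolic_one parabolic_mult(1) Mpar n1)
  have lM: "levi_proj n M = 0\<^sub>m (2*?q) (2*?q)"
    unfolding M_def using parabolicD(1)[OF kpar] uni(1)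
    by (subst levi_proj_add) (auto simp: levi_proj_smult levi_proj_one[OF n1] intro!: eq_matI)
  have l\<rho>: "levi_proj n \<rho> = 1\<^sub>m (2*?q)"
  proof -
    have c: "M \<in> carrier_mat (2*n) (2*n)" "M * M \<in> carrier_mat (2*n) (2*n)" by (auto intro: carrier_matI)
    have "levi_proj n \<rho> = 1\<^sub>m (2*?q) + (-1/2) \<cdot>\<^sub>m levi_proj n M + (3/8) \<cdot>\<^sub>m (levi_proj n M * levi_proj n M)"
      unfolding \<rho>_def using c
      by (simp add: levi_proj_add levi_proj_smult levi_proj_one[OF n1] parabolic_mult(2)[OF n1 Mpar Mpar])
    then show ?thesis unfolding lM by (simp add: mat_dim_simps)
  qed
  note h'par = parabolic_mult[OF n1 hpar(1) \<rho>par, folded h'h]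
  have stab': "stab_bc n h'" using parabolicD(4)[OF h'par(1)] unfolding stab_bc_def by blast
  \<comment> \<open>The corrected element therefore sends \<open>Z\<close> to
    \<open>\<tau>(Z)\<close> with the same factor \<open>K1\<close>.\<close>
  have lh': "levi_proj n h' = levi_proj n h" unfolding h'par(2) l\<rho> by (simp add: one_mult_mat_dim)
  have q: "n = Suc ?q" using n by simp
  show "in_satake_closure n (\<Union>\<gamma>'\<in>{\<gamma>'. Gamma_level n (4*m) \<gamma>'}. fixed_set n \<gamma>') g Z"
    unfolding in_satake_closure_def
  proof (intro allI impI)
    fix \<epsilon> t :: real assume \<epsilon>: "\<epsilon> > 0"
    obtain W M' where W: "siegel n W" and WZ: "\<And>i j. i < ?q \<Longrightarrow> j < ?q \<Longrightarrow> W $$ (i, j) = Z $$ (i, j)"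
      and ht: "height n W > t" and M': "M' \<in> carrier_mat n n"
      and hW: "cplx h' * (W @\<^sub>r 1\<^sub>m n) = (tau_pt W @\<^sub>r 1\<^sub>m n) * M'"
      using boundary_fixed_point[OF q h'Sp h'inv stab' Z K1 lag[folded lh'], of t] by blast
    have Wc: "W \<in> carrier_mat n n" using W unfolding siegel_def by simp
    define V where "V = sp_act n g W"
    obtain K where K: "K \<in> carrier_mat n n" "minv K \<in> carrier_mat n n" "K * minv K = 1\<^sub>m n"
      and gW: "cplx g * (W @\<^sub>r 1\<^sub>m n) = (V @\<^sub>r 1\<^sub>m n) * K" and V: "siegel n V"
      using sp_act_lagrangian[OF gSp W] unfolding V_def by metis
    have Vc: "V \<in> carrier_mat n n" using V unfolding siegel_def by simp
    have tc: "tau_pt W \<in> carrier_mat n n" "tau_pt V \<in> carrier_mat n n" using Wc Vc unfolding tau_pt_def by auto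
    have Pn: "dim_row (A @\<^sub>r 1\<^sub>m n) = 2*n" "dim_col (A @\<^sub>r 1\<^sub>m n) = n" if "A \<in> carrier_mat n n" for A :: "complex mat"
      using that unfolding append_rows_def by auto
    note [simp] = Pn[OF Wc] Pn[OF Vc] Pn[OF tc(1)] Pn[OF tc(2)]
    have [simp]: "dim_row K = n" "dim_col K = n" "dim_row M' = n" "dim_col M' = n" "dim_row (minv K) = n" "dim_col (minv K) = n"
      using K M' by auto
    \<comment> \<open>With \<open>V = g W\<close> this gives \<open>\<gamma>' V = \<tau>(g) (h' W) =
      \<tau>(g) \<tau>(W) = \<tau>(V)\<close>, carried out below on stacked matrices.\<close>
    have \<gamma>g: "\<gamma>' * g = (?T * g * ?T) * h'" unfolding h'_def by (simp add: mat_dim_simps Tmat_cancel gi')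
    have "cplx \<gamma>' * (V @\<^sub>r 1\<^sub>m n) = cplx \<gamma>' * (((V @\<^sub>r 1\<^sub>m n) * K) * minv K)"
      using K(3) by (simp add: assoc_mult_mat_dim one_mult_mat_dim)
    also have "\<dots> = (cplx (\<gamma>' * g) * (W @\<^sub>r 1\<^sub>m n)) * minv K"
      unfolding gW[symmetric] by (simp add: cplx_mult assoc_mult_mat_dim)
    also have "cplx (\<gamma>' * g) * (W @\<^sub>r 1\<^sub>m n) = cplx (?T * g * ?T) * (cplx h' * (W @\<^sub>r 1\<^sub>m n))"
      unfolding \<gamma>g by (simp add: cplx_mult assoc_mult_mat_dim)
    also have "\<dots> = (cplx (?T * g * ?T) * (tau_pt W @\<^sub>r 1\<^sub>m n)) * M'"
      unfolding hW by (simp add: assoc_mult_mat_dim)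
    also have "\<dots> = ((tau_pt V @\<^sub>r 1\<^sub>m n) * conj_mat K) * M'"
      unfolding tau_lagrangian[OF gc Wc Vc K(1) gW] ..
    also have "\<dots> * minv K = (tau_pt V @\<^sub>r 1\<^sub>m n) * (conj_mat K * (M' * minv K))"
      by (simp add: assoc_mult_mat_dim)
    finally have e: "cplx \<gamma>' * (V @\<^sub>r 1\<^sub>m n) = (tau_pt V @\<^sub>r 1\<^sub>m n) * (conj_mat K * (M' * minv K))" .
    have "sp_act n \<gamma>' V = tau_pt V"
      by (rule sp_act_eqI[OF \<gamma>'Sp V tc(2) _ e]) (auto intro: carrier_matI)
    then have "V \<in> fixed_set n \<gamma>'" unfolding fixed_set_def using V by simp
    \<comment> \<open>The upper left block of \<open>W\<close> equals \<open>Z\<close>, so the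
      boundary point is approached inside its own fibre, by height alone.\<close>
    then show "\<exists>W. siegel n W \<and> (\<forall>i<n-1. \<forall>j<n-1. cmod (W $$ (i,j) - Z $$ (i,j)) < \<epsilon>) \<and> height n W > t
        \<and> sp_act n g W \<in> (\<Union>\<gamma>'\<in>{\<gamma>'. Gamma_level n (4*m) \<gamma>'}. fixed_set n \<gamma>')"
      using W WZ ht \<gamma>' \<epsilon> unfolding V_def by (intro exI[of _ W]) auto
  qed
qed

end
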